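(* Let $n\ge 2$ and $a_1,a_2\in\mathbb{C}\setminus\mathbb{Z}$, and assume $a_1-a_2\notin\mathbb{Z}$. Then the $\mathfrak{sl}_{2n}$-module $N_{a_1,a_2}$ decomposes as follows as a $\mathfrak{b}\oplus\mathfrak{a}$-module (in each tensor product the first factor is a $\mathfrak{b}$-module and the second an $\mathfrak{a}$-module): 1. If $n=2$, $$N_{a_1,a_2}\cong\bigoplus_{b\in\mathbb{Z}} L(-1-a_1+a_2-2b)\otimes L(a_1-a_2+2b-1).$$ 2. If $n>2$, $$N_{a_1,a_2}\cong\bigoplus_{b\in\mathbb{Z}} L(a_2-b,0,\ldots,0,-1-a_1-b)\otimes L(a_1-a_2+2b-(n-1)).$$
   Context: The module $N_{a_1,a_2}$: let $n\ge 2$, $a_1,a_2\in\mathbb{C}\setminus\mathbb{Z}$ and $a=(-1,\ldots,-1,a_1,a_2,0,\ldots,0)\in\mathbb{C}^{2n}$ (with $n-1$ entries $-1$ and $n-1$ entries $0$). A tuple $\beta\in\mathbb{C}^{2n}$ is admissible if $\beta-a\in\mathbb{Z}^{2n}$, $\beta_i<0$ for $1\le i\le n-1$, $\beta_i\ge 0$ for $n+2\le i\le 2n$, and $\sum_i\beta_i=\sum_i a_i$. $N_{a_1,a_2}$ is the complex vector space with basis $\{x(\beta):\beta \text{ admissible}\}$. With $\epsilon_i$ the standard basis of $\mathbb{C}^{2n}$, put $q_i x(\beta)=(\beta_i+1)x(\beta+\epsilon_i)$ if $\beta_i$ is a negative integer and $q_i x(\beta)=x(\beta+\epsilon_i)$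 otherwise; $p_j x(\beta)=x(\beta-\epsilon_j)$ if $\beta_j$ is a negative integer and $p_jx(\beta)=\beta_j x(\beta-\epsilon_j)$ otherwise (operators on the larger space where the condition on $\sum_i\beta_i$ is dropped; terms with zero coefficient are $0$). $\mathfrak{sl}_{2n}$ acts on $N_{a_1,a_2}$ by letting the elementary matrix $E_{i,j}$ act as $q_ip_j$. Dual pair: $\mathfrak{b}=\{\mathrm{diag}(A,A): A\in\mathfrak{sl}_n\}\cong\mathfrak{sl}_n$ (block diagonal matrices) and $\mathfrak{a}=\langle X,H,Y\rangle\cong\mathfrak{sl}_2$, where $X=\sum_{i=1}^n E_{n+i,i}$, $Y=\sum_{i=1}^n E_{i,n+i}$, $H=\mathrm{diag}(I_n,-I_n)$; they are commuting subalgebras of $\mathfrak{sl}_{2n}$. Highest weight conventions: for $\mathfrak{a}$, $\mathbb{C}H$ is the Cartan subalgebra and $Y$ the raising operator; a weight is given by the eigenvalue of $H$, and $L(\mu)$ is the simple highest weight module of highest weight $\mu\in\mathbb{C}$. For $\mathfrak{b}$, the Cartan subalgebra is that of diagonal matrices, the positive part is $\mathfrak{b}^+=\{\mathrm{diag}(A,A): A \text{ strictly upper triangular}\}$, and a weight is given by the tuple of eigenvalues of $H_1,\ldots,H_{n-1}$, where $H_i=\mathrm{diag}(h_i,h_i)$, $h_i=E_{i,i}-E_{i+1,i+1}\in\mathfrak{sl}_n$; $L(\mu_1,\ldots,\mu_{n-1})$ is the simple highest weight $\mathfrak{b}$-module with that highest weight (for $n=2$, $L(\mu_1)$). *)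

theory Defs
  imports
    "Jordan_Normal_Form.VS_Connect"
    "HOL-Algebra.AbelCoset"
    "HOL-Library.Poly_Mapping"
begin

section \<open>Representations with explicit carriers\<close>

text \<open>A representation of a Lie algebra whose elements have type \<open>'g\<close> is a complex vector space
  (a module over \<^term>\<open>class_ring :: complex ring\<close>; the record fields \<open>mult\<close> and \<open>one\<close> are
  irrelevant) with an operator for every \<open>x :: 'g\<close>.  The Lie algebra itself, a set of elements
  of \<open>'g\<close>, is passed separately.\<close>

record ('g, 'v) rep = "(complex, 'v) module" +
  act :: "'g \<Rightarrow> 'v \<Rightarrow> 'v"

abbreviation cspan :: "(complex, 'v, 'z) module_scheme \<Rightarrow> 'v set \<Rightarrow> 'v set" where
  "cspan \<equiv> LinearCombinations.module.span class_ring"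

definition subrep :: "'g set \<Rightarrow> ('g, 'v) rep \<Rightarrow> 'v set \<Rightarrow> bool" where
  "subrep g V S \<longleftrightarrow> LinearCombinations.submodule class_ring S V \<and> (\<forall>x\<in>g. \<forall>v\<in>S. act V x v \<in> S)"

definition generated_subrep :: "'g set \<Rightarrow> ('g, 'v) rep \<Rightarrow> 'v set \<Rightarrow> 'v set" where
  "generated_subrep g V X = \<Inter>{S. subrep g V S \<and> X \<subseteq> S}"

text \<open>The quotient by an invariant subspace \<open>S\<close>, on the cosets of \<open>S\<close>.\<close>

definition quotient_rep :: "('g, 'v) rep \<Rightarrow> 'v set \<Rightarrow> ('g, 'v set) rep" where
  "quotient_rep V S =
    \<lparr>carrier = a_rcosets\<^bsub>V\<^esub> S, mult = undefined, one = undefined,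
     zero = S, add = (\<lambda>C D. C <+>\<^bsub>V\<^esub> D),
     smult = (\<lambda>c C. \<Union>v\<in>C. S +>\<^bsub>V\<^esub> (c \<odot>\<^bsub>V\<^esub> v)),
     act = (\<lambda>x C. \<Union>v\<in>C. S +>\<^bsub>V\<^esub> (act V x v))\<rparr>"

definition pullback_rep :: "('h \<Rightarrow> 'g) \<Rightarrow> ('g, 'v) rep \<Rightarrow> ('h, 'v) rep" where
  "pullback_rep \<phi> V =
    \<lparr>carrier = carrier V, mult = mult V, one = one V, zero = zero V, add = add V,
     smult = smult V, act = (\<lambda>x. act V (\<phi> x))\<rparr>"

text \<open>The direct sum of a family: finitely supported families of vectors.\<close>

definition direct_sum_rep :: "('i \<Rightarrow> ('g, 'v) rep) \<Rightarrow> ('g, 'i \<Rightarrow> 'v) rep" where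
  "direct_sum_rep V =
    \<lparr>carrier = {f. (\<forall>i. f i \<in> carrier (V i)) \<and> finite {i. f i \<noteq> \<zero>\<^bsub>V i\<^esub>}},
     mult = undefined, one = undefined,
     zero = (\<lambda>i. \<zero>\<^bsub>V i\<^esub>), add = (\<lambda>f f' i. f i \<oplus>\<^bsub>V i\<^esub> f' i),
     smult = (\<lambda>c f i. c \<odot>\<^bsub>V i\<^esub> f i),
     act = (\<lambda>x f i. act (V i) x (f i))\<rparr>"

definition isomorphic_rep :: "'g set \<Rightarrow> ('g, 'v) rep \<Rightarrow> ('g, 'w) rep \<Rightarrow> bool" where
  "isomorphic_rep g V W \<longleftrightarrow>
    (\<exists>\<phi> \<in> LinearCombinations.module_hom class_ring V W. bij_betw \<phi> (carrier V) (carrier W) \<and>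
      (\<forall>x\<in>g. \<forall>v\<in>carrier V. \<phi> (act V x v) = act W x (\<phi> v)))"


section \<open>Free vector spaces and tensor products\<close>

definition fscale :: "complex \<Rightarrow> ('b \<Rightarrow>\<^sub>0 complex) \<Rightarrow> ('b \<Rightarrow>\<^sub>0 complex)" where
  "fscale c f = Poly_Mapping.map ((*) c) f"

definition linear_extension ::
  "('b \<Rightarrow> ('c \<Rightarrow>\<^sub>0 complex)) \<Rightarrow> ('b \<Rightarrow>\<^sub>0 complex) \<Rightarrow> ('c \<Rightarrow>\<^sub>0 complex)" where
  "linear_extension \<phi> f =
    (\<Sum>b\<in>Poly_Mapping.keys f. fscale (Poly_Mapping.lookup f b) (\<phi> b))"

text \<open>The vector space with basis \<open>B\<close>, the basis vector of \<open>b\<close> being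
  \<open>Poly_Mapping.single b 1\<close>.\<close>

definition free_rep ::
  "'b set \<Rightarrow> ('g \<Rightarrow> ('b \<Rightarrow>\<^sub>0 complex) \<Rightarrow> ('b \<Rightarrow>\<^sub>0 complex)) \<Rightarrow> ('g, 'b \<Rightarrow>\<^sub>0 complex) rep" where
  "free_rep B \<rho> =
    \<lparr>carrier = {f. Poly_Mapping.keys f \<subseteq> B}, mult = undefined, one = undefined,
     zero = 0, add = (+), smult = fscale, act = \<rho>\<rparr>"

text \<open>\<open>V \<otimes> W\<close> as a representation of the direct sum of the two Lie algebras, whose elements
  are pairs: the free vector space on \<open>carrier V \<times> carrier W\<close> modulo the bilinearity relations,
  with \<open>(x, y) \<sqdot> (v \<otimes> w) = x \<sqdot> v \<otimes> w + v \<otimes> y \<sqdot> w\<close>.\<close>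

definition free_pairs_rep ::
  "('g, 'v) rep \<Rightarrow> ('h, 'w) rep \<Rightarrow> ('g \<times> 'h, ('v \<times> 'w) \<Rightarrow>\<^sub>0 complex) rep" where
  "free_pairs_rep V W = free_rep (carrier V \<times> carrier W)
    (\<lambda>(x, y). linear_extension (\<lambda>(v, w).
      Poly_Mapping.single (act V x v, w) 1 + Poly_Mapping.single (v, act W y w) 1))"

definition bilinearity_relations ::
  "('g, 'v) rep \<Rightarrow> ('h, 'w) rep \<Rightarrow> (('v \<times> 'w) \<Rightarrow>\<^sub>0 complex) set" where
  "bilinearity_relations V W =
    {Poly_Mapping.single (v \<oplus>\<^bsub>V\<^esub> v', w) 1 - Poly_Mapping.single (v, w) 1
       - Poly_Mapping.single (v', w) 1 | v v' w.
       v \<in> carrier V \<and> v' \<in> carrier V \<and> w \<in> carrier W} \<union>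
    {Poly_Mapping.single (v, w \<oplus>\<^bsub>W\<^esub> w') 1 - Poly_Mapping.single (v, w) 1
       - Poly_Mapping.single (v, w') 1 | v w w'.
       v \<in> carrier V \<and> w \<in> carrier W \<and> w' \<in> carrier W} \<union>
    {Poly_Mapping.single (c \<odot>\<^bsub>V\<^esub> v, w) 1 - Poly_Mapping.single (v, w) c | c v w.
       v \<in> carrier V \<and> w \<in> carrier W} \<union>
    {Poly_Mapping.single (v, c \<odot>\<^bsub>W\<^esub> w) 1 - Poly_Mapping.single (v, w) c | c v w.
       v \<in> carrier V \<and> w \<in> carrier W}"

definition tensor_rep ::
  "('g, 'v) rep \<Rightarrow> ('h, 'w) rep \<Rightarrow> ('g \<times> 'h, (('v \<times> 'w) \<Rightarrow>\<^sub>0 complex) set) rep" where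
  "tensor_rep V W = quotient_rep (free_pairs_rep V W)
    (cspan (free_pairs_rep V W) (bilinearity_relations V W))"


section \<open>Simple highest weight modules\<close>

text \<open>Let \<open>g\<close> be a Lie algebra of complex matrices.  Its universal enveloping algebra is the
  free associative algebra on the set \<open>g\<close> (with basis the words over \<open>g\<close>) modulo the two-sided
  ideal that identifies linear combinations and commutators of letters with those formed in \<open>g\<close>.
  It is a representation of \<open>g\<close> by left multiplication.\<close>

definition words_rep :: "complex mat set \<Rightarrow> (complex mat, complex mat list \<Rightarrow>\<^sub>0 complex) rep" where
  "words_rep g = free_rep (lists g)
    (\<lambda>x. linear_extension (\<lambda>w. Poly_Mapping.single (x # w) 1))"

definition enveloping_relations :: "complex mat set \<Rightarrow> (complex mat list \<Rightarrow>\<^sub>0 complex) set" where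
  "enveloping_relations g =
    {Poly_Mapping.single (u @ [c \<cdot>\<^sub>m x + d \<cdot>\<^sub>m y] @ w) 1 - Poly_Mapping.single (u @ [x] @ w) c
       - Poly_Mapping.single (u @ [y] @ w) d | u w x y c d.
       u \<in> lists g \<and> w \<in> lists g \<and> x \<in> g \<and> y \<in> g} \<union>
    {Poly_Mapping.single (u @ [x, y] @ w) 1 - Poly_Mapping.single (u @ [y, x] @ w) 1
       - Poly_Mapping.single (u @ [x * y - y * x] @ w) 1 | u w x y.
       u \<in> lists g \<and> w \<in> lists g \<and> x \<in> g \<and> y \<in> g}"

definition enveloping_ideal :: "complex mat set \<Rightarrow> (complex mat list \<Rightarrow>\<^sub>0 complex) set" where
  "enveloping_ideal g = cspan (words_rep g) (enveloping_relations g)"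

definition enveloping_rep ::
  "complex mat set \<Rightarrow> (complex mat, (complex mat list \<Rightarrow>\<^sub>0 complex) set) rep" where
  "enveloping_rep g = quotient_rep (words_rep g) (enveloping_ideal g)"

definition enveloping_class ::
  "complex mat set \<Rightarrow> (complex mat list \<Rightarrow>\<^sub>0 complex) \<Rightarrow> (complex mat list \<Rightarrow>\<^sub>0 complex) set" where
  "enveloping_class g f = enveloping_ideal g +>\<^bsub>words_rep g\<^esub> f"

text \<open>In the following, \<open>np\<close> is the positive part of \<open>g\<close>, and \<open>hw\<close> describes the highest weight:
  it consists of pairs \<open>(h, c)\<close>, where the elements \<open>h\<close> span the Cartan subalgebra and \<open>c\<close> is the
  eigenvalue of \<open>h\<close>.  The Verma module is the enveloping algebra modulo the left ideal generated by
  \<open>np\<close> and the elements \<open>h - c\<close>.\<close>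

definition verma_rep ::
  "complex mat set \<Rightarrow> complex mat set \<Rightarrow> (complex mat \<times> complex) set \<Rightarrow>
    (complex mat, (complex mat list \<Rightarrow>\<^sub>0 complex) set set) rep" where
  "verma_rep g np hw = quotient_rep (enveloping_rep g)
    (generated_subrep g (enveloping_rep g)
      ({enveloping_class g (Poly_Mapping.single [x] 1) | x. x \<in> np} \<union>
       {enveloping_class g (Poly_Mapping.single [h] 1 - Poly_Mapping.single [] c) | h c.
          (h, c) \<in> hw}))"

text \<open>The simple highest weight module is the Verma module modulo the sum of all its proper
  submodules.\<close>

definition simple_hw_rep ::
  "complex mat set \<Rightarrow> complex mat set \<Rightarrow> (complex mat \<times> complex) set \<Rightarrow>
    (complex mat, (complex mat list \<Rightarrow>\<^sub>0 complex) set set set) rep" where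
  "simple_hw_rep g np hw = (let M = verma_rep g np hw in
    quotient_rep M (cspan M (\<Union>{S. subrep g M S \<and> S \<noteq> carrier M})))"


section \<open>The dual pair\<close>

text \<open>Rows and columns of matrices, and entries of tuples, are numbered from 0.\<close>

definition sl :: "nat \<Rightarrow> complex mat set" where
  "sl m = {A \<in> carrier_mat m m. (\<Sum>i<m. A $$ (i, i)) = 0}"

definition diag2 :: "nat \<Rightarrow> complex mat \<Rightarrow> complex mat" where
  "diag2 n A = four_block_mat A (0\<^sub>m n n) (0\<^sub>m n n) A"

definition alg_b :: "nat \<Rightarrow> complex mat set" where
  "alg_b n = diag2 n ` sl n"

definition pos_b :: "nat \<Rightarrow> complex mat set" where
  "pos_b n = diag2 n ` {A \<in> carrier_mat n n. \<forall>i<n. \<forall>j<n. j \<le> i \<longrightarrow> A $$ (i, j) = 0}"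

definition coroot :: "nat \<Rightarrow> nat \<Rightarrow> complex mat" where
  "coroot n i = mat n n (\<lambda>(k, l).
    if k = l \<and> k = i then 1 else if k = l \<and> k = i + 1 then -1 else 0)"

definition mat_X :: "nat \<Rightarrow> complex mat" where
  "mat_X n = four_block_mat (0\<^sub>m n n) (0\<^sub>m n n) (1\<^sub>m n) (0\<^sub>m n n)"

definition mat_Y :: "nat \<Rightarrow> complex mat" where
  "mat_Y n = four_block_mat (0\<^sub>m n n) (1\<^sub>m n) (0\<^sub>m n n) (0\<^sub>m n n)"

definition mat_H :: "nat \<Rightarrow> complex mat" where
  "mat_H n = four_block_mat (1\<^sub>m n) (0\<^sub>m n n) (0\<^sub>m n n) (- 1\<^sub>m n)"

definition alg_a :: "nat \<Rightarrow> complex mat set" where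
  "alg_a n = {x \<cdot>\<^sub>m mat_X n + h \<cdot>\<^sub>m mat_H n + y \<cdot>\<^sub>m mat_Y n | x h y. True}"

text \<open>\<open>L_b n \<mu>\<close> is used for lists \<open>\<mu>\<close> of length \<open>n - 1\<close>.\<close>

definition L_b ::
  "nat \<Rightarrow> complex list \<Rightarrow> (complex mat, (complex mat list \<Rightarrow>\<^sub>0 complex) set set set) rep" where
  "L_b n \<mu> = simple_hw_rep (alg_b n) (pos_b n)
    {(diag2 n (coroot n i), \<mu> ! i) | i. i < n - 1}"

definition L_a ::
  "nat \<Rightarrow> complex \<Rightarrow> (complex mat, (complex mat list \<Rightarrow>\<^sub>0 complex) set set set) rep" where
  "L_a n \<mu> = simple_hw_rep (alg_a n) {mat_Y n} {(mat_H n, \<mu>)}"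


section \<open>The module \<open>N\<close>\<close>

definition neg_int :: "complex \<Rightarrow> bool" where
  "neg_int z \<longleftrightarrow> (\<exists>k::int. k < 0 \<and> z = of_int k)"

definition base_tuple :: "nat \<Rightarrow> complex \<Rightarrow> complex \<Rightarrow> complex vec" where
  "base_tuple n a1 a2 = vec (2 * n) (\<lambda>i.
    if i < n - 1 then -1 else if i = n - 1 then a1 else if i = n then a2 else 0)"

definition admissible :: "nat \<Rightarrow> complex \<Rightarrow> complex \<Rightarrow> complex vec set" where
  "admissible n a1 a2 = {\<beta> \<in> carrier_vec (2 * n).
    (\<forall>i<2 * n. \<beta> $ i - base_tuple n a1 a2 $ i \<in> \<int>) \<and>
    (\<forall>i<n - 1. neg_int (\<beta> $ i)) \<and>
    (\<forall>i\<in>{n + 1..<2 * n}. \<beta> $ i \<in> \<nat>) \<and>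
    (\<Sum>i<2 * n. \<beta> $ i) = (\<Sum>i<2 * n. base_tuple n a1 a2 $ i)}"

definition q_op :: "nat \<Rightarrow> nat \<Rightarrow> (complex vec \<Rightarrow>\<^sub>0 complex) \<Rightarrow> (complex vec \<Rightarrow>\<^sub>0 complex)" where
  "q_op m i = linear_extension (\<lambda>\<beta>.
    Poly_Mapping.single (\<beta> + unit_vec m i) (if neg_int (\<beta> $ i) then \<beta> $ i + 1 else 1))"

definition p_op :: "nat \<Rightarrow> nat \<Rightarrow> (complex vec \<Rightarrow>\<^sub>0 complex) \<Rightarrow> (complex vec \<Rightarrow>\<^sub>0 complex)" where
  "p_op m j = linear_extension (\<lambda>\<beta>.
    Poly_Mapping.single (\<beta> - unit_vec m j) (if neg_int (\<beta> $ j) then 1 else \<beta> $ j))"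

definition N_rep ::
  "nat \<Rightarrow> complex \<Rightarrow> complex \<Rightarrow> (complex mat, complex vec \<Rightarrow>\<^sub>0 complex) rep" where
  "N_rep n a1 a2 = free_rep (admissible n a1 a2)
    (\<lambda>A f. \<Sum>i<2 * n. \<Sum>j<2 * n. fscale (A $$ (i, j)) (q_op (2 * n) i (p_op (2 * n) j f)))"

text \<open>The restriction of \<open>N\<close> to the direct sum of \<open>alg_b n\<close> and \<open>alg_a n\<close>, whose elements are pairs
  \<open>(B, A)\<close>, embedded by \<open>(B, A) \<mapsto> B + A\<close>.\<close>

definition N_ba_rep ::
  "nat \<Rightarrow> complex \<Rightarrow> complex \<Rightarrow> (complex mat \<times> complex mat, complex vec \<Rightarrow>\<^sub>0 complex) rep" where
  "N_ba_rep n a1 a2 = pullback_rep (\<lambda>(B, A). B + A) (N_rep n a1 a2)"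

end

theory Submission imports Defs begin

text \<open>
  Write \<open>x\<^sub>1, \<dots>, x\<^sub>n, y\<^sub>1, \<dots>, y\<^sub>n\<close> for the \<open>2n\<close> variables.  In \<open>N\<close> the exponents of
  \<open>x\<^sub>1, \<dots>, x\<^bsub>n-1\<^esub>\<close> are negative integers, those of \<open>y\<^sub>2, \<dots>, y\<^sub>n\<close> are natural numbers, and those of
  \<open>x\<^sub>n\<close> and \<open>y\<^sub>1\<close> lie in two cosets of nonintegral numbers.  The algebra \<open>\<bb>\<close> acts through
  \<open>x\<^sub>i\<partial>/\<partial>x\<^sub>j + y\<^sub>i\<partial>/\<partial>y\<^sub>j\<close>, and \<open>\<aa>\<close> through \<open>Y = \<Sum> x\<^sub>i\<partial>/\<partial>y\<^sub>i\<close>, \<open>X = \<Sum> y\<^sub>i\<partial>/\<partial>x\<^sub>i\<close> and \<open>H\<close>.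

  Grade \<open>N\<close> by the total degree in the \<open>x\<^sub>i\<close>, that is \<open>a\<^sub>1 - (n-1) + b\<close> for an integer \<open>b\<close>.  On this
  piece \<open>H\<close> is the scalar \<open>\<mu>\<^sub>b = a\<^sub>1 - a\<^sub>2 + 2b - (n-1)\<close>, which is not an integer.  Let \<open>K\<^sub>b\<close> be the
  kernel of \<open>Y\<close> in degree \<open>b\<close>; it is a \<open>\<bb>\<close>-module since \<open>\<aa>\<close> and \<open>\<bb>\<close> commute.  On \<open>K\<^sub>b\<close> one has
  \<open>Y X\<^bsup>k+1\<^esup> = (k+1)(\<mu>\<^sub>b - k) X\<^sup>k\<close> with nonzero coefficients, so \<open>X\<close> is injective on the sum of all
  \<open>X\<^sup>k K\<^sub>b\<close> and this sum is direct (\<open>X_pow_independent\<close>).  It remains to see that it is all of \<open>N\<close>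
  and that \<open>K\<^sub>b\<close> is the simple module with the highest weight vector
  \<open>v\<^sub>b = (x\<^sub>1\<cdots>x\<^bsub>n-1\<^esub>)\<^bsup>-1\<^esup> x\<^sub>n\<^bsup>a\<^sub>1+b\<^esup> y\<^sub>1\<^bsup>a\<^sub>2-b\<^esup>\<close>.

  Both follow from one computation (\<open>reach\<close>).  The monomials carry a level, a natural number that \<open>X\<close>
  and the strictly lower triangular part of \<open>\<bb>\<close> increase, and every monomial other than the \<open>v\<^sub>b\<close> is
  a combination of images under these operators of vectors of lower level.  The only denominator
  involving both parameters has the form \<open>a\<^sub>2 - a\<^sub>1\<close> plus an integer, which is where
  \<open>a\<^sub>1 - a\<^sub>2 \<notin> \<int>\<close> enters.  First, by induction on the level, the \<open>v\<^sub>b\<close> generate \<open>N\<close>: if \<open>S\<^sub>b \<subseteq> K\<^sub>b\<close>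
  are \<open>\<bb>\<close>-submodules containing the \<open>v\<^sub>b\<close>, then the \<open>X\<^sup>k S\<^sub>b\<close> span \<open>N\<close> (\<open>N_span\<close>).  Second, a form on
  \<open>N\<close> that makes the monomials orthogonal turns lowering into raising operators, so a vector killed
  by \<open>Y\<close> and by the strictly upper triangular part of \<open>\<bb>\<close> is orthogonal to every monomial other than
  the \<open>v\<^sub>b\<close> (\<open>singular_support\<close>).  Hence a nonzero \<open>\<bb>\<close>-submodule \<open>S\<close> of \<open>K\<^sub>b\<close>, whose vectors of minimal level
  are singular, contains \<open>v\<^sub>b\<close>; then \<open>S\<close> and the other \<open>K\<^sub>c\<close> together generate \<open>N\<close>, and directness
  of the sum forces \<open>S = K\<^sub>b\<close> (\<open>K_simple\<close>).

  On the other side, \<open>L(\<mu>\<^sub>b)\<close> has the basis \<open>X\<^sup>k\<close> applied to its highest weight vector, because the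
  Verma module with a nonintegral highest weight is simple.  The isomorphism of the theorem sends
  \<open>f \<otimes> X\<^sup>k w\<close>, for \<open>f \<in> K\<^sub>b\<close> and the highest weight vector \<open>w\<close>, to \<open>X\<^sup>k f\<close>.

  The simple highest weight modules and the tensor products of the statement are iterated quotients
  of free vector spaces.  All of them are handled as images of a fixed subspace of a free space
  (\<open>presented_rep\<close>); each further quotient only enlarges a kernel, and to identify a module one
  computes this kernel.  For a simple highest weight module it is the annihilator of a highest weight
  vector in any simple module with that weight (\<open>simple_hw_rep_identified\<close>).
\<close>

section \<open>Free vector spaces\<close>

abbreviation "single \<equiv> Poly_Mapping.single"
abbreviation "lookup \<equiv> Poly_Mapping.lookup"
abbreviation "keys \<equiv> Poly_Mapping.keys"

lemma lookup_fscale [simp]: "lookup (fscale c f) b = c * lookup f b"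
  by (auto simp: fscale_def Poly_Mapping.map.rep_eq when_def)

interpretation fs: vector_space "fscale :: complex \<Rightarrow> ('b \<Rightarrow>\<^sub>0 complex) \<Rightarrow> _"
  by unfold_locales (auto intro!: poly_mapping_eqI simp: lookup_add algebra_simps)

interpretation fs2: vector_space_pair
  "fscale :: complex \<Rightarrow> ('b \<Rightarrow>\<^sub>0 complex) \<Rightarrow> _" "fscale :: complex \<Rightarrow> ('c \<Rightarrow>\<^sub>0 complex) \<Rightarrow> _"
  by unfold_locales

abbreviation flinear :: "(('b \<Rightarrow>\<^sub>0 complex) \<Rightarrow> ('c \<Rightarrow>\<^sub>0 complex)) \<Rightarrow> bool" where
  "flinear \<equiv> Vector_Spaces.linear fscale fscale"

lemma flinearI:
  assumes "\<And>f g. T (f + g) = T f + T g" "\<And>c f. T (fscale c f) = fscale c (T f)"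
  shows "flinear T"
  using assms by unfold_locales

lemmas flinear_simps = fs2.linear_add fs2.linear_scale fs2.linear_0 fs2.linear_diff fs2.linear_neg

lemma flinear_compose: "flinear S \<Longrightarrow> flinear T \<Longrightarrow> flinear (\<lambda>f. T (S f))"
  by (rule flinearI) (simp_all add: flinear_simps)

lemma flinear_id: "flinear (\<lambda>f. f)"
  by (rule flinearI) simp_all

lemma flinear_zero: "flinear (\<lambda>f. 0)"
  by (rule flinearI) simp_all

lemma flinear_add: "flinear S \<Longrightarrow> flinear T \<Longrightarrow> flinear (\<lambda>f. S f + T f)"
  by (rule flinearI) (simp_all add: flinear_simps fs.scale_right_distrib)

lemma flinear_diff: "flinear S \<Longrightarrow> flinear T \<Longrightarrow> flinear (\<lambda>f. S f - T f)"
  by (rule flinearI) (simp_all add: flinear_simps fs.scale_right_diff_distrib)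

lemma flinear_scale: "flinear S \<Longrightarrow> flinear (\<lambda>f. fscale c (S f))"
  by (rule flinearI) (simp_all add: flinear_simps fs.scale_right_distrib mult.commute)

lemma flinear_sum: "(\<And>i. i \<in> I \<Longrightarrow> flinear (T i)) \<Longrightarrow> flinear (\<lambda>f. \<Sum>i\<in>I. T i f)"
  by (rule flinearI) (simp_all add: flinear_simps fs.scale_sum_right sum.distrib)

lemma linear_extension_single [simp]:
  "linear_extension \<phi> (single b c) = fscale c (\<phi> b)"
  by (cases "c = 0") (simp_all add: linear_extension_def)

lemma linear_extension_superset:
  assumes "finite A" "keys f \<subseteq> A"
  shows "linear_extension \<phi> f = (\<Sum>b\<in>A. fscale (lookup f b) (\<phi> b))"
  unfolding linear_extension_def
  by (rule sum.mono_neutral_left) (use assms in \<open>auto simp: in_keys_iff\<close>)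

lemma flinear_linear_extension: "flinear (linear_extension \<phi>)"
proof (rule flinearI)
  fix f g :: "'a \<Rightarrow>\<^sub>0 complex" and c
  let ?A = "keys f \<union> keys g"
  show "linear_extension \<phi> (f + g) = linear_extension \<phi> f + linear_extension \<phi> g"
    using keys_add[of f g]
    by (simp add: linear_extension_superset[of ?A] lookup_add fs.scale_left_distrib sum.distrib)
  have "keys (fscale c f) \<subseteq> keys f"
    by (auto simp: in_keys_iff)
  then show "linear_extension \<phi> (fscale c f) = fscale c (linear_extension \<phi> f)"
    by (simp add: linear_extension_superset[of "keys f"] fs.scale_sum_right)
qed

definition supported :: "'b set \<Rightarrow> ('b \<Rightarrow>\<^sub>0 complex) set" where
  "supported B = {f. keys f \<subseteq> B}"

lemma subspace_supported: "fs.subspace (supported B)"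
  by (rule fs.subspaceI) (auto simp: supported_def in_keys_iff lookup_add subset_iff, metis add_0)

lemma single_supported: "b \<in> B \<Longrightarrow> single b c \<in> supported B"
  by (auto simp: supported_def)

lemma single_eq_fscale: "single b c = fscale c (single b 1)"
  by (rule poly_mapping_eqI) (simp add: lookup_single when_def)

lemma sum_of_singles:
  "f = (\<Sum>b\<in>keys f. fscale (lookup f b) (single b 1))"
  by (rule poly_mapping_eqI)
     (simp add: lookup_sum lookup_single when_def in_keys_iff if_distrib cong: if_cong)

lemma supported_subset:
  assumes "fs.subspace P" "\<And>b. b \<in> B \<Longrightarrow> single b 1 \<in> P"
  shows "supported B \<subseteq> P"
proof
  fix f assume f: "f \<in> supported B"
  then have "(\<Sum>b\<in>keys f.
      fscale (lookup f b) (single b 1)) \<in> P"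
    by (intro fs.subspace_sum[OF assms(1)] fs.subspace_scale[OF assms(1)] assms(2))
       (auto simp: supported_def)
  then show "f \<in> P" using sum_of_singles[of f] by simp
qed

lemma flinear_eq_on_supported:
  assumes "flinear S" "flinear T" "f \<in> supported B"
    and "\<And>b. b \<in> B \<Longrightarrow> S (single b 1) = T (single b 1)"
  shows "S f = T f"
proof -
  have "supported B \<subseteq> {f. S f = T f}"
  proof (rule supported_subset)
    show "fs.subspace {f. S f = T f}"
      by (rule fs.subspaceI) (use assms(1,2) in \<open>auto simp: flinear_simps\<close>)
  qed (use assms(4) in auto)
  then show ?thesis using assms(3) by auto
qed

lemma flinear_maps_supported:
  assumes "flinear T" "fs.subspace P" "f \<in> supported B"
    and "\<And>b. b \<in> B \<Longrightarrow> T (single b 1) \<in> P"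
  shows "T f \<in> P"
proof -
  have "supported B \<subseteq> {f. T f \<in> P}"
  proof (rule supported_subset)
    show "fs.subspace {f. T f \<in> P}"
      by (rule fs.subspaceI)
         (use assms(1,2) in \<open>auto simp: flinear_simps fs.subspace_0 fs.subspace_add fs.subspace_scale\<close>)
  qed (use assms(4) in auto)
  then show ?thesis using assms(3) by auto
qed

section \<open>Presented and identified representations\<close>

text \<open>The operators \<open>\<rho>\<close> live on the free space and are linear everywhere, whereas \<open>V\<close> may be a set of
  cosets of cosets.  Keeping \<open>A\<close> and \<open>\<rho>\<close> fixed while \<open>V\<close> and \<open>\<pi>\<close> change allows all computations to
  take place in \<open>A\<close>.\<close>

locale presented_rep =
  fixes g :: "'g set" and V :: "('g, 'v) rep" (structure)
    and A :: "('b \<Rightarrow>\<^sub>0 complex) set" and \<pi> :: "('b \<Rightarrow>\<^sub>0 complex) \<Rightarrow> 'v"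
    and \<rho> :: "'g \<Rightarrow> ('b \<Rightarrow>\<^sub>0 complex) \<Rightarrow> ('b \<Rightarrow>\<^sub>0 complex)"
  assumes subspace: "fs.subspace A"
    and image: "\<pi> ` A = carrier V"
    and proj_add: "\<And>f f'. f \<in> A \<Longrightarrow> f' \<in> A \<Longrightarrow> \<pi> (f + f') = \<pi> f \<oplus> \<pi> f'"
    and proj_scale: "\<And>c f. f \<in> A \<Longrightarrow> \<pi> (fscale c f) = c \<odot>\<^bsub>V\<^esub> \<pi> f"
    and proj_zero: "\<pi> 0 = \<zero>"
    and linear: "\<And>x. x \<in> g \<Longrightarrow> flinear (\<rho> x)"
    and closed: "\<And>x f. x \<in> g \<Longrightarrow> f \<in> A \<Longrightarrow> \<rho> x f \<in> A"
    and proj_act: "\<And>x f. x \<in> g \<Longrightarrow> f \<in> A \<Longrightarrow> \<pi> (\<rho> x f) = act V x (\<pi> f)"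
begin

lemma proj_carrier: "f \<in> A \<Longrightarrow> \<pi> f \<in> carrier V"
  using image by auto

lemma carrierE:
  assumes "v \<in> carrier V" obtains f where "f \<in> A" "v = \<pi> f"
  using assms image by auto

lemmas sub_closed = fs.subspace_add[OF subspace] fs.subspace_scale[OF subspace]
  fs.subspace_0[OF subspace] fs.subspace_diff[OF subspace] fs.subspace_neg[OF subspace]

lemma abelian_group: "abelian_group V"
proof (rule abelian_groupI)
  fix x assume "x \<in> carrier V"
  then obtain f where f: "f \<in> A" "x = \<pi> f" by (rule carrierE)
  have "\<pi> (- f) \<oplus> x = \<zero>"
    using f proj_add[of "-f" f] by (simp add: sub_closed proj_zero)
  then show "\<exists>y\<in>carrier V. y \<oplus> x = \<zero>"
    using f by (metis proj_carrier sub_closed(5))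
next
  fix x y z assume "x \<in> carrier V" "y \<in> carrier V" "z \<in> carrier V"
  then obtain f f' f'' where "f \<in> A" "f' \<in> A" "f'' \<in> A" "x = \<pi> f" "y = \<pi> f'" "z = \<pi> f''"
    by (metis carrierE)
  then show "x \<oplus> y \<oplus> z = x \<oplus> (y \<oplus> z)"
    by (simp add: sub_closed add.assoc flip: proj_add)
next
  fix x y assume "x \<in> carrier V" "y \<in> carrier V"
  then obtain f f' where "f \<in> A" "f' \<in> A" "x = \<pi> f" "y = \<pi> f'"
    by (metis carrierE)
  then show "x \<oplus> y = y \<oplus> x" "x \<oplus> y \<in> carrier V"
    by (simp_all add: sub_closed add.commute proj_carrier flip: proj_add)
next
  show "\<zero> \<in> carrier V"
    using proj_carrier[of 0] by (simp add: sub_closed proj_zero)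
next
  fix x assume "x \<in> carrier V"
  then obtain f where f: "f \<in> A" "x = \<pi> f" by (rule carrierE)
  then show "\<zero> \<oplus> x = x"
    using proj_add[of 0 f] by (simp add: sub_closed proj_zero)
qed

lemma is_module: "Module.module class_ring V"
proof -
  interpret abelian_group V by (rule abelian_group)
  show ?thesis
  proof (unfold_locales, goal_cases)
    case (1 a x) then show ?case
      by (auto elim!: carrierE simp: proj_carrier sub_closed simp flip: proj_scale)
  next
    case (2 a b x) then show ?case
      by (auto elim!: carrierE simp: sub_closed fs.scale_left_distrib simp flip: proj_scale proj_add)
  next
    case (3 a x y) then show ?case
      by (auto elim!: carrierE simp: sub_closed fs.scale_right_distrib simp flip: proj_scale proj_add)
  next
    case (4 a b x) then show ?case
      by (auto elim!: carrierE simp: sub_closed simp flip: proj_scale)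
  next
    case (5 x) then show ?case
      by (auto elim!: carrierE simp: sub_closed simp flip: proj_scale)
  qed
qed

text \<open>The next lemmas translate between submodules of \<open>V\<close> and subspaces of \<open>A\<close>, in both directions.\<close>

lemma preimage_subspace:
  assumes "submodule class_ring S V"
  shows "fs.subspace {f \<in> A. \<pi> f \<in> S}"
  using submodule.m_closed[OF assms] submodule.zero_closed[OF assms] submodule.smult_closed[OF assms]
  by (intro fs.subspaceI) (auto simp: sub_closed proj_add proj_scale proj_zero)

lemma image_submodule:
  assumes "fs.subspace B" "B \<subseteq> A"
  shows "submodule class_ring (\<pi> ` B) V"
proof (rule submodule.intro[OF is_module])
  show "\<pi> ` B \<subseteq> carrier V" using assms proj_carrier by auto
  show "\<zero> \<in> \<pi> ` B" using fs.subspace_0[OF assms(1)] proj_zero by force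
next
  fix v w assume "v \<in> \<pi> ` B" "w \<in> \<pi> ` B"
  then obtain f h where "f \<in> B" "h \<in> B" "v = \<pi> f" "w = \<pi> h" by auto
  then show "v \<oplus> w \<in> \<pi> ` B"
    using assms fs.subspace_add[OF assms(1), of f h] by (auto simp: subset_iff simp flip: proj_add)
next
  fix c v assume "v \<in> \<pi> ` B"
  then obtain f where "f \<in> B" "v = \<pi> f" by auto
  then show "c \<odot>\<^bsub>V\<^esub> v \<in> \<pi> ` B"
    using assms fs.subspace_scale[OF assms(1), of f c] by (auto simp: subset_iff simp flip: proj_scale)
qed

lemma preimage_subrep:
  assumes "subrep g V S"
  shows "fs.subspace {f \<in> A. \<pi> f \<in> S}"
    and "\<And>x f. x \<in> g \<Longrightarrow> f \<in> A \<Longrightarrow> \<pi> f \<in> S \<Longrightarrow> \<pi> (\<rho> x f) \<in> S"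
  using assms preimage_subspace by (auto simp: subrep_def proj_act)

lemma image_subrep:
  assumes "fs.subspace B" "B \<subseteq> A" "\<And>x f. x \<in> g \<Longrightarrow> f \<in> B \<Longrightarrow> \<rho> x f \<in> B"
  shows "subrep g V (\<pi> ` B)"
  using image_submodule[OF assms(1,2)] assms(2,3)
  by (auto simp: subrep_def subset_iff image_iff simp flip: proj_act)

lemma proj_diff_zero:
  assumes "f \<in> A" "h \<in> A" shows "\<pi> f = \<pi> h \<longleftrightarrow> \<pi> (f - h) = \<zero>"
proof -
  interpret abelian_group V by (rule abelian_group)
  have "\<pi> f = \<pi> (f - h) \<oplus> \<pi> h"
    using proj_add[of "f - h" h] assms by (simp add: sub_closed)
  then show ?thesis
    using assms proj_carrier sub_closed(4)[of f h] by (auto simp: proj_carrier)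
qed

lemma cspan_eq: 
  assumes "X \<subseteq> carrier V"
  shows "submodule class_ring (cspan V X) V" "X \<subseteq> cspan V X"
    "\<And>S. submodule class_ring S V \<Longrightarrow> X \<subseteq> S \<Longrightarrow> cspan V X \<subseteq> S"
proof -
  interpret M: Module.module class_ring V by (rule is_module)
  show "submodule class_ring (cspan V X) V" "X \<subseteq> cspan V X"
    "\<And>S. submodule class_ring S V \<Longrightarrow> X \<subseteq> S \<Longrightarrow> cspan V X \<subseteq> S"
    using M.span_is_submodule[OF assms] M.in_own_span[OF assms] M.span_is_subset by auto
qed

text \<open>Passing to a quotient only enlarges the kernel of the presentation.\<close>

lemma quotient:
  assumes S: "submodule class_ring S V"
    and inv: "\<And>x v. x \<in> g \<Longrightarrow> v \<in> S \<Longrightarrow> act V x v \<in> S"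
  shows "presented_rep g (quotient_rep V S) A (\<lambda>f. S +> \<pi> f) \<rho>"
    and "f \<in> A \<Longrightarrow> S +> \<pi> f = \<zero>\<^bsub>quotient_rep V S\<^esub> \<longleftrightarrow> \<pi> f \<in> S"
proof -
  interpret M: Module.module class_ring V by (rule is_module)
  interpret abelian_subgroup S V
    by (rule abelian_subgroupI3)
       (use S in \<open>auto simp: subgroup_def submodule_def additive_subgroup_def M.abelian_group_axioms\<close>,
        metis M.smult_minus_1 UNIV_I a_inv_def partial_object.select_convs(1) submodule.smult_closed[OF S] subsetD)
  have SV: "S \<subseteq> carrier V" using S by (simp add: submodule_def)
  have eq: "S +> \<pi> f = S +> \<pi> h" if "f \<in> A" "h \<in> A" "\<pi> (f - h) \<in> S" for f h
  proof -
    have "\<pi> f = \<pi> (f - h) \<oplus> \<pi> h"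
      using that proj_add[of "f - h" h] by (simp add: sub_closed)
    then have "\<pi> f \<in> S +> \<pi> h" using that by (auto simp: a_r_coset_def')
    then show ?thesis
      using M.a_repr_independence[OF _ proj_carrier[OF that(2)]] a_subgroup by metis
  qed
  show A: "S +> \<pi> f = \<zero>\<^bsub>quotient_rep V S\<^esub> \<longleftrightarrow> \<pi> f \<in> S" if "f \<in> A" for f
    using that M.a_coset_join1[OF _ proj_carrier[OF that]] M.a_coset_join2[OF proj_carrier[OF that]]
      a_subgroup SV by (auto simp: quotient_rep_def)
  \<comment> \<open>The operations of a quotient are unions over a coset; each member of the coset gives the same set.\<close>
  have in_coset: "\<exists>h. h \<in> A \<and> v = \<pi> h \<and> \<pi> (h - f) \<in> S" if "f \<in> A" "v \<in> S +> \<pi> f" for f v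
  proof -
    obtain s where s: "s \<in> S" "v = s \<oplus> \<pi> f" using \<open>v \<in> S +> \<pi> f\<close> by (auto simp: a_r_coset_def')
    then obtain h where "h \<in> A" "s = \<pi> h" using SV by (metis carrierE subsetD)
    then show ?thesis using s that by (intro exI[of _ "h + f"]) (simp add: sub_closed proj_add)
  qed
  have union: "(\<Union>v\<in>S +> \<pi> f. S +> T v) = S +> \<pi> (T' f)"
    if f: "f \<in> A" and T: "\<And>h. h \<in> A \<Longrightarrow> T (\<pi> h) = \<pi> (T' h)" "\<And>h. h \<in> A \<Longrightarrow> T' h \<in> A"
      "\<And>h. h \<in> A \<Longrightarrow> \<pi> h \<in> S \<Longrightarrow> \<pi> (T' h) \<in> S" "flinear T'" for f T T'
  proof -
    have "S +> T v = S +> \<pi> (T' f)" if v: "v \<in> S +> \<pi> f" for v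
    proof -
      obtain h where h: "h \<in> A" "v = \<pi> h" "\<pi> (h - f) \<in> S" using in_coset[OF f v] by blast
      then show ?thesis
        using T(3)[of "h - f"] T(1,2) f by (simp add: eq sub_closed flinear_simps[OF T(4)])
    qed
    moreover have "\<pi> f \<in> S +> \<pi> f" using a_rcos_self f proj_carrier by blast
    ultimately show ?thesis by blast
  qed
  show "presented_rep g (quotient_rep V S) A (\<lambda>f. S +> \<pi> f) \<rho>"
  proof (rule presented_rep.intro)
    show "(\<lambda>f. S +> \<pi> f) ` A = carrier (quotient_rep V S)"
      unfolding quotient_rep_def A_RCOSETS_def' by (auto simp flip: image)
    show "S +> \<pi> 0 = \<zero>\<^bsub>quotient_rep V S\<^esub>"
      using A[of 0] submodule.zero_closed[OF S] by (simp add: sub_closed proj_zero)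
  next
    fix f f' assume "f \<in> A" "f' \<in> A"
    then show "S +> \<pi> (f + f') = (S +> \<pi> f) \<oplus>\<^bsub>quotient_rep V S\<^esub> (S +> \<pi> f')"
      by (simp add: quotient_rep_def a_rcos_sum proj_carrier proj_add)
  next
    fix c f assume "f \<in> A"
    then show "S +> \<pi> (fscale c f) = c \<odot>\<^bsub>quotient_rep V S\<^esub> (S +> \<pi> f)"
      using submodule.smult_closed[OF S]
      by (simp add: quotient_rep_def sub_closed proj_scale
          union[of f "smult V c" "fscale c"] flinear_scale[OF flinear_id])
  next
    fix x f assume "x \<in> g" "f \<in> A"
    then show "S +> \<pi> (\<rho> x f) = act (quotient_rep V S) x (S +> \<pi> f)"
      using inv by (simp add: quotient_rep_def union[of f "act V x" "\<rho> x"] closed linear proj_act)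
  qed (use subspace linear closed in auto)
qed

lemma span_subrep:
  assumes X: "X \<subseteq> carrier V"
    and inv: "\<And>x v. x \<in> g \<Longrightarrow> v \<in> X \<Longrightarrow> act V x v \<in> cspan V X"
  shows "subrep g V (cspan V X)"
proof -
  let ?C = "cspan V X"
  note C = cspan_eq[OF X]
  note P = fs.subspace_0[OF preimage_subspace[OF C(1)]] fs.subspace_add[OF preimage_subspace[OF C(1)]]
    fs.subspace_scale[OF preimage_subspace[OF C(1)]]
  let ?B = "{f \<in> A. \<pi> f \<in> ?C \<and> (\<forall>x\<in>g. \<pi> (\<rho> x f) \<in> ?C)}"
  have "fs.subspace ?B"
    by (rule fs.subspaceI) (use P in \<open>auto simp: flinear_simps[OF linear] closed\<close>)
  then have "submodule class_ring (\<pi> ` ?B) V" by (rule image_submodule) auto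
  moreover have "X \<subseteq> \<pi> ` ?B"
  proof
    fix v assume v: "v \<in> X"
    then obtain f where "f \<in> A" "v = \<pi> f" using X by (metis carrierE subsetD)
    then show "v \<in> \<pi> ` ?B" using v C(2) inv by (intro image_eqI[of _ _ f]) (auto simp: proj_act)
  qed
  ultimately have "?C \<subseteq> \<pi> ` ?B" by (rule C(3))
  then show ?thesis using C(1) by (auto simp: subrep_def simp flip: proj_act)
qed

lemma generated_subrep:
  assumes X: "X \<subseteq> carrier V"
  shows "subrep g V (generated_subrep g V X)" "X \<subseteq> generated_subrep g V X"
    "\<And>S. subrep g V S \<Longrightarrow> X \<subseteq> S \<Longrightarrow> generated_subrep g V X \<subseteq> S"
proof -
  have "subrep g V (carrier V)"
    using image_subrep[OF subspace subset_refl closed] image by simp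
  then show "subrep g V (generated_subrep g V X)"
    using X is_module by (auto simp: generated_subrep_def subrep_def submodule_def)
qed (auto simp: generated_subrep_def)

end

lemma presented_free_rep:
  assumes "\<And>x. x \<in> g \<Longrightarrow> flinear (\<rho> x)"
    and "\<And>x b. x \<in> g \<Longrightarrow> b \<in> B \<Longrightarrow> \<rho> x (single b 1) \<in> supported B"
  shows "presented_rep g (free_rep B \<rho>) (supported B) (\<lambda>f. f) \<rho>"
proof (rule presented_rep.intro)
  show "\<rho> x f \<in> supported B" if "x \<in> g" "f \<in> supported B" for x f
    using that assms flinear_maps_supported[OF _ subspace_supported] by blast
qed (use assms(1) subspace_supported in \<open>auto simp: free_rep_def supported_def\<close>)

text \<open>The opposite situation to a presentation: coordinates for \<open>V\<close> in which its operations become those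
  of a subspace of a free space.\<close>

locale identified_rep =
  fixes g :: "'g set" and V :: "('g, 'v) rep" (structure) and \<Phi> :: "'v \<Rightarrow> ('c \<Rightarrow>\<^sub>0 complex)"
    and U :: "('c \<Rightarrow>\<^sub>0 complex) set"
    and \<rho> :: "'g \<Rightarrow> ('c \<Rightarrow>\<^sub>0 complex) \<Rightarrow> ('c \<Rightarrow>\<^sub>0 complex)"
  assumes subspace: "fs.subspace U"
    and bij: "bij_betw \<Phi> (carrier V) U"
    and zero: "\<zero> \<in> carrier V" "\<Phi> \<zero> = 0"
    and add: "\<And>v w. v \<in> carrier V \<Longrightarrow> w \<in> carrier V \<Longrightarrow> v \<oplus> w \<in> carrier V"
      "\<And>v w. v \<in> carrier V \<Longrightarrow> w \<in> carrier V \<Longrightarrow> \<Phi> (v \<oplus> w) = \<Phi> v + \<Phi> w"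
    and scale: "\<And>c v. v \<in> carrier V \<Longrightarrow> c \<odot>\<^bsub>V\<^esub> v \<in> carrier V"
      "\<And>c v. v \<in> carrier V \<Longrightarrow> \<Phi> (c \<odot>\<^bsub>V\<^esub> v) = fscale c (\<Phi> v)"
    and act: "\<And>x v. x \<in> g \<Longrightarrow> v \<in> carrier V \<Longrightarrow> act V x v \<in> carrier V"
      "\<And>x v. x \<in> g \<Longrightarrow> v \<in> carrier V \<Longrightarrow> \<Phi> (act V x v) = \<rho> x (\<Phi> v)"

text \<open>The homomorphism theorem: \<open>e\<close> and \<open>\<pi>\<close> are surjections from \<open>A\<close> with the same kernel.\<close>

lemma (in presented_rep) identify:
  assumes e: "flinear e" "e ` A = U"
    and equiv: "\<And>x f. x \<in> g \<Longrightarrow> f \<in> A \<Longrightarrow> e (\<rho> x f) = \<rho>' x (e f)"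
    and ker: "\<And>f. f \<in> A \<Longrightarrow> \<pi> f = \<zero> \<longleftrightarrow> e f = 0"
  shows "\<exists>\<Phi>. identified_rep g V \<Phi> U \<rho>' \<and> (\<forall>f\<in>A. \<Phi> (\<pi> f) = e f)"
proof -
  define \<Phi> where "\<Phi> v = e (SOME f. f \<in> A \<and> \<pi> f = v)" for v
  have eq: "\<pi> f = \<pi> h \<longleftrightarrow> e f = e h" if "f \<in> A" "h \<in> A" for f h
    using that ker[of "f - h"] proj_diff_zero[OF that] by (simp add: sub_closed flinear_simps[OF e(1)])
  have \<Phi>: "\<Phi> (\<pi> f) = e f" if "f \<in> A" for f
    using someI[of "\<lambda>h. h \<in> A \<and> \<pi> h = \<pi> f" f] that eq[of _ f] unfolding \<Phi>_def by blast
  have "identified_rep g V \<Phi> U \<rho>'"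
  proof
    show "fs.subspace U"
      unfolding e(2)[symmetric]
    proof (rule fs.subspaceI)
      show "0 \<in> e ` A" using fs2.linear_0[OF e(1)] sub_closed(3) by force
      show "x + y \<in> e ` A" if "x \<in> e ` A" "y \<in> e ` A" for x y
        using that by (auto simp: sub_closed simp flip: flinear_simps[OF e(1)])
      show "fscale c x \<in> e ` A" if "x \<in> e ` A" for c x
        using that by (auto simp: sub_closed simp flip: flinear_simps[OF e(1)])
    qed
    show "bij_betw \<Phi> (carrier V) U"
      unfolding bij_betw_def inj_on_def image[symmetric] e(2)[symmetric]
      by (auto simp: \<Phi> eq image_image)
    show "\<Phi> \<zero> = 0" using \<Phi>[of 0] by (simp add: sub_closed proj_zero flinear_simps[OF e(1)])
    show "\<zero> \<in> carrier V" using proj_carrier[of 0] by (simp add: sub_closed proj_zero)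
  next
    fix v w assume "v \<in> carrier V" "w \<in> carrier V"
    then obtain f h where "f \<in> A" "h \<in> A" "v = \<pi> f" "w = \<pi> h" by (metis carrierE)
    then show "v \<oplus> w \<in> carrier V" "\<Phi> (v \<oplus> w) = \<Phi> v + \<Phi> w"
      by (simp_all add: \<Phi> sub_closed proj_carrier flinear_simps[OF e(1)] flip: proj_add)
  next
    fix c v assume "v \<in> carrier V"
    then obtain f where "f \<in> A" "v = \<pi> f" by (rule carrierE)
    then show "c \<odot>\<^bsub>V\<^esub> v \<in> carrier V" "\<Phi> (c \<odot>\<^bsub>V\<^esub> v) = fscale c (\<Phi> v)"
      by (simp_all add: \<Phi> sub_closed proj_carrier flinear_simps[OF e(1)] flip: proj_scale)
  next
    fix x v assume "x \<in> g" "v \<in> carrier V"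
    then obtain f where "f \<in> A" "v = \<pi> f" by (metis carrierE)
    then show "act V x v \<in> carrier V" "\<Phi> (act V x v) = \<rho>' x (\<Phi> v)"
      using \<open>x \<in> g\<close> by (simp_all add: \<Phi> closed equiv proj_carrier flip: proj_act)
  qed
  then show ?thesis using \<Phi> by blast
qed

section \<open>Simple highest weight modules\<close>

text \<open>The linear span, built from linear combinations of two matrices at a time, which is the form of the
  relations of the enveloping algebra.\<close>

inductive_set lin_hull :: "complex mat set \<Rightarrow> complex mat set" for X where
  base: "x \<in> X \<Longrightarrow> x \<in> lin_hull X"
| lincomb: "x \<in> lin_hull X \<Longrightarrow> y \<in> lin_hull X \<Longrightarrow> c \<cdot>\<^sub>m x + d \<cdot>\<^sub>m y \<in> lin_hull X"

definition lmult :: "complex mat \<Rightarrow> (complex mat list \<Rightarrow>\<^sub>0 complex) \<Rightarrow> (complex mat list \<Rightarrow>\<^sub>0 complex)" where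
  "lmult x = linear_extension (\<lambda>w. single (x # w) 1)"

lemma flinear_lmult: "flinear (lmult x)"
  unfolding lmult_def by (rule flinear_linear_extension)

lemma lmult_single [simp]: "lmult x (single w c) = single (x # w) c"
  by (simp add: lmult_def flip: single_eq_fscale)

locale matrix_lie_algebra =
  fixes g :: "complex mat set"
  assumes lincomb_closed: "\<And>x y c d. x \<in> g \<Longrightarrow> y \<in> g \<Longrightarrow> c \<cdot>\<^sub>m x + d \<cdot>\<^sub>m y \<in> g"
    and commutator_closed: "\<And>x y. x \<in> g \<Longrightarrow> y \<in> g \<Longrightarrow> x * y - y * x \<in> g"

text \<open>What is used of a triangular decomposition: \<open>g\<close> is spanned by the lowering elements \<open>F\<close>, the elements
  of the Cartan subalgebra in \<open>hw\<close>, and the positive part; and the element \<open>h0\<close> of the Cartan subalgebra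
  gives every lowering element a negative integral degree.  The term \<open>0 \<cdot>\<^sub>m y\<close> makes the bracket a linear
  combination of the shape that occurs in the enveloping relations.\<close>

locale triangular_lie_algebra = matrix_lie_algebra +
  fixes np F :: "complex mat set" and hw :: "(complex mat \<times> complex) set"
    and h0 :: "complex mat" and d :: "complex mat \<Rightarrow> nat"
  assumes np: "np \<subseteq> g" and hw: "fst ` hw \<subseteq> g" and F: "F \<subseteq> g"
    and h0: "h0 \<in> lin_hull (fst ` hw)"
    and degree: "\<And>y. y \<in> F \<Longrightarrow> 0 < d y"
      "\<And>y. y \<in> F \<Longrightarrow> h0 * y - y * h0 = (- of_nat (d y)) \<cdot>\<^sub>m y + 0 \<cdot>\<^sub>m y"
    and generate: "g \<subseteq> lin_hull (F \<union> fst ` hw \<union> np)"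

locale simple_hw_module = triangular_lie_algebra +
  fixes U :: "('c \<Rightarrow>\<^sub>0 complex) set"
    and \<rho> :: "complex mat \<Rightarrow> ('c \<Rightarrow>\<^sub>0 complex) \<Rightarrow> ('c \<Rightarrow>\<^sub>0 complex)" and v0
  assumes sub: "fs.subspace U"
    and lin: "\<And>x. x \<in> g \<Longrightarrow> flinear (\<rho> x)"
    and stable: "\<And>x f. x \<in> g \<Longrightarrow> f \<in> U \<Longrightarrow> \<rho> x f \<in> U"
    and lincomb: "\<And>x y c d f. x \<in> g \<Longrightarrow> y \<in> g \<Longrightarrow> f \<in> U \<Longrightarrow>
      \<rho> (c \<cdot>\<^sub>m x + d \<cdot>\<^sub>m y) f = fscale c (\<rho> x f) + fscale d (\<rho> y f)"
    and commutator: "\<And>x y f. x \<in> g \<Longrightarrow> y \<in> g \<Longrightarrow> f \<in> U \<Longrightarrow>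
      \<rho> (x * y - y * x) f = \<rho> x (\<rho> y f) - \<rho> y (\<rho> x f)"
    and v0: "v0 \<in> U" "v0 \<noteq> 0"
    and v0_np: "\<And>x. x \<in> np \<Longrightarrow> \<rho> x v0 = 0"
    and v0_hw: "\<And>h c. (h, c) \<in> hw \<Longrightarrow> \<rho> h v0 = fscale c v0"
    and simple: "\<And>S. fs.subspace S \<Longrightarrow> S \<subseteq> U \<Longrightarrow> S \<noteq> {0} \<Longrightarrow>
      (\<And>x f. x \<in> g \<Longrightarrow> f \<in> S \<Longrightarrow> \<rho> x f \<in> S) \<Longrightarrow> S = U"
begin

text \<open>The free algebra acts on \<open>U\<close>, and \<open>ev\<close> evaluates it at the highest weight vector.  The aim is to show
  that the kernel \<open>Ann\<close> of \<open>ev\<close> is also the kernel of the projection from the free algebra to the simple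
  highest weight module.\<close>

abbreviation "A \<equiv> supported (lists g)"
abbreviation "I \<equiv> enveloping_ideal g"
abbreviation "one_word \<equiv> single [] (1::complex) :: complex mat list \<Rightarrow>\<^sub>0 complex"

lemma lmult_closed: "x \<in> g \<Longrightarrow> f \<in> A \<Longrightarrow> lmult x f \<in> A"
  by (rule flinear_maps_supported[OF flinear_lmult subspace_supported])
     (auto intro!: single_supported)

sublocale W: presented_rep g "words_rep g" A "\<lambda>f. f" lmult
  unfolding words_rep_def lmult_def[symmetric]
  by (rule presented_free_rep) (auto simp: flinear_lmult intro!: single_supported)

abbreviation word_act :: "complex mat list \<Rightarrow> ('c \<Rightarrow>\<^sub>0 complex) \<Rightarrow> ('c \<Rightarrow>\<^sub>0 complex)" where
  "word_act w f \<equiv> foldr \<rho> w f"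

definition ev :: "(complex mat list \<Rightarrow>\<^sub>0 complex) \<Rightarrow> ('c \<Rightarrow>\<^sub>0 complex)" where
  "ev = linear_extension (\<lambda>w. word_act w v0)"

lemma flinear_ev: "flinear ev"
  unfolding ev_def by (rule flinear_linear_extension)

lemma ev_single: "ev (single w c) = fscale c (word_act w v0)"
  by (simp add: ev_def)

lemma word_act_closed: "w \<in> lists g \<Longrightarrow> f \<in> U \<Longrightarrow> word_act w f \<in> U"
  by (induction w) (auto intro: stable)

lemma flinear_word_act: "w \<in> lists g \<Longrightarrow> flinear (word_act w)"
proof (induction w)
  case Nil then show ?case by (simp add: flinear_id id_def)
next
  case (Cons x w) then show ?case
    using flinear_compose[of "word_act w" "\<rho> x"] lin by (simp add: comp_def)
qed

lemma ev_lmult: "x \<in> g \<Longrightarrow> f \<in> A \<Longrightarrow> ev (lmult x f) = \<rho> x (ev f)"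
  by (rule flinear_eq_on_supported[OF flinear_compose[OF flinear_lmult flinear_ev]
        flinear_compose[OF flinear_ev lin]]) (auto simp: ev_single)

lemma ev_closed: "f \<in> A \<Longrightarrow> ev f \<in> U"
  by (rule flinear_maps_supported[OF flinear_ev sub])
     (auto simp: ev_single intro: word_act_closed v0)

text \<open>The image of a left ideal is a submodule of the simple module \<open>U\<close>.\<close>

lemma stable_subspace_image:
  assumes "fs.subspace B" "B \<subseteq> A" "\<And>x f. x \<in> g \<Longrightarrow> f \<in> B \<Longrightarrow> lmult x f \<in> B" "\<exists>f\<in>B. ev f \<noteq> 0"
  shows "ev ` B = U"
proof (rule simple)
  show "fs.subspace (ev ` B)"
  proof (rule fs.subspaceI)
    show "0 \<in> ev ` B" using fs2.linear_0[OF flinear_ev] fs.subspace_0[OF assms(1)] by force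
    show "x + y \<in> ev ` B" if "x \<in> ev ` B" "y \<in> ev ` B" for x y
      using that fs.subspace_add[OF assms(1)] by (auto simp flip: flinear_simps[OF flinear_ev])
    show "fscale c x \<in> ev ` B" if "x \<in> ev ` B" for c x
      using that fs.subspace_scale[OF assms(1)] by (auto simp flip: flinear_simps[OF flinear_ev])
  qed
  show "ev ` B \<subseteq> U" using assms(2) ev_closed by auto
  show "ev ` B \<noteq> {0}" using assms(4) by force
  show "\<rho> x f \<in> ev ` B" if "x \<in> g" "f \<in> ev ` B" for x f
    using that assms(2,3) by (auto simp: subset_iff simp flip: ev_lmult)
qed

definition Ann :: "(complex mat list \<Rightarrow>\<^sub>0 complex) set" where
  "Ann = {f \<in> A. ev f = 0}"

lemma Ann_A: "Ann \<subseteq> A"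
  by (auto simp: Ann_def)

lemma subspace_Ann: "fs.subspace Ann"
  by (rule fs.subspaceI) (auto simp: Ann_def W.sub_closed flinear_simps[OF flinear_ev])

lemma lmult_Ann: "x \<in> g \<Longrightarrow> f \<in> Ann \<Longrightarrow> lmult x f \<in> Ann"
  using lmult_closed flinear_simps(3)[OF lin] by (auto simp: Ann_def ev_lmult)

lemma relations_A: "enveloping_relations g \<subseteq> A"
  unfolding enveloping_relations_def
  by (auto intro!: W.sub_closed single_supported lincomb_closed commutator_closed)

lemma relations_Ann: "enveloping_relations g \<subseteq> Ann"
proof
  fix f assume f: "f \<in> enveloping_relations g"
  note ua = flinear_simps[OF flinear_word_act]
  have "f \<in> enveloping_relations g \<Longrightarrow> ev f = 0"
    unfolding enveloping_relations_def
  proof (elim UnE CollectE exE conjE, goal_cases)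
    case (1 u w x y c d)
    then show ?case
      by (simp add: flinear_simps[OF flinear_ev] ev_single lincomb word_act_closed v0 ua)
  next
    case (2 u w x y)
    then show ?case
      by (simp add: flinear_simps[OF flinear_ev] ev_single commutator word_act_closed v0 ua)
  qed
  then show "f \<in> Ann" using f relations_A by (auto simp: Ann_def)
qed

lemma relations_lmult:
  assumes "x \<in> g" "f \<in> enveloping_relations g"
  shows "lmult x f \<in> enveloping_relations g"
proof -
  have "f \<in> enveloping_relations g \<Longrightarrow> ?thesis"
    unfolding enveloping_relations_def
  proof (elim UnE CollectE exE conjE, goal_cases)
    case (1 u w y z c d)
    then show ?case
      by (intro UnI1 CollectI exI[of _ "x # u"] exI[of _ w] exI[of _ y] exI[of _ z] exI[of _ c] exI[of _ d])
         (use assms(1) in \<open>simp add: flinear_simps[OF flinear_lmult]\<close>)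
  next
    case (2 u w y z)
    then show ?case
      by (intro UnI2 CollectI exI[of _ "x # u"] exI[of _ w] exI[of _ y] exI[of _ z])
         (use assms(1) in \<open>simp add: flinear_simps[OF flinear_lmult]\<close>)
  qed
  then show ?thesis using assms(2) by simp
qed

lemma carrier_words: "carrier (words_rep g) = A"
  using W.image by simp

lemma ideal_subrep: "subrep g (words_rep g) I"
  unfolding enveloping_ideal_def
  using relations_A W.cspan_eq(2)[of "enveloping_relations g"] relations_lmult
  by (intro W.span_subrep) (auto simp: carrier_words subset_iff simp flip: W.proj_act)

lemma ideal_Ann: "I \<subseteq> Ann" and relations_I: "enveloping_relations g \<subseteq> I"
proof -
  have R: "enveloping_relations g \<subseteq> carrier (words_rep g)" using relations_A by (simp add: carrier_words)
  show "enveloping_relations g \<subseteq> I" unfolding enveloping_ideal_def by (rule W.cspan_eq(2)[OF R])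
  have "submodule class_ring Ann (words_rep g)"
    using W.image_submodule[OF subspace_Ann] by (auto simp: Ann_def)
  then show "I \<subseteq> Ann" unfolding enveloping_ideal_def by (rule W.cspan_eq(3)[OF R _ relations_Ann])
qed

sublocale E: presented_rep g "enveloping_rep g" A "enveloping_class g" lmult
  using W.quotient(1)[of I] ideal_subrep
  by (simp add: enveloping_rep_def enveloping_class_def[abs_def] subrep_def)

lemma E_zero: "f \<in> A \<Longrightarrow> enveloping_class g f = \<zero>\<^bsub>enveloping_rep g\<^esub> \<longleftrightarrow> f \<in> I"
  using W.quotient(2)[of I f] ideal_subrep
  by (simp add: enveloping_rep_def enveloping_class_def[abs_def] subrep_def)

definition hw_gens :: "(complex mat list \<Rightarrow>\<^sub>0 complex) set" where
  "hw_gens = {single [x] 1 | x. x \<in> np} \<union>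
     {single [h] 1 - single [] c | h c. (h, c) \<in> hw}"

definition G where "G = generated_subrep g (enveloping_rep g) (enveloping_class g ` hw_gens)"

lemma verma_eq: "verma_rep g np hw = quotient_rep (enveloping_rep g) G"
  unfolding verma_rep_def G_def hw_gens_def image_Un
  by (intro arg_cong[where f = "quotient_rep _"] arg_cong[where f = "generated_subrep _ _"]
      arg_cong2[where f = "(\<union>)"]) (auto simp: image_iff)

lemma hw_gens_Ann: "hw_gens \<subseteq> Ann"
proof -
  have "h \<in> g" if "(h, c) \<in> hw" for h c
    using hw that by (metis fst_conv image_eqI subsetD)
  then have "hw_gens \<subseteq> A"
    using np unfolding hw_gens_def by (auto intro!: W.sub_closed single_supported)
  moreover have "ev f = 0" if "f \<in> hw_gens" for f
    using that unfolding hw_gens_def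
    by (auto simp: flinear_simps[OF flinear_ev] ev_single v0_np v0_hw)
  ultimately show ?thesis by (auto simp: Ann_def)
qed

lemma G: "subrep g (enveloping_rep g) G" "enveloping_class g ` hw_gens \<subseteq> G"
    "G \<subseteq> enveloping_class g ` Ann"
proof -
  have *: "enveloping_class g ` hw_gens \<subseteq> carrier (enveloping_rep g)"
    using hw_gens_Ann E.proj_carrier by (auto simp: Ann_def subset_iff)
  note ** = E.generated_subrep[OF *, folded G_def]
  show "subrep g (enveloping_rep g) G" "enveloping_class g ` hw_gens \<subseteq> G" by (fact **)+
  show "G \<subseteq> enveloping_class g ` Ann"
    using hw_gens_Ann Ann_A by (intro **(3) E.image_subrep[OF subspace_Ann] lmult_Ann) blast+
qed

abbreviation verma_class where
  "verma_class f \<equiv> G +>\<^bsub>enveloping_rep g\<^esub> enveloping_class g f"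

sublocale M: presented_rep g "verma_rep g np hw" A verma_class lmult
  using E.quotient(1)[of G] G(1) by (simp add: verma_eq subrep_def)

text \<open>The kernel of the projection of the free algebra onto the Verma module.\<close>

definition J where "J = {f \<in> A. verma_class f = \<zero>\<^bsub>verma_rep g np hw\<^esub>}"

lemma J_iff: "f \<in> J \<longleftrightarrow> f \<in> A \<and> enveloping_class g f \<in> G"
  using E.quotient(2)[of G f] G(1) by (auto simp: J_def verma_eq subrep_def)

lemma J_Ann: "J \<subseteq> Ann"
proof
  fix f assume "f \<in> J"
  then obtain h where h: "f \<in> A" "h \<in> Ann" "enveloping_class g f = enveloping_class g h"
    using G(3) by (auto simp: J_iff)
  then have "f - h \<in> I"
    using E.proj_diff_zero[of f h] E_zero[of "f - h"] by (auto simp: Ann_def W.sub_closed)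
  then have "f - h + h \<in> Ann"
    using h ideal_Ann fs.subspace_add[OF subspace_Ann] by blast
  then show "f \<in> Ann" by simp
qed

lemma subspace_J: "fs.subspace J"
  using E.preimage_subspace[of G] G(1) J_iff by (simp add: subrep_def J_def Collect_conj_eq)

lemma lmult_J: "x \<in> g \<Longrightarrow> f \<in> J \<Longrightarrow> lmult x f \<in> J"
  using E.preimage_subrep(2)[OF G(1)] lmult_closed by (auto simp: J_iff)

lemma relations_J: "enveloping_relations g \<subseteq> J"
proof
  fix f assume f: "f \<in> enveloping_relations g"
  then have "enveloping_class g f = \<zero>\<^bsub>enveloping_rep g\<^esub>" "f \<in> A"
    using relations_I relations_A E_zero by auto
  then show "f \<in> J" using G(1) by (auto simp: J_iff subrep_def intro: submodule.zero_closed)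
qed

lemma hw_gens_J: "hw_gens \<subseteq> J"
  using G(2) hw_gens_Ann Ann_A unfolding J_iff[THEN eq_reflection] subset_iff by blast

lemmas J_closed = fs.subspace_add[OF subspace_J] fs.subspace_scale[OF subspace_J]
  fs.subspace_0[OF subspace_J] fs.subspace_diff[OF subspace_J] fs.subspace_neg[OF subspace_J]

lemma J_lincomb:
  assumes "x \<in> g" "y \<in> g" "w \<in> lists g"
  shows "single ((c \<cdot>\<^sub>m x + e \<cdot>\<^sub>m y) # w) 1 - single (x # w) c
       - single (y # w) e \<in> J"
proof (rule subsetD[OF relations_J])
  show "single ((c \<cdot>\<^sub>m x + e \<cdot>\<^sub>m y) # w) 1 - single (x # w) c
       - single (y # w) e \<in> enveloping_relations g"
    unfolding enveloping_relations_def
    by (intro UnI1 CollectI exI[of _ "[]"] exI[of _ w] exI[of _ x] exI[of _ y] exI[of _ c] exI[of _ e])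
       (use assms in simp)
qed

lemma J_commutator:
  assumes "x \<in> g" "y \<in> g" "w \<in> lists g"
  shows "single (x # y # w) 1 - single (y # x # w) 1
       - single ((x * y - y * x) # w) 1 \<in> J"
proof (rule subsetD[OF relations_J])
  show "single (x # y # w) 1 - single (y # x # w) 1
       - single ((x * y - y * x) # w) 1 \<in> enveloping_relations g"
    unfolding enveloping_relations_def
    by (intro UnI2 CollectI exI[of _ "[]"] exI[of _ w] exI[of _ x] exI[of _ y])
       (use assms in simp)
qed

lemma lists_F: "w \<in> lists F \<Longrightarrow> w \<in> lists g"
  using F by auto

lemma hw_g: "h \<in> fst ` hw \<Longrightarrow> h \<in> g"
  using hw by blast

text \<open>The easy half of the Poincare-Birkhoff-Witt theorem: modulo \<open>J\<close> every word is a combination of words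
  in the lowering elements alone.  A letter in front of such a word is moved to the right by
  commutators, which have shorter words behind them.\<close>

definition Q where "Q = fs.span (J \<union> {single w 1 | w. w \<in> lists F})"

lemmas Q_closed = fs.span_add[of _ "J \<union> {single w 1 | w. w \<in> lists F}", folded Q_def]
  fs.span_scale[of _ "J \<union> {single w 1 | w. w \<in> lists F}", folded Q_def]
  fs.span_diff[of _ "J \<union> {single w 1 | w. w \<in> lists F}", folded Q_def]

lemma subspace_Q: "fs.subspace Q" unfolding Q_def by simp

lemma J_Q: "J \<subseteq> Q" unfolding Q_def by (auto intro: fs.span_base)

lemma word_Q: "w \<in> lists F \<Longrightarrow> single w c \<in> Q"
  unfolding Q_def by (subst single_eq_fscale) (auto intro!: fs.span_base fs.span_scale)

lemma lmult_F_Q: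
  assumes "y \<in> F" "f \<in> Q" shows "lmult y f \<in> Q"
proof -
  have "fs.subspace {f. lmult y f \<in> Q}"
    by (rule fs.subspaceI)
       (auto simp: flinear_simps[OF flinear_lmult] Q_closed fs.subspace_0[OF subspace_Q])
  moreover have "J \<union> {single w 1 | w. w \<in> lists F} \<subseteq> {f. lmult y f \<in> Q}"
    using assms(1) F lmult_J J_Q by (auto intro!: word_Q)
  ultimately show ?thesis using assms(2) fs.span_minimal unfolding Q_def by blast
qed

lemma lmult_word_Q:
  "x \<in> g \<Longrightarrow> w \<in> lists F \<Longrightarrow> single (x # w) 1 \<in> Q"
proof (induction w arbitrary: x)
  case Nil
  have "x \<in> g \<and> single [x] 1 \<in> Q" if "x \<in> lin_hull (F \<union> fst ` hw \<union> np)" for x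
    using that
  proof induction
    case (base x)
    then consider "x \<in> F" | h c where "x = h" "(h, c) \<in> hw" | "x \<in> np" by auto
    then show ?case
    proof cases
      case 1 then show ?thesis using F by (auto intro!: word_Q)
    next
      case 2
      then have "single [h] 1 - single [] c \<in> J"
        using hw_gens_J unfolding hw_gens_def by blast
      then have "single [h] 1 - single [] c + single [] c \<in> Q"
        using J_Q by (intro Q_closed(1) word_Q) auto
      then show ?thesis using 2 hw_g by force
    next
      case 3
      then have "single [x] 1 \<in> J"
        using hw_gens_J unfolding hw_gens_def by blast
      then show ?thesis using 3 np J_Q by auto
    qed
  next
    case (lincomb x y c e)
    then have "single [c \<cdot>\<^sub>m x + e \<cdot>\<^sub>m y] 1 - single [x] c
       - single [y] e + fscale c (single [x] 1)
       + fscale e (single [y] 1) \<in> Q"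
      using J_Q J_lincomb[of x y "[]"] by (intro Q_closed(1,2)) auto
    then show ?case using lincomb by (simp add: lincomb_closed flip: single_eq_fscale)
  qed
  then show ?case using generate Nil by blast
next
  case (Cons y w)
  then have y: "y \<in> g" "y \<in> F" using F by auto
  have "single (x # y # w) 1 - single (y # x # w) 1
       - single ((x * y - y * x) # w) 1
       + lmult y (single (x # w) 1)
       + single ((x * y - y * x) # w) 1 \<in> Q"
    using Cons y J_Q lists_F[of w]
    by (intro Q_closed(1) lmult_F_Q Cons.IH commutator_closed subsetD[OF J_Q] J_commutator) auto
  then show ?case by simp
qed

lemma A_Q: "A \<subseteq> Q"
proof (rule supported_subset[OF subspace_Q])
  have lm: "lmult x f \<in> Q" if "x \<in> g" "f \<in> Q" for x f
  proof -
    have "fs.subspace {f. lmult x f \<in> Q}"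
      by (rule fs.subspaceI)
         (auto simp: flinear_simps[OF flinear_lmult] Q_closed fs.subspace_0[OF subspace_Q])
    moreover have "J \<union> {single w 1 | w. w \<in> lists F} \<subseteq> {f. lmult x f \<in> Q}"
      using that(1) lmult_J J_Q by (auto intro!: lmult_word_Q)
    ultimately show ?thesis using that(2) fs.span_minimal unfolding Q_def by blast
  qed
  show "single w 1 \<in> Q" if "w \<in> lists g" for w
    using that
  proof (induction w)
    case Nil then show ?case by (simp add: word_Q)
  next
    case (Cons x w) then show ?case using lm[of x "single w 1"] by simp
  qed
qed

lemma h0_scalar: "h0 \<in> g" "\<exists>c. single [h0] 1 - single [] c \<in> J"
proof -
  have "h \<in> g \<and> (\<exists>c. single [h] 1 - single [] c \<in> J)"
    if "h \<in> lin_hull (fst ` hw)" for h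
    using that
  proof induction
    case (base x)
    then obtain c where "(x, c) \<in> hw" by auto
    then have "single [x] 1 - single [] c \<in> J"
      using hw_gens_J unfolding hw_gens_def by blast
    then show ?case using base hw_g by blast
  next
    case (lincomb x y c e)
    then obtain a b where ab: "single [x] 1 - single [] a \<in> J"
      "single [y] 1 - single [] b \<in> J" by blast
    have "(single [c \<cdot>\<^sub>m x + e \<cdot>\<^sub>m y] 1 - single [x] c
       - single [y] e) + fscale c (single [x] 1 - single [] a)
       + fscale e (single [y] 1 - single [] b) \<in> J"
      using J_closed(1)[OF J_closed(1)[OF J_lincomb[of x y "[]" c e] J_closed(2)[OF ab(1), of c]]
          J_closed(2)[OF ab(2), of e]] lincomb by simp
    also have "(single [c \<cdot>\<^sub>m x + e \<cdot>\<^sub>m y] 1 - single [x] c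
       - single [y] e) + fscale c (single [x] 1 - single [] a)
       + fscale e (single [y] 1 - single [] b) =
       single [c \<cdot>\<^sub>m x + e \<cdot>\<^sub>m y] 1 - single [] (c * a + e * b)"
      by (rule poly_mapping_eqI) (simp add: lookup_add lookup_minus lookup_single when_def algebra_simps)
    finally show ?case using lincomb lincomb_closed by blast
  qed
  then show "h0 \<in> g" "\<exists>c. single [h0] 1 - single [] c \<in> J"
    using h0 by auto
qed

definition top_weight where
  "top_weight = (SOME c. single [h0] 1 - single [] c \<in> J)"

text \<open>Words in the lowering elements are weight vectors of the Verma module, and only the empty word has
  the top weight.\<close>

lemma h0_word:
  "w \<in> lists F \<Longrightarrow> single (h0 # w) 1
     - single w (top_weight - of_nat (sum_list (map d w))) \<in> J"
proof (induction w)
  case Nil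
  show ?case using someI_ex[OF h0_scalar(2)] by (simp add: top_weight_def)
next
  case (Cons y w)
  then have y: "y \<in> F" "y \<in> g" "w \<in> lists F" "w \<in> lists g" using F lists_F by auto
  let ?e = "top_weight - of_nat (sum_list (map d w))"
  let ?c = "((- of_nat (d y)) \<cdot>\<^sub>m y + 0 \<cdot>\<^sub>m y) # w"
  have "(single (h0 # y # w) 1 - single (y # h0 # w) 1
       - single ((h0 * y - y * h0) # w) 1)
    + lmult y (single (h0 # w) 1 - single w ?e)
    + (single ?c 1 - single (y # w) (- of_nat (d y))
       - single (y # w) 0) \<in> J"
    using J_closed(1)[OF J_closed(1)[OF J_commutator[of h0 y w] lmult_J[OF y(2) Cons.IH[OF y(3)]]]
        J_lincomb[of y y w "- of_nat (d y)" 0]] y h0_scalar(1) by simp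
  also have "(single (h0 # y # w) 1 - single (y # h0 # w) 1
       - single ((h0 * y - y * h0) # w) 1)
    + lmult y (single (h0 # w) 1 - single w ?e)
    + (single ?c 1 - single (y # w) (- of_nat (d y))
       - single (y # w) 0) = 
    single (h0 # y # w) 1 - single (y # w) (?e - of_nat (d y))"
    using degree(2)[OF y(1)] by (simp add: flinear_simps[OF flinear_lmult] single_diff single_uminus)
  finally show ?case by (simp add: algebra_simps)
qed

text \<open>The polynomial \<open>\<Prod> (h0 - (top_weight - j))\<close>, over \<open>j = 1, \<dots>, k\<close>, annihilates all weight vectors of degree
  between 1 and \<open>k\<close>.  For large \<open>k\<close> it therefore maps every element of the Verma module to a multiple of
  the highest weight vector.\<close>

fun lower :: "nat \<Rightarrow> (complex mat list \<Rightarrow>\<^sub>0 complex) \<Rightarrow> (complex mat list \<Rightarrow>\<^sub>0 complex)" where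
  "lower 0 f = f"
| "lower (Suc k) f = lmult h0 (lower k f) - fscale (top_weight - of_nat (Suc k)) (lower k f)"

lemma flinear_lower: "flinear (lower k)"
proof (induction k)
  case 0 show ?case by (simp add: flinear_id[unfolded id_def])
next
  case (Suc k)
  show ?case unfolding lower.simps
    by (intro flinear_diff flinear_compose[OF Suc flinear_lmult] flinear_scale Suc)
qed

lemma lower_stable:
  assumes "fs.subspace B" "\<And>x f. x \<in> g \<Longrightarrow> f \<in> B \<Longrightarrow> lmult x f \<in> B" "f \<in> B"
  shows "lower k f \<in> B"
  by (induction k) (auto intro!: fs.subspace_diff fs.subspace_scale assms h0_scalar(1) simp del: of_nat_Suc)

lemma lower_word:
  assumes "w \<in> lists F"
  shows "lower k (single w 1)
    - single w (\<Prod>j=1..k. of_nat j - of_nat (sum_list (map d w))) \<in> J"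
proof (induction k)
  case 0 then show ?case by (simp add: J_closed)
next
  case (Suc k)
  let ?e = "of_nat (sum_list (map d w)) :: complex"
  let ?p = "\<Prod>j=1..k. of_nat j - ?e"
  let ?t = "top_weight - of_nat (Suc k)"
  let ?r = "lower k (single w 1) - single w ?p"
  have "lmult h0 ?r - fscale ?t ?r + fscale ?p (single (h0 # w) 1
     - single w (top_weight - ?e)) \<in> J"
    using J_closed(1)[OF J_closed(4)[OF lmult_J[OF h0_scalar(1) Suc] J_closed(2)[OF Suc, of ?t]]
        J_closed(2)[OF h0_word[OF assms], of ?p]] .
  also have "lmult h0 ?r - fscale ?t ?r + fscale ?p (single (h0 # w) 1
     - single w (top_weight - ?e)) =
     lower (Suc k) (single w 1) - single w (?p * (of_nat (Suc k) - ?e))"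
    by (rule poly_mapping_eqI)
       (simp add: lookup_add lookup_minus lookup_single flinear_simps[OF flinear_lmult] when_def algebra_simps)
  finally show ?case by (simp add: mult.commute)
qed

lemma lower_eventually:
  assumes "f \<in> A"
  shows "\<exists>c k0. \<forall>k\<ge>k0. lower k f - fscale (c * fact k) one_word \<in> J"
proof -
  let ?P = "{f. \<exists>c k0. \<forall>k\<ge>k0. lower k f - fscale (c * fact k) one_word \<in> J}"
  have "fs.subspace ?P"
  proof (rule fs.subspaceI)
    show "0 \<in> ?P"
      by (auto intro!: exI[of _ 0] simp: flinear_simps[OF flinear_lower] J_closed)
  next
    fix f h assume "f \<in> ?P" "h \<in> ?P"
    then obtain c k0 c' k0' where c: "\<And>k. k \<ge> k0 \<Longrightarrow> lower k f - fscale (c * fact k) one_word \<in> J"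
      "\<And>k. k \<ge> k0' \<Longrightarrow> lower k h - fscale (c' * fact k) one_word \<in> J" by blast
    have "lower k (f + h) - fscale ((c + c') * fact k) one_word \<in> J" if "k \<ge> max k0 k0'" for k
      using J_closed(1)[OF c(1) c(2), of k k] that
      by (simp add: flinear_simps[OF flinear_lower] distrib_right fs.scale_left_distrib algebra_simps)
    then show "f + h \<in> ?P" by blast
  next
    fix e f assume "f \<in> ?P"
    then obtain c k0 where c: "\<And>k. k \<ge> k0 \<Longrightarrow> lower k f - fscale (c * fact k) one_word \<in> J" by blast
    have "lower k (fscale e f) - fscale ((e * c) * fact k) one_word \<in> J" if "k \<ge> k0" for k
      using J_closed(2)[OF c[OF that], of e]
      by (simp add: flinear_simps[OF flinear_lower] fs.scale_right_diff_distrib mult.assoc)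
    then show "fscale e f \<in> ?P" by blast
  qed
  moreover have "J \<subseteq> ?P"
    by (auto intro!: exI[of _ 0] lower_stable[OF subspace_J] lmult_J)
  moreover have "single w 1 \<in> ?P" if w: "w \<in> lists F" for w
  proof (cases "w = []")
    case True
    have "(\<Prod>j=1..k. of_nat j) = (fact k :: complex)" for k
      by (simp add: fact_prod)
    then show ?thesis using lower_word[of "[]"] True
      by (auto intro!: exI[of _ 1] simp flip: single_eq_fscale)
  next
    case False
    let ?e = "sum_list (map d w)"
    obtain y u where "w = y # u" using False by (cases w) auto
    then have e: "?e \<ge> 1" using degree(1)[of y] w by auto
    have "lower k (single w 1) \<in> J" if "k \<ge> ?e" for k
    proof -
      have "(\<Prod>j=1..k. of_nat j - (of_nat ?e :: complex)) = 0"
        using that e by (intro prod_zero bexI[of _ ?e]) auto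
      then show ?thesis using lower_word[OF w, of k] unfolding \<open>_ = 0\<close> by simp
    qed
    then have "\<forall>k\<ge>?e. lower k (single w 1) - fscale (0 * fact k) one_word \<in> J"
      by simp
    then show ?thesis by blast
  qed
  ultimately have "Q \<subseteq> ?P" unfolding Q_def by (intro fs.span_minimal) auto
  then show ?thesis using assms A_Q by blast
qed

text \<open>Proper submodules of the Verma module die in \<open>U\<close>.  Otherwise a submodule \<open>B\<close> would contain some \<open>b\<close>
  that has the same image \<open>v0\<close> as the empty word.  The difference \<open>k\<close> lies in \<open>Ann\<close>, hence has no
  component of top weight, so a suitable polynomial in \<open>h0\<close> kills it and maps \<open>b\<close> to a nonzero multiple
  of the empty word.\<close>

lemma proper_le_Ann:
  assumes B: "fs.subspace B" "J \<subseteq> B" "B \<subseteq> A" "\<And>x f. x \<in> g \<Longrightarrow> f \<in> B \<Longrightarrow> lmult x f \<in> B"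
    and proper: "one_word \<notin> B"
  shows "B \<subseteq> Ann"
proof (rule ccontr)
  assume "\<not> B \<subseteq> Ann"
  then have "ev ` B = U" using B by (intro stable_subspace_image) (auto simp: Ann_def)
  then obtain b where b: "b \<in> B" "ev b = v0" using v0 by auto
  define k where "k = b - one_word"
  have "one_word \<in> A" by (auto intro: single_supported)
  then have k: "k \<in> Ann" using b B(3) unfolding k_def Ann_def
    by (auto simp: flinear_simps[OF flinear_ev] ev_single W.sub_closed)
  obtain c k0 where "\<And>i. i \<ge> k0 \<Longrightarrow> lower i k - fscale (c * fact i) one_word \<in> J"
    using lower_eventually k Ann_A by blast
  then have c: "lower k0 k - fscale (c * fact k0) one_word \<in> J" by simp
  have "lower k0 k \<in> Ann" using k by (intro lower_stable[OF subspace_Ann] lmult_Ann)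
  then have "lower k0 k - (lower k0 k - fscale (c * fact k0) one_word) \<in> Ann"
    using c J_Ann fs.subspace_diff[OF subspace_Ann] by blast
  then have "fscale (c * fact k0) v0 = 0"
    by (simp add: Ann_def flinear_simps[OF flinear_ev] ev_single)
  then have "c = 0" using v0 by simp
  then have "lower k0 k \<in> B" using c B(2) by auto
  moreover have "lower k0 b \<in> B" using B b by (intro lower_stable) auto
  ultimately have "lower k0 b - lower k0 k \<in> B" by (intro fs.subspace_diff B(1))
  then have "lower k0 one_word \<in> B" by (simp add: k_def flinear_simps[OF flinear_lower])
  moreover have "lower k0 one_word - single [] (fact k0) \<in> B"
    using lower_word[of "[]" k0] B(2) by (auto simp: fact_prod)
  ultimately have "lower k0 one_word - (lower k0 one_word - single [] (fact k0)) \<in> B"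
    using fs.subspace_diff[OF B(1)] by blast
  then have "fscale (1 / fact k0) (single [] (fact k0)) \<in> B"
    by (intro fs.subspace_scale B(1)) simp
  then have "one_word \<in> B"
    by (subst (asm) single_eq_fscale) simp
  then show False using proper by simp
qed

lemma words_generate:
  assumes "fs.subspace B" "\<And>x f. x \<in> g \<Longrightarrow> f \<in> B \<Longrightarrow> lmult x f \<in> B" "one_word \<in> B"
  shows "A \<subseteq> B"
proof (rule supported_subset[OF assms(1)])
  show "single w 1 \<in> B" if "w \<in> lists g" for w
    using that
  proof (induction w)
    case (Cons x w) then show ?case using assms(2)[of x "single w 1"] by simp
  qed (use assms(3) in simp)
qed

text \<open>The union of the proper submodules of the Verma module.  It turns out to be the image of \<open>Ann\<close>, and
  is therefore a submodule itself.\<close>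

definition C where "C = \<Union>{S. subrep g (verma_rep g np hw) S \<and> S \<noteq> carrier (verma_rep g np hw)}"

lemma simple_eq: "simple_hw_rep g np hw = quotient_rep (verma_rep g np hw) (cspan (verma_rep g np hw) C)"
  by (simp add: simple_hw_rep_def C_def Let_def)

lemma Ann_image_proper: "verma_class ` Ann \<subseteq> C"
proof -
  have "subrep g (verma_rep g np hw) (verma_class ` Ann)"
    by (rule M.image_subrep[OF subspace_Ann Ann_A lmult_Ann])
  moreover have "verma_class one_word \<notin> verma_class ` Ann"
  proof
    assume "verma_class one_word \<in> verma_class ` Ann"
    then obtain a where a: "a \<in> Ann" "verma_class one_word = verma_class a" by blast
    moreover have ow: "one_word \<in> A" by (auto intro: single_supported)
    ultimately have "one_word - a \<in> J"
      using M.proj_diff_zero[of one_word a] Ann_A by (auto simp: J_def W.sub_closed)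
    then have "one_word - a + a \<in> Ann" using a J_Ann fs.subspace_add[OF subspace_Ann] by blast
    then show False using v0 by (simp add: Ann_def ev_single)
  qed
  ultimately show ?thesis unfolding C_def
    using M.proj_carrier[of one_word] by (auto intro: single_supported)
qed

lemma C_Ann: "C \<subseteq> verma_class ` Ann"
proof
  fix x assume "x \<in> C"
  then obtain S where S: "subrep g (verma_rep g np hw) S" "S \<noteq> carrier (verma_rep g np hw)" "x \<in> S"
    unfolding C_def by blast
  let ?B = "{f \<in> A. verma_class f \<in> S}"
  have SM: "S \<subseteq> carrier (verma_rep g np hw)" using S(1) by (simp add: subrep_def submodule_def)
  have B: "fs.subspace ?B" "\<And>x f. x \<in> g \<Longrightarrow> f \<in> ?B \<Longrightarrow> lmult x f \<in> ?B"
    using M.preimage_subrep[OF S(1)] lmult_closed by auto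
  have "\<zero>\<^bsub>verma_rep g np hw\<^esub> \<in> S"
    using S(1) by (auto simp: subrep_def intro: submodule.zero_closed)
  then have J: "J \<subseteq> ?B" by (auto simp: J_def)
  have one: "one_word \<notin> ?B"
  proof
    assume "one_word \<in> ?B"
    then have "A \<subseteq> ?B" using words_generate[OF B] by blast
    then have "verma_class ` A \<subseteq> S" by (intro image_subsetI) auto
    then have "carrier (verma_rep g np hw) \<subseteq> S" by (simp only: M.image)
    then have "carrier (verma_rep g np hw) = S" using SM by (rule subset_antisym)
    then show False using S(2) by simp
  qed
  have "?B \<subseteq> A" by blast
  then have "?B \<subseteq> Ann" by (rule proper_le_Ann[OF B(1) J _ B(2) one])
  moreover have "x \<in> carrier (verma_rep g np hw)" using S(3) SM by (rule subsetD[rotated])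
  then obtain f where "f \<in> A" "x = verma_class f" by (rule M.carrierE)
  ultimately show "x \<in> verma_class ` Ann" using S(3) by blast
qed

text \<open>Any simple module with a highest weight vector of the given weight is the simple highest weight
  module.\<close>

theorem simple_hw_rep_identified:
  "\<exists>\<Phi>. identified_rep g (simple_hw_rep g np hw) \<Phi> U \<rho>"
proof -
  let ?M = "verma_rep g np hw"
  let ?N = "cspan ?M C"
  have C: "C \<subseteq> carrier ?M" using C_Ann M.proj_carrier Ann_A by blast
  have N: "subrep g ?M ?N"
  proof (rule M.span_subrep[OF C])
    show "act ?M x v \<in> ?N" if "x \<in> g" "v \<in> C" for x v
    proof -
      have "act ?M x v \<in> C" using that unfolding C_def subrep_def by blast
      then show ?thesis using M.cspan_eq(2)[OF C] by blast
    qed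
  qed
  have N_eq: "?N = verma_class ` Ann"
    using M.cspan_eq(2,3)[OF C] M.image_submodule[OF subspace_Ann Ann_A] C_Ann Ann_image_proper by blast
  interpret L: presented_rep g "simple_hw_rep g np hw" A "\<lambda>f. ?N +>\<^bsub>?M\<^esub> verma_class f" lmult
    using M.quotient(1)[of ?N] N by (simp add: simple_eq subrep_def)
  have "(?N +>\<^bsub>?M\<^esub> verma_class f = \<zero>\<^bsub>simple_hw_rep g np hw\<^esub>) \<longleftrightarrow> ev f = 0" if f: "f \<in> A" for f
  proof -
    have "(?N +>\<^bsub>?M\<^esub> verma_class f = \<zero>\<^bsub>simple_hw_rep g np hw\<^esub>) \<longleftrightarrow> verma_class f \<in> ?N"
      using M.quotient(2)[of ?N f] N f by (simp add: simple_eq subrep_def)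
    also have "\<dots> \<longleftrightarrow> f \<in> Ann"
    proof
      assume "verma_class f \<in> ?N"
      then obtain a where a: "a \<in> Ann" "verma_class f = verma_class a" by (auto simp: N_eq)
      then have "f - a \<in> J"
        using f M.proj_diff_zero[of f a] Ann_A by (auto simp: J_def W.sub_closed)
      then have "f - a + a \<in> Ann" using a J_Ann fs.subspace_add[OF subspace_Ann] by blast
      then show "f \<in> Ann" by simp
    qed (auto simp: N_eq)
    finally show ?thesis using f by (simp add: Ann_def)
  qed
  moreover have "ev ` A = U"
  proof (rule stable_subspace_image[OF W.subspace subset_refl lmult_closed])
    show "\<exists>f\<in>A. ev f \<noteq> 0"
      using v0 by (intro bexI[of _ one_word]) (auto simp: ev_single intro: single_supported)
  qed
  ultimately show ?thesis
    using L.identify[OF flinear_ev _ ev_lmult, of U] by blast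
qed

end

section \<open>Tensor products and direct sums\<close>

text \<open>A family of operators \<open>T k\<close> is the same as a bilinear map on pairs of a vector \<open>f\<close> and a
  finitely supported family of coefficients.\<close>

definition pairing :: "(nat \<Rightarrow> ('c \<Rightarrow>\<^sub>0 complex) \<Rightarrow> ('d \<Rightarrow>\<^sub>0 complex)) \<Rightarrow> ('c \<Rightarrow>\<^sub>0 complex)
    \<Rightarrow> (nat \<Rightarrow>\<^sub>0 complex) \<Rightarrow> ('d \<Rightarrow>\<^sub>0 complex)" where
  "pairing T f = linear_extension (\<lambda>k. T k f)"

lemma flinear_pairing: "flinear (pairing T f)"
  unfolding pairing_def by (rule flinear_linear_extension)

lemma flinear_pairing_left:
  assumes "\<And>k. flinear (T k)" shows "flinear (\<lambda>f. pairing T f h)"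
  unfolding pairing_def linear_extension_def by (intro flinear_sum flinear_scale assms)

lemma pairing_single [simp]: "pairing T f (single k c) = fscale c (T k f)"
  by (simp add: pairing_def)

text \<open>The second factor is given in coordinates with respect to a basis indexed by the natural numbers, so
  that every tensor is a sum of terms \<open>t k \<otimes> basis k\<close>.  By \<open>indep\<close> the bilinear map sends such a sum to
  0 only if all \<open>t k\<close> vanish; the tensor product is then a subspace of the target, with \<open>left\<close> and \<open>right\<close>
  describing the two actions there.\<close>

locale tensor_pairing =
  V: identified_rep g V \<Phi> U \<rho> + W: identified_rep h W \<Theta> UNIV \<sigma>
  for g :: "'g set" and V :: "('g, 'v) rep" and \<Phi> :: "'v \<Rightarrow> ('c \<Rightarrow>\<^sub>0 complex)" and U \<rho>
    and h :: "'h set" and W :: "('h, 'w) rep" and \<Theta> :: "'w \<Rightarrow> (nat \<Rightarrow>\<^sub>0 complex)" and \<sigma> +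
  fixes T :: "nat \<Rightarrow> ('c \<Rightarrow>\<^sub>0 complex) \<Rightarrow> ('d \<Rightarrow>\<^sub>0 complex)"
    and \<tau>1 :: "'g \<Rightarrow> ('d \<Rightarrow>\<^sub>0 complex) \<Rightarrow> ('d \<Rightarrow>\<^sub>0 complex)"
    and \<tau>2 :: "'h \<Rightarrow> ('d \<Rightarrow>\<^sub>0 complex) \<Rightarrow> ('d \<Rightarrow>\<^sub>0 complex)"
  assumes lin: "\<And>k. flinear (T k)" "\<And>y. y \<in> h \<Longrightarrow> flinear (\<sigma> y)"
      "\<And>x. x \<in> g \<Longrightarrow> flinear (\<tau>1 x)" "\<And>y. y \<in> h \<Longrightarrow> flinear (\<tau>2 y)"
    and indep: "\<And>n t k. (\<And>k. k < n \<Longrightarrow> t k \<in> U) \<Longrightarrow> (\<Sum>k<n. T k (t k)) = 0 \<Longrightarrow> k < n \<Longrightarrow> t k = 0"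
    and left: "\<And>k x f. x \<in> g \<Longrightarrow> f \<in> U \<Longrightarrow> T k (\<rho> x f) = \<tau>1 x (T k f)"
    and right: "\<And>k y f. y \<in> h \<Longrightarrow> f \<in> U \<Longrightarrow> pairing T f (\<sigma> y (single k 1)) = \<tau>2 y (T k f)"
begin

abbreviation "F \<equiv> free_pairs_rep V W"
abbreviation "A \<equiv> supported (carrier V \<times> carrier W)"
abbreviation "R \<equiv> bilinearity_relations V W"
abbreviation tens :: "'v \<Rightarrow> 'w \<Rightarrow> ('v \<times> 'w) \<Rightarrow>\<^sub>0 complex" where
  "tens v w \<equiv> single (v, w) 1"

definition pair_act where
  "pair_act = (\<lambda>(x, y). linear_extension (\<lambda>(v, w). tens (act V x v) w + tens v (act W y w)))"

lemma flinear_pair_act: "flinear (pair_act z)"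
  unfolding pair_act_def by (cases z) (simp add: flinear_linear_extension)

lemma V_carrier: "v \<in> carrier V \<Longrightarrow> \<Phi> v \<in> U"
  using V.bij by (auto simp: bij_betw_def)

sublocale P: presented_rep "g \<times> h" F A "\<lambda>f. f" pair_act
  unfolding free_pairs_rep_def pair_act_def[symmetric]
proof (rule presented_free_rep[OF flinear_pair_act])
  show "pair_act z (single b 1) \<in> A" if "z \<in> g \<times> h" "b \<in> carrier V \<times> carrier W" for z b
    using that fs.subspace_add[OF subspace_supported]
    by (auto simp: pair_act_def V.act W.act intro!: fs.subspace_add[OF subspace_supported] single_supported)
qed

definition ev :: "(('v \<times> 'w) \<Rightarrow>\<^sub>0 complex) \<Rightarrow> ('d \<Rightarrow>\<^sub>0 complex)" where
  "ev = linear_extension (\<lambda>(v, w). pairing T (\<Phi> v) (\<Theta> w))"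

lemma flinear_ev: "flinear ev" unfolding ev_def by (rule flinear_linear_extension)

lemma ev_single: "ev (single (v, w) c) = fscale c (pairing T (\<Phi> v) (\<Theta> w))"
  by (simp add: ev_def)

lemma pairing_left: "x \<in> g \<Longrightarrow> f \<in> U \<Longrightarrow> pairing T (\<rho> x f) k = \<tau>1 x (pairing T f k)"
  by (rule flinear_eq_on_supported[OF flinear_pairing flinear_compose[OF flinear_pairing lin(3)],
        of _ _ UNIV]) (auto simp: supported_def left)

lemma pairing_right: "y \<in> h \<Longrightarrow> f \<in> U \<Longrightarrow> pairing T f (\<sigma> y k) = \<tau>2 y (pairing T f k)"
  by (rule flinear_eq_on_supported[OF flinear_compose[OF lin(2) flinear_pairing]
        flinear_compose[OF flinear_pairing lin(4)], of _ _ _ UNIV]) (auto simp: supported_def right)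

lemma ev_act:
  assumes "z \<in> g \<times> h" "f \<in> A"
  shows "ev (pair_act z f) = (case z of (x, y) \<Rightarrow> \<lambda>f. \<tau>1 x f + \<tau>2 y f) (ev f)"
proof -
  obtain x y where z: "z = (x, y)" "x \<in> g" "y \<in> h" using assms(1) by auto
  have "ev (pair_act (x, y) f) = \<tau>1 x (ev f) + \<tau>2 y (ev f)"
  proof (rule flinear_eq_on_supported[OF flinear_compose[OF flinear_pair_act flinear_ev] _ assms(2)])
    show "flinear (\<lambda>f. \<tau>1 x (ev f) + \<tau>2 y (ev f))"
      by (intro flinear_add flinear_compose[OF flinear_ev] lin z)
    fix b assume "b \<in> carrier V \<times> carrier W"
    then show "ev (pair_act (x, y) (single b 1)) =
        \<tau>1 x (ev (single b 1)) + \<tau>2 y (ev (single b 1))"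
      using z by (cases b) (auto simp: pair_act_def flinear_simps[OF flinear_ev] ev_single
          V.act W.act pairing_left pairing_right V_carrier)
  qed
  then show ?thesis using z by simp
qed

lemma R_A: "R \<subseteq> A"
  unfolding bilinearity_relations_def
  by (auto intro!: P.sub_closed single_supported V.add V.scale W.add W.scale)

lemma R_ev: "f \<in> R \<Longrightarrow> ev f = 0"
  unfolding bilinearity_relations_def
  by (auto simp: flinear_simps[OF flinear_ev] ev_single V.add V.scale W.add W.scale
      flinear_simps[OF flinear_pairing] flinear_simps[OF flinear_pairing_left[OF lin(1)]])

definition D where "D = cspan F R"

lemma carrier_F: "carrier F = A" using P.image by simp

lemma D_sub: "LinearCombinations.submodule class_ring D F" and R_D: "R \<subseteq> D"
  and D_least: "\<And>S. LinearCombinations.submodule class_ring S F \<Longrightarrow> R \<subseteq> S \<Longrightarrow> D \<subseteq> S"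
  using P.cspan_eq[of R] R_A unfolding carrier_F D_def by auto

lemma D_A: "D \<subseteq> A"
  using D_sub by (simp add: LinearCombinations.submodule_def carrier_F)

lemma subspace_D: "fs.subspace D"
  using P.preimage_subspace[OF D_sub] D_A by (simp add: Collect_conj_eq Int_absorb1)

lemmas D_closed = fs.subspace_add[OF subspace_D] fs.subspace_scale[OF subspace_D]
  fs.subspace_0[OF subspace_D] fs.subspace_diff[OF subspace_D] fs.subspace_neg[OF subspace_D]

lemma D_ev: "f \<in> D \<Longrightarrow> ev f = 0"
proof -
  have "LinearCombinations.submodule class_ring ((\<lambda>f. f) ` {f \<in> A. ev f = 0}) F"
    by (rule P.image_submodule, rule fs.subspaceI) (auto simp: P.sub_closed flinear_simps[OF flinear_ev])
  then show "f \<in> D \<Longrightarrow> ev f = 0" using D_least R_A R_ev by fastforce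
qed

lemma D_rel:
  "v \<in> carrier V \<Longrightarrow> v' \<in> carrier V \<Longrightarrow> w \<in> carrier W \<Longrightarrow>
    tens (v \<oplus>\<^bsub>V\<^esub> v') w - tens v w - tens v' w \<in> D"
  "v \<in> carrier V \<Longrightarrow> w \<in> carrier W \<Longrightarrow> w' \<in> carrier W \<Longrightarrow>
    tens v (w \<oplus>\<^bsub>W\<^esub> w') - tens v w - tens v w' \<in> D"
  "v \<in> carrier V \<Longrightarrow> w \<in> carrier W \<Longrightarrow> tens (c \<odot>\<^bsub>V\<^esub> v) w - fscale c (tens v w) \<in> D"
  "v \<in> carrier V \<Longrightarrow> w \<in> carrier W \<Longrightarrow> tens v (c \<odot>\<^bsub>W\<^esub> w) - fscale c (tens v w) \<in> D"
  unfolding single_eq_fscale[of _ c, symmetric]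
  by (rule subsetD[OF R_D], unfold bilinearity_relations_def, blast)+

lemma V_inj: "v \<in> carrier V \<Longrightarrow> w \<in> carrier V \<Longrightarrow> \<Phi> v = \<Phi> w \<Longrightarrow> v = w"
  using V.bij by (auto simp: bij_betw_def inj_on_def)

lemma W_inj: "v \<in> carrier W \<Longrightarrow> w \<in> carrier W \<Longrightarrow> \<Theta> v = \<Theta> w \<Longrightarrow> v = w"
  using W.bij by (auto simp: bij_betw_def inj_on_def)

definition coord_vec where "coord_vec = inv_into (carrier W) \<Theta>"

lemma coord_vec: "coord_vec k \<in> carrier W" "\<Theta> (coord_vec k) = k"
  using W.bij unfolding coord_vec_def bij_betw_def
  by (auto intro: inv_into_into f_inv_into_f)

lemma coord_vec_eq: "w \<in> carrier W \<Longrightarrow> coord_vec (\<Theta> w) = w"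
  using W_inj coord_vec by blast

abbreviation "basis k \<equiv> coord_vec (single k 1)"

lemma tens_zero: "w \<in> carrier W \<Longrightarrow> tens \<zero>\<^bsub>V\<^esub> w \<in> D"
proof -
  assume w: "w \<in> carrier W"
  have "0 \<odot>\<^bsub>V\<^esub> \<zero>\<^bsub>V\<^esub> = \<zero>\<^bsub>V\<^esub>" using V.zero V.scale by (intro V_inj) auto
  then show ?thesis using D_rel(3)[OF V.zero(1) w, of 0] by simp
qed

text \<open>Congruence of \<open>f\<close> to \<open>\<Sum> t k \<otimes> basis k\<close> modulo the bilinearity relations.  All sufficiently long
  partial sums are required to be congruent to \<open>f\<close>, so that normal forms can be added termwise whatever
  their lengths.\<close>

definition normal_form where
  "normal_form f t \<longleftrightarrow> (\<forall>k. t k \<in> carrier V) \<and> (\<exists>k0. \<forall>n\<ge>k0. f - (\<Sum>k<n. tens (t k) (basis k)) \<in> D)"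

lemma D_normal_form: "f \<in> D \<Longrightarrow> normal_form f (\<lambda>_. \<zero>\<^bsub>V\<^esub>)"
  unfolding normal_form_def
  by (auto simp: V.zero coord_vec intro!: D_closed(4) fs.subspace_sum[OF subspace_D] tens_zero)

lemma normal_form_subspace: "fs.subspace {f. \<exists>t. normal_form f t}"
proof (rule fs.subspaceI)
  show "0 \<in> {f. \<exists>t. normal_form f t}" using D_normal_form[OF D_closed(3)] by blast
next
  fix f h assume "f \<in> {f. \<exists>t. normal_form f t}" "h \<in> {f. \<exists>t. normal_form f t}"
  then obtain t s k0 k1 where t: "\<And>k. t k \<in> carrier V" "\<And>k. s k \<in> carrier V"
    "\<And>n. n \<ge> k0 \<Longrightarrow> f - (\<Sum>k<n. tens (t k) (basis k)) \<in> D"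
    "\<And>n. n \<ge> k1 \<Longrightarrow> h - (\<Sum>k<n. tens (s k) (basis k)) \<in> D"
    unfolding normal_form_def by blast
  have "f + h - (\<Sum>k<n. tens (t k \<oplus>\<^bsub>V\<^esub> s k) (basis k)) \<in> D" if "n \<ge> max k0 k1" for n
  proof -
    have "(f - (\<Sum>k<n. tens (t k) (basis k))) + (h - (\<Sum>k<n. tens (s k) (basis k)))
      - (\<Sum>k<n. tens (t k \<oplus>\<^bsub>V\<^esub> s k) (basis k) - tens (t k) (basis k) - tens (s k) (basis k)) \<in> D"
      using that t coord_vec
      by (intro D_closed(4)[OF D_closed(1)] fs.subspace_sum[OF subspace_D] D_rel) auto
    then show ?thesis by (simp add: sum_subtractf sum.distrib algebra_simps)
  qed
  then have "normal_form (f + h) (\<lambda>k. t k \<oplus>\<^bsub>V\<^esub> s k)"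
    unfolding normal_form_def using t V.add by blast
  then show "f + h \<in> {f. \<exists>t. normal_form f t}" by blast
next
  fix c f assume "f \<in> {f. \<exists>t. normal_form f t}"
  then obtain t k0 where t: "\<And>k. t k \<in> carrier V"
    "\<And>n. n \<ge> k0 \<Longrightarrow> f - (\<Sum>k<n. tens (t k) (basis k)) \<in> D"
    unfolding normal_form_def by blast
  have "fscale c f - (\<Sum>k<n. tens (c \<odot>\<^bsub>V\<^esub> t k) (basis k)) \<in> D" if "n \<ge> k0" for n
  proof -
    have "fscale c (f - (\<Sum>k<n. tens (t k) (basis k)))
      - (\<Sum>k<n. tens (c \<odot>\<^bsub>V\<^esub> t k) (basis k) - fscale c (tens (t k) (basis k))) \<in> D"
      using that t coord_vec
      by (intro D_closed(4)[OF D_closed(2)] fs.subspace_sum[OF subspace_D] D_rel) auto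
    then show ?thesis by (simp add: sum_subtractf fs.scale_right_diff_distrib fs.scale_sum_right algebra_simps)
  qed
  then have "normal_form (fscale c f) (\<lambda>k. c \<odot>\<^bsub>V\<^esub> t k)"
    unfolding normal_form_def using t V.scale by blast
  then show "fscale c f \<in> {f. \<exists>t. normal_form f t}" by blast
qed

text \<open>The vectors \<open>w\<close> for which all \<open>v \<otimes> w\<close> have a normal form correspond to a subspace that contains the
  basis.\<close>

lemma normal_form_exists:
  assumes "f \<in> A" shows "\<exists>t. normal_form f t"
proof -
  let ?P = "{f. \<exists>t. normal_form f t}"
  note P = fs.subspace_add[OF normal_form_subspace] fs.subspace_scale[OF normal_form_subspace]
  have DP: "D \<subseteq> ?P" using D_normal_form by blast
  have mod: "f \<in> ?P" if "f - f' \<in> D" "f' \<in> ?P" for f f'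
    using P(1)[of "f - f'" f'] that DP by auto
  have base: "tens v (basis k) \<in> ?P" if v: "v \<in> carrier V" for v k
  proof -
    let ?t = "\<lambda>j. if j = k then v else \<zero>\<^bsub>V\<^esub>"
    have "tens v (basis k) - (\<Sum>j<n. tens (?t j) (basis j)) \<in> D" if "n \<ge> Suc k" for n
    proof -
      have "(\<Sum>j<n. tens (?t j) (basis j)) = tens v (basis k) + (\<Sum>j\<in>{..<n}-{k}. tens (?t j) (basis j))"
        using that by (subst sum.remove[of _ k]) auto
      moreover have "(\<Sum>j\<in>{..<n}-{k}. tens (?t j) (basis j)) \<in> D"
        by (rule fs.subspace_sum[OF subspace_D]) (auto simp: tens_zero coord_vec)
      ultimately show ?thesis using D_closed(5) by simp
    qed
    then have "normal_form (tens v (basis k)) ?t" unfolding normal_form_def using v V.zero by auto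
    then show ?thesis by blast
  qed
  have "supported UNIV \<subseteq> {k. \<forall>v\<in>carrier V. tens v (coord_vec k) \<in> ?P}"
  proof (rule supported_subset)
    show "fs.subspace {k. \<forall>v\<in>carrier V. tens v (coord_vec k) \<in> ?P}"
    proof (rule fs.subspaceI)
      have z: "coord_vec 0 = \<zero>\<^bsub>W\<^esub>" using coord_vec W.zero by (intro W_inj) auto
      have "0 \<odot>\<^bsub>W\<^esub> \<zero>\<^bsub>W\<^esub> = \<zero>\<^bsub>W\<^esub>" using W.zero W.scale by (intro W_inj) auto
      then have "tens v \<zero>\<^bsub>W\<^esub> \<in> D" if "v \<in> carrier V" for v
        using D_rel(4)[OF that W.zero(1), of 0] by simp
      then show "0 \<in> {k. \<forall>v\<in>carrier V. tens v (coord_vec k) \<in> ?P}" using DP z by auto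
    next
      fix j k assume jk: "j \<in> {k. \<forall>v\<in>carrier V. tens v (coord_vec k) \<in> ?P}" "k \<in> {k. \<forall>v\<in>carrier V. tens v (coord_vec k) \<in> ?P}"
      have e: "coord_vec (j + k) = coord_vec j \<oplus>\<^bsub>W\<^esub> coord_vec k" using coord_vec W.add by (intro W_inj) auto
      have "tens v (coord_vec (j + k)) \<in> ?P" if v: "v \<in> carrier V" for v
      proof (rule mod[of _ "tens v (coord_vec j) + tens v (coord_vec k)"])
        show "tens v (coord_vec (j + k)) - (tens v (coord_vec j) + tens v (coord_vec k)) \<in> D"
          using D_rel(2)[OF v coord_vec(1) coord_vec(1), of j k] by (simp add: e algebra_simps)
      qed (use jk v P in blast)
      then show "j + k \<in> {k. \<forall>v\<in>carrier V. tens v (coord_vec k) \<in> ?P}" by blast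
    next
      fix c k assume k: "k \<in> {k. \<forall>v\<in>carrier V. tens v (coord_vec k) \<in> ?P}"
      have e: "coord_vec (fscale c k) = c \<odot>\<^bsub>W\<^esub> coord_vec k" using coord_vec W.scale by (intro W_inj) auto
      have "tens v (coord_vec (fscale c k)) \<in> ?P" if v: "v \<in> carrier V" for v
      proof (rule mod[of _ "fscale c (tens v (coord_vec k))"])
        show "tens v (coord_vec (fscale c k)) - fscale c (tens v (coord_vec k)) \<in> D"
          using D_rel(4)[OF v coord_vec(1)] by (simp add: e)
      qed (use k v P in blast)
      then show "fscale c k \<in> {k. \<forall>v\<in>carrier V. tens v (coord_vec k) \<in> ?P}" by blast
    qed
  qed (use base in blast)
  then have "tens v (coord_vec k) \<in> ?P" if "v \<in> carrier V" for v k
    using that by (auto simp: supported_def subset_iff)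
  then have "tens v w \<in> ?P" if "v \<in> carrier V" "w \<in> carrier W" for v w
    using that coord_vec_eq[OF that(2)] by metis
  then have "A \<subseteq> ?P" by (intro supported_subset[OF normal_form_subspace]) blast
  then show ?thesis using assms by blast
qed

lemma ev_normal_form:
  assumes "normal_form f t"
  obtains n where "f - (\<Sum>k<n. tens (t k) (basis k)) \<in> D" "ev f = (\<Sum>k<n. T k (\<Phi> (t k)))"
proof -
  obtain n where n: "f - (\<Sum>k<n. tens (t k) (basis k)) \<in> D"
    using assms unfolding normal_form_def by blast
  have "ev f = ev (\<Sum>k<n. tens (t k) (basis k))"
    using D_ev[OF n] by (simp add: flinear_simps[OF flinear_ev])
  also have "\<dots> = (\<Sum>k<n. T k (\<Phi> (t k)))"
    by (simp add: fs2.linear_sum[OF flinear_ev] ev_single coord_vec)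
  finally show ?thesis using n that by blast
qed

lemma kernel: assumes "f \<in> A" shows "f \<in> D \<longleftrightarrow> ev f = 0"
proof
  assume 0: "ev f = 0"
  obtain t where t: "normal_form f t" using normal_form_exists assms by blast
  obtain n where n: "f - (\<Sum>k<n. tens (t k) (basis k)) \<in> D" "ev f = (\<Sum>k<n. T k (\<Phi> (t k)))"
    using ev_normal_form[OF t] by blast
  have tV: "t k \<in> carrier V" for k using t by (simp add: normal_form_def)
  have "\<Phi> (t k) = 0" if "k < n" for k
    using indep[of n "\<lambda>k. \<Phi> (t k)" k] tV V_carrier n(2) 0 that by auto
  then have "t k = \<zero>\<^bsub>V\<^esub>" if "k < n" for k
    using V_inj[OF tV V.zero(1)] V.zero(2) that by simp
  then have "(\<Sum>k<n. tens (t k) (basis k)) \<in> D"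
    by (intro fs.subspace_sum[OF subspace_D]) (auto simp: tens_zero coord_vec)
  then show "f \<in> D" using D_closed(1)[OF n(1)] by fastforce
qed (rule D_ev)

lemma ev_image: "ev ` A = {\<Sum>k<n. T k (t k) | n t. \<forall>k. t k \<in> U}"
proof (intro subset_antisym subsetI)
  fix x assume "x \<in> ev ` A"
  then obtain f where f: "f \<in> A" "x = ev f" by blast
  obtain t where t: "normal_form f t" using normal_form_exists f by blast
  then show "x \<in> {\<Sum>k<n. T k (t k) | n t. \<forall>k. t k \<in> U}"
    using ev_normal_form[OF t] f V_carrier unfolding normal_form_def mem_Collect_eq by metis
next
  fix x assume "x \<in> {\<Sum>k<n. T k (t k) | n t. \<forall>k. t k \<in> U}"
  then obtain n t where x: "x = (\<Sum>k<n. T k (t k))" "\<And>k. t k \<in> U" by blast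
  define s where "s k = inv_into (carrier V) \<Phi> (t k)" for k
  have s: "s k \<in> carrier V" "\<Phi> (s k) = t k" for k
    using V.bij x(2)[of k] unfolding s_def bij_betw_def by (auto intro: inv_into_into f_inv_into_f)
  have "x = ev (\<Sum>k<n. tens (s k) (basis k))"
    by (simp add: x fs2.linear_sum[OF flinear_ev] ev_single coord_vec s)
  moreover have "(\<Sum>k<n. tens (s k) (basis k)) \<in> A"
    by (intro fs.subspace_sum[OF subspace_supported] single_supported) (auto simp: s coord_vec)
  ultimately show "x \<in> ev ` A" by blast
qed

theorem tensor_rep_identified:
  "\<exists>\<Psi>. identified_rep (g \<times> h) (tensor_rep V W) \<Psi> {\<Sum>k<n. T k (t k) | n t. \<forall>k. t k \<in> U}
     (\<lambda>(x, y) f. \<tau>1 x f + \<tau>2 y f)"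
proof -
  have inv: "act F z f \<in> D" if "z \<in> g \<times> h" "f \<in> D" for z f
  proof -
    have f: "f \<in> A" using that D_A by blast
    have "ev (pair_act z f) = 0"
      using that by (auto simp: ev_act[OF that(1) f] D_ev flinear_simps[OF lin(3)] flinear_simps[OF lin(4)])
    then show ?thesis using P.closed[OF that(1) f] kernel by (simp flip: P.proj_act[OF that(1) f])
  qed
  note Q = P.quotient[OF D_sub inv]
  interpret Q: presented_rep "g \<times> h" "tensor_rep V W" A "\<lambda>f. D +>\<^bsub>F\<^esub> f" pair_act
    using Q(1) by (simp add: tensor_rep_def D_def)
  show ?thesis
    using Q.identify[OF flinear_ev ev_image ev_act] Q(2) kernel
    unfolding tensor_rep_def D_def by blast
qed

end

text \<open>Recognition of an internal direct sum.  The isomorphism is the inverse of the map that adds up the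
  components of a family.\<close>

theorem isomorphic_direct_sum_rep:
  fixes N :: "('g, 'c \<Rightarrow>\<^sub>0 complex) rep" and T :: "'i \<Rightarrow> ('g, 'v) rep"
  assumes N: "add N = (+)" "smult N = fscale"
      "\<And>x f. x \<in> g \<Longrightarrow> f \<in> carrier N \<Longrightarrow> act N x f = \<tau> x f"
    and lin: "\<And>x. x \<in> g \<Longrightarrow> flinear (\<tau> x)"
    and T: "\<And>i. identified_rep g (T i) (\<Psi> i) (I i) \<tau>"
    and span: "carrier N = {\<Sum>i\<in>S. t i | S t. finite S \<and> (\<forall>i\<in>S. t i \<in> I i)}"
    and indep: "\<And>S t i. finite S \<Longrightarrow> (\<And>i. i \<in> S \<Longrightarrow> t i \<in> I i) \<Longrightarrow> sum t S = 0 \<Longrightarrow> i \<in> S \<Longrightarrow> t i = 0"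
  shows "isomorphic_rep g N (direct_sum_rep T)"
proof -
  let ?D = "direct_sum_rep T"
  interpret T: identified_rep g "T i" "\<Psi> i" "I i" \<tau> for i by (rule T)
  define supp where "supp t = {i. t i \<noteq> \<zero>\<^bsub>T i\<^esub>}" for t
  define \<Theta> where "\<Theta> t = (\<Sum>i\<in>supp t. \<Psi> i (t i))" for t
  have D: "t \<in> carrier ?D \<longleftrightarrow> (\<forall>i. t i \<in> carrier (T i)) \<and> finite (supp t)" for t
    by (simp add: direct_sum_rep_def supp_def)
  have \<Theta>: "\<Theta> t = (\<Sum>i\<in>S. \<Psi> i (t i))" if "finite S" "supp t \<subseteq> S" for t S
    unfolding \<Theta>_def by (rule sum.mono_neutral_left) (use that T.zero in \<open>auto simp: supp_def\<close>)
  have inj: "v = w" if "v \<in> carrier (T i)" "w \<in> carrier (T i)" "\<Psi> i v = \<Psi> i w" for i v w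
    using T.bij[of i] that by (auto simp: bij_betw_def inj_on_def)
  have I: "v \<in> carrier (T i) \<Longrightarrow> \<Psi> i v \<in> I i" for i v
    using T.bij[of i] by (auto simp: bij_betw_def)
  have zero: "v = \<zero>\<^bsub>T i\<^esub>" if "v \<in> carrier (T i)" "\<Psi> i v = 0" for i v
    using inj[OF that(1) T.zero(1)] T.zero(2) that by simp
  have bij: "bij_betw \<Theta> (carrier ?D) (carrier N)"
  proof (rule bij_betw_imageI)
    show "inj_on \<Theta> (carrier ?D)"
    proof (rule inj_onI)
      fix s t assume st: "s \<in> carrier ?D" "t \<in> carrier ?D" "\<Theta> s = \<Theta> t"
      let ?S = "supp s \<union> supp t"
      have "(\<Sum>i\<in>?S. \<Psi> i (s i) - \<Psi> i (t i)) = 0"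
        using st D \<Theta>[of ?S s] \<Theta>[of ?S t] by (simp add: sum_subtractf)
      then have "\<Psi> i (s i) - \<Psi> i (t i) = 0" if "i \<in> ?S" for i
        using indep[of ?S "\<lambda>i. \<Psi> i (s i) - \<Psi> i (t i)" i] st D that
          fs.subspace_diff[OF T.subspace I I] by auto
      then have "s i = t i" if "i \<in> ?S" for i
        using inj[of "s i" i "t i"] st D that by simp
      moreover have "s i = t i" if "i \<notin> ?S" for i using that by (auto simp: supp_def)
      ultimately show "s = t" by blast
    qed
    show "\<Theta> ` carrier ?D = carrier N"
    proof (intro subset_antisym subsetI)
      fix x assume "x \<in> \<Theta> ` carrier ?D"
      then obtain t where "t \<in> carrier ?D" "x = \<Theta> t" by blast
      then show "x \<in> carrier N" using I unfolding span \<Theta>_def D by blast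
    next
      fix x assume "x \<in> carrier N"
      then obtain S u where x: "finite S" "\<And>i. i \<in> S \<Longrightarrow> u i \<in> I i" "x = (\<Sum>i\<in>S. u i)"
        unfolding span by blast
      define t where "t i = (if i \<in> S then inv_into (carrier (T i)) (\<Psi> i) (u i) else \<zero>\<^bsub>T i\<^esub>)" for i
      have t: "t i \<in> carrier (T i)" "i \<in> S \<Longrightarrow> \<Psi> i (t i) = u i" for i
        using T.bij[of i] x(2)[of i] T.zero(1)[of i] unfolding t_def bij_betw_def
        by (auto intro: inv_into_into f_inv_into_f)
      have sub: "supp t \<subseteq> S" by (auto simp: supp_def t_def)
      have "t \<in> carrier ?D" using D t finite_subset[OF sub x(1)] by blast
      moreover have "\<Theta> t = x" using \<Theta>[OF x(1) sub] t x(3) by simp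
      ultimately show "x \<in> \<Theta> ` carrier ?D" by blast
    qed
  qed
  have sup_add: "supp (\<lambda>i. s i \<oplus>\<^bsub>T i\<^esub> t i) \<subseteq> supp s \<union> supp t"
    if "s \<in> carrier ?D" "t \<in> carrier ?D" for s t
  proof -
    have "\<zero>\<^bsub>T i\<^esub> \<oplus>\<^bsub>T i\<^esub> \<zero>\<^bsub>T i\<^esub> = \<zero>\<^bsub>T i\<^esub>" for i
      using T.zero T.add by (intro zero) auto
    then show ?thesis by (auto simp: supp_def)
  qed
  have sup_scale: "supp (\<lambda>i. c \<odot>\<^bsub>T i\<^esub> t i) \<subseteq> supp t" for c t
  proof -
    have "c \<odot>\<^bsub>T i\<^esub> \<zero>\<^bsub>T i\<^esub> = \<zero>\<^bsub>T i\<^esub>" for i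
      using T.zero T.scale by (intro zero) auto
    then show ?thesis by (auto simp: supp_def)
  qed
  have sup_act: "supp (\<lambda>i. act (T i) x (t i)) \<subseteq> supp t" if "x \<in> g" for x t
  proof -
    have "act (T i) x \<zero>\<^bsub>T i\<^esub> = \<zero>\<^bsub>T i\<^esub>" for i
      using T.zero T.act that lin[OF that] by (intro zero) (auto simp: flinear_simps)
    then show ?thesis by (auto simp: supp_def)
  qed
  have add: "s \<oplus>\<^bsub>?D\<^esub> t \<in> carrier ?D \<and> \<Theta> (s \<oplus>\<^bsub>?D\<^esub> t) = \<Theta> s + \<Theta> t"
    if "s \<in> carrier ?D" "t \<in> carrier ?D" for s t
  proof -
    let ?S = "supp s \<union> supp t"
    have fin: "finite ?S" using that D by simp
    have e: "s \<oplus>\<^bsub>?D\<^esub> t = (\<lambda>i. s i \<oplus>\<^bsub>T i\<^esub> t i)" by (simp add: direct_sum_rep_def)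
    show ?thesis
      unfolding e \<Theta>[OF fin sup_add[OF that]] \<Theta>[OF fin Un_upper1] \<Theta>[OF fin Un_upper2]
      using that T.add finite_subset[OF sup_add[OF that] fin] by (simp add: D sum.distrib)
  qed
  have scale: "c \<odot>\<^bsub>?D\<^esub> t \<in> carrier ?D \<and> \<Theta> (c \<odot>\<^bsub>?D\<^esub> t) = fscale c (\<Theta> t)"
    if "t \<in> carrier ?D" for c t
  proof -
    have fin: "finite (supp t)" using that D by simp
    have e: "c \<odot>\<^bsub>?D\<^esub> t = (\<lambda>i. c \<odot>\<^bsub>T i\<^esub> t i)" by (simp add: direct_sum_rep_def)
    show ?thesis
      unfolding e \<Theta>[OF fin sup_scale] \<Theta>[OF fin subset_refl]
      using that T.scale finite_subset[OF sup_scale fin] by (simp add: D fs.scale_sum_right)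
  qed
  have act: "act ?D x t \<in> carrier ?D \<and> \<Theta> (act ?D x t) = act N x (\<Theta> t)"
    if "x \<in> g" "t \<in> carrier ?D" for x t
  proof -
    have fin: "finite (supp t)" using that D by simp
    have e: "act ?D x t = (\<lambda>i. act (T i) x (t i))" by (simp add: direct_sum_rep_def)
    have "\<Theta> t \<in> carrier N" using that bij by (auto simp: bij_betw_def)
    then have a: "act N x (\<Theta> t) = \<tau> x (\<Theta> t)" using N(3) that by simp
    have "\<Theta> (act ?D x t) = \<tau> x (\<Theta> t)"
      unfolding e \<Theta>[OF fin sup_act[OF that(1)]] \<Theta>[OF fin subset_refl]
      using that T.act by (simp add: D fs2.linear_sum[OF lin[OF that(1)]])
    then show ?thesis
      unfolding a using that T.act finite_subset[OF sup_act[OF that(1)] fin] by (simp add: D e)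
  qed
  let ?\<phi> = "inv_into (carrier ?D) \<Theta>"
  have \<phi>bij: "bij_betw ?\<phi> (carrier N) (carrier ?D)" by (rule bij_betw_inv_into[OF bij])
  have \<phi>: "?\<phi> f \<in> carrier ?D" "\<Theta> (?\<phi> f) = f" if "f \<in> carrier N" for f
    using that \<phi>bij bij bij_betw_inv_into_right[OF bij that] by (auto simp: bij_betw_def)
  have \<phi>I: "?\<phi> f = t" if "t \<in> carrier ?D" "\<Theta> t = f" for f t
    using bij that by (auto simp: bij_betw_def)
  show ?thesis unfolding isomorphic_rep_def
  proof (intro bexI[of _ ?\<phi>] conjI \<phi>bij ballI)
    show "?\<phi> (act N x f) = act ?D x (?\<phi> f)" if "x \<in> g" "f \<in> carrier N" for x f
      using act[OF that(1) \<phi>(1)[OF that(2)]] \<phi>[OF that(2)] by (intro \<phi>I) auto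
    show "?\<phi> \<in> LinearCombinations.module_hom class_ring N ?D"
      unfolding LinearCombinations.module_hom_def
      using \<phi> add scale by (auto intro!: \<phi>I simp: N)
  qed
qed

section \<open>The operators of multiplication and differentiation\<close>

text \<open>The coefficients of \<open>q_op\<close> and \<open>p_op\<close> on a monomial, as functions of the exponent concerned.\<close>

definition q_coeff :: "complex \<Rightarrow> complex" where "q_coeff z = (if neg_int z then z + 1 else 1)"
definition p_coeff :: "complex \<Rightarrow> complex" where "p_coeff z = (if neg_int z then 1 else z)"

lemma neg_int_iff: "neg_int z \<longleftrightarrow> z \<in> \<int> \<and> Re z < 0"
  unfolding neg_int_def by (auto elim!: Ints_cases)

lemma neg_int_pred: "neg_int z \<Longrightarrow> neg_int (z - 1)"
  by (auto simp: neg_int_iff)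

lemma neg_int_succ: "neg_int z \<Longrightarrow> z \<noteq> -1 \<Longrightarrow> neg_int (z + 1)"
proof -
  assume "neg_int z" "z \<noteq> -1"
  then obtain k :: int where k: "k < 0" "z = of_int k" unfolding neg_int_def by auto
  then have "k + 1 < 0" using \<open>z \<noteq> -1\<close> by (cases "k = -1") auto
  then show "neg_int (z + 1)" using k unfolding neg_int_def by (intro exI[of _ "k + 1"]) auto
qed

lemma neg_int_succ': "\<not> neg_int z \<Longrightarrow> neg_int (z - 1) \<Longrightarrow> z = 0"
proof -
  assume "\<not> neg_int z" "neg_int (z - 1)"
  then show "z = 0" using neg_int_succ[of "z - 1"] by (cases "z - 1 = -1") auto
qed

lemma neg_int_minus1 [simp]: "neg_int (-1)" by (simp add: neg_int_iff)

lemma neg_int_0 [simp]: "\<not> neg_int 0" by (simp add: neg_int_iff)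

text \<open>These two identities say that \<open>q\<^sub>i p\<^sub>i\<close> and \<open>p\<^sub>i q\<^sub>i\<close> act on a monomial by \<open>\<beta>\<^sub>i\<close> and \<open>\<beta>\<^sub>i + 1\<close>, also at the
  exponents 0 and -1, where one of the operators vanishes.\<close>

lemma p_q_coeff_pred: "p_coeff z * q_coeff (z - 1) = z"
  using neg_int_pred[of z] neg_int_succ'[of z] by (auto simp: p_coeff_def q_coeff_def)

lemma q_p_coeff_succ: "q_coeff z * p_coeff (z + 1) = z + 1"
  using neg_int_succ[of z] neg_int_pred[of "z + 1"] by (cases "z = -1") (auto simp: p_coeff_def q_coeff_def)

lemma q_op_single:
  "q_op m i (single \<beta> c) = single (\<beta> + unit_vec m i) (c * q_coeff (\<beta> $ i))"
  by (rule poly_mapping_eqI) (simp add: q_op_def q_coeff_def lookup_single when_def)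

lemma p_op_single:
  "p_op m j (single \<beta> c) = single (\<beta> - unit_vec m j) (c * p_coeff (\<beta> $ j))"
  by (rule poly_mapping_eqI) (simp add: p_op_def p_coeff_def lookup_single when_def)

lemma flinear_q: "flinear (q_op m i)" and flinear_p: "flinear (p_op m i)"
  unfolding q_op_def p_op_def by (rule flinear_linear_extension)+

abbreviation vecs :: "nat \<Rightarrow> (complex vec \<Rightarrow>\<^sub>0 complex) set" where
  "vecs m \<equiv> supported (carrier_vec m)"

lemma q_closed: "f \<in> vecs m \<Longrightarrow> q_op m i f \<in> vecs m"
  by (rule flinear_maps_supported[OF flinear_q subspace_supported])
     (auto simp: q_op_single intro!: single_supported)

lemma p_closed: "f \<in> vecs m \<Longrightarrow> p_op m i f \<in> vecs m"
  by (rule flinear_maps_supported[OF flinear_p subspace_supported])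
     (auto simp: p_op_single intro!: single_supported)

lemma q_commute:
  assumes "f \<in> vecs m" "i < m" "j < m" shows "q_op m i (q_op m j f) = q_op m j (q_op m i f)"
proof (rule flinear_eq_on_supported[OF flinear_compose[OF flinear_q flinear_q]
        flinear_compose[OF flinear_q flinear_q] assms(1)])
  fix \<beta> :: "complex vec" assume \<beta>: "\<beta> \<in> carrier_vec m"
  then have "\<beta> + unit_vec m j + unit_vec m i = \<beta> + unit_vec m i + unit_vec m j"
    by (intro eq_vecI) auto
  then show "q_op m i (q_op m j (single \<beta> 1)) = q_op m j (q_op m i (single \<beta> 1))"
    using \<beta> assms by (cases "i = j") (simp_all add: q_op_single mult.commute)
qed

lemma p_commute:
  assumes "f \<in> vecs m" "i < m" "j < m" shows "p_op m i (p_op m j f) = p_op m j (p_op m i f)"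
proof (rule flinear_eq_on_supported[OF flinear_compose[OF flinear_p flinear_p]
        flinear_compose[OF flinear_p flinear_p] assms(1)])
  fix \<beta> :: "complex vec" assume \<beta>: "\<beta> \<in> carrier_vec m"
  then have "\<beta> - unit_vec m j - unit_vec m i = \<beta> - unit_vec m i - unit_vec m j"
    by (intro eq_vecI) auto
  then show "p_op m i (p_op m j (single \<beta> 1)) = p_op m j (p_op m i (single \<beta> 1))"
    using \<beta> assms by (cases "i = j") (simp_all add: p_op_single mult.commute)
qed

lemma p_q_commute:
  assumes "f \<in> vecs m" "i < m" "j < m"
  shows "p_op m i (q_op m j f) = q_op m j (p_op m i f) + (if i = j then f else 0)"
proof (rule flinear_eq_on_supported[OF flinear_compose[OF flinear_q flinear_p] _ assms(1)])
  show "flinear (\<lambda>f. q_op m j (p_op m i f) + (if i = j then f else 0))"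
    by (cases "i = j") (auto intro!: flinear_add flinear_compose[OF flinear_p flinear_q] flinear_id flinear_zero)
  fix \<beta> :: "complex vec" assume \<beta>: "\<beta> \<in> carrier_vec m"
  then have e: "\<beta> + unit_vec m j - unit_vec m i = \<beta> - unit_vec m i + unit_vec m j"
    by (intro eq_vecI) auto
  have e': "\<beta> - unit_vec m j + unit_vec m j = \<beta>" "\<beta> + unit_vec m j - unit_vec m j = \<beta>"
    using \<beta> by (intro eq_vecI; auto)+
  show "p_op m i (q_op m j (single \<beta> 1)) =
      q_op m j (p_op m i (single \<beta> 1)) + (if i = j then single \<beta> 1 else 0)"
  proof (cases "i = j")
    case True
    then show ?thesis using \<beta> assms q_p_coeff_succ[of "\<beta> $ i"] p_q_coeff_pred[of "\<beta> $ i"]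
      by (simp add: q_op_single p_op_single e' flip: single_add)
  next
    case False
    then show ?thesis using \<beta> assms by (simp add: q_op_single p_op_single e mult.commute)
  qed
qed

definition gl_unit :: "nat \<Rightarrow> nat \<Rightarrow> nat \<Rightarrow> (complex vec \<Rightarrow>\<^sub>0 complex) \<Rightarrow> (complex vec \<Rightarrow>\<^sub>0 complex)" where
  "gl_unit m i j f = q_op m i (p_op m j f)"

lemma flinear_unit: "flinear (gl_unit m i j)"
  using flinear_compose[OF flinear_p flinear_q] unfolding gl_unit_def[abs_def] .

lemma unit_commutator:
  assumes "f \<in> vecs m" "i < m" "j < m" "k < m" "l < m"
  shows "gl_unit m i j (gl_unit m k l f) - gl_unit m k l (gl_unit m i j f) =
    (if j = k then gl_unit m i l f else 0) - (if i = l then gl_unit m k j f else 0)"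
proof -
  have *: "gl_unit m i j (gl_unit m k l f) =
      q_op m i (q_op m k (p_op m j (p_op m l f))) + (if j = k then gl_unit m i l f else 0)"
    if "i < m" "j < m" "k < m" "l < m" for i j k l
    using that assms(1) flinear_simps[OF flinear_q]
    by (simp add: gl_unit_def p_q_commute p_closed q_closed)
  show ?thesis
    using assms *[of i j k l] *[of k l i j] p_commute[OF assms(1), of j l]
      q_commute[OF p_closed[OF p_closed[OF assms(1)]], of i k j l]
    by auto
qed

definition gl_act :: "nat \<Rightarrow> complex mat \<Rightarrow> (complex vec \<Rightarrow>\<^sub>0 complex) \<Rightarrow> (complex vec \<Rightarrow>\<^sub>0 complex)" where
  "gl_act m A f = (\<Sum>i<m. \<Sum>j<m. fscale (A $$ (i, j)) (gl_unit m i j f))"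

lemma flinear_gl_act: "flinear (gl_act m A)"
  unfolding gl_act_def[abs_def] by (intro flinear_sum flinear_scale flinear_unit)

lemma gl_act_lincomb:
  assumes "A \<in> carrier_mat m m" "B \<in> carrier_mat m m"
  shows "gl_act m (c \<cdot>\<^sub>m A + d \<cdot>\<^sub>m B) f = fscale c (gl_act m A f) + fscale d (gl_act m B f)"
  using assms by (simp add: gl_act_def fs.scale_left_distrib fs.scale_sum_right sum.distrib)

lemma gl_act_add:
  assumes "A \<in> carrier_mat m m" "B \<in> carrier_mat m m"
  shows "gl_act m (A + B) f = gl_act m A f + gl_act m B f"
  using assms by (simp add: gl_act_def fs.scale_left_distrib sum.distrib)

lemma sum_swap_pairs:
  "(\<Sum>k\<in>K. \<Sum>l\<in>L. \<Sum>i\<in>I. \<Sum>j\<in>J. f i j k l) = (\<Sum>i\<in>I. \<Sum>j\<in>J. \<Sum>k\<in>K. \<Sum>l\<in>L. f i j k l)"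
proof -
  have "(\<Sum>k\<in>K. \<Sum>l\<in>L. \<Sum>i\<in>I. \<Sum>j\<in>J. f i j k l) = (\<Sum>k\<in>K. \<Sum>i\<in>I. \<Sum>l\<in>L. \<Sum>j\<in>J. f i j k l)"
    by (rule sum.cong[OF refl], rule sum.swap)
  also have "\<dots> = (\<Sum>i\<in>I. \<Sum>k\<in>K. \<Sum>l\<in>L. \<Sum>j\<in>J. f i j k l)" by (rule sum.swap)
  also have "\<dots> = (\<Sum>i\<in>I. \<Sum>k\<in>K. \<Sum>j\<in>J. \<Sum>l\<in>L. f i j k l)"
    by (rule sum.cong[OF refl], rule sum.cong[OF refl], rule sum.swap)
  also have "\<dots> = (\<Sum>i\<in>I. \<Sum>j\<in>J. \<Sum>k\<in>K. \<Sum>l\<in>L. f i j k l)"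
    by (rule sum.cong[OF refl], rule sum.swap)
  finally show ?thesis .
qed

text \<open>Bilinear expansion of both sides into matrix units.\<close>

lemma gl_act_commutator:
  assumes A: "A \<in> carrier_mat m m" and B: "B \<in> carrier_mat m m" and f: "f \<in> vecs m"
  shows "gl_act m (A * B - B * A) f = gl_act m A (gl_act m B f) - gl_act m B (gl_act m A f)"
proof -
  let ?E = "gl_unit m" and ?I = "{..<m}"
  have prod: "gl_act m A (gl_act m B f) =
      (\<Sum>i\<in>?I. \<Sum>j\<in>?I. \<Sum>k\<in>?I. \<Sum>l\<in>?I. fscale (A $$ (i, j) * B $$ (k, l)) (?E i j (?E k l f)))" for A B
    by (simp add: gl_act_def fs2.linear_sum[OF flinear_unit] flinear_simps[OF flinear_unit] fs.scale_sum_right)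
  have prod': "gl_act m B (gl_act m A f) =
      (\<Sum>i\<in>?I. \<Sum>j\<in>?I. \<Sum>k\<in>?I. \<Sum>l\<in>?I. fscale (A $$ (i, j) * B $$ (k, l)) (?E k l (?E i j f)))"
  proof -
    have "gl_act m B (gl_act m A f) =
      (\<Sum>k\<in>?I. \<Sum>l\<in>?I. \<Sum>i\<in>?I. \<Sum>j\<in>?I. fscale (A $$ (i, j) * B $$ (k, l)) (?E k l (?E i j f)))"
      unfolding prod by (simp add: mult.commute)
    also have "\<dots> = (\<Sum>i\<in>?I. \<Sum>j\<in>?I. \<Sum>k\<in>?I. \<Sum>l\<in>?I. fscale (A $$ (i, j) * B $$ (k, l)) (?E k l (?E i j f)))"
      by (rule sum_swap_pairs)
    finally show ?thesis .
  qed
  have "gl_act m A (gl_act m B f) - gl_act m B (gl_act m A f) =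
    (\<Sum>i\<in>?I. \<Sum>j\<in>?I. \<Sum>k\<in>?I. \<Sum>l\<in>?I. fscale (A $$ (i, j) * B $$ (k, l))
        ((if j = k then ?E i l f else 0) - (if i = l then ?E k j f else 0)))"
    unfolding prod[of A B] prod'
    by (simp add: unit_commutator[OF f] flip: sum_subtractf fs.scale_right_diff_distrib)
  also have "\<dots> = (\<Sum>i\<in>?I. \<Sum>j\<in>?I. \<Sum>l\<in>?I. fscale (A $$ (i, j) * B $$ (j, l)) (?E i l f))
     - (\<Sum>i\<in>?I. \<Sum>j\<in>?I. \<Sum>k\<in>?I. fscale (A $$ (i, j) * B $$ (k, i)) (?E k j f))"
  proof -
    have 1: "(\<Sum>k\<in>?I. \<Sum>l\<in>?I. fscale (A $$ (i, j) * B $$ (k, l)) (if j = k then ?E i l f else 0)) =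
        (\<Sum>l\<in>?I. fscale (A $$ (i, j) * B $$ (j, l)) (?E i l f))" if "j < m" for i j
    proof -
      have "(\<Sum>k\<in>?I. \<Sum>l\<in>?I. fscale (A $$ (i, j) * B $$ (k, l)) (if j = k then ?E i l f else 0)) =
        (\<Sum>k\<in>?I. if k = j then (\<Sum>l\<in>?I. fscale (A $$ (i, j) * B $$ (k, l)) (?E i l f)) else 0)"
        by (intro sum.cong refl) auto
      then show ?thesis using that by simp
    qed
    have 2: "(\<Sum>k\<in>?I. \<Sum>l\<in>?I. fscale (A $$ (i, j) * B $$ (k, l)) (if i = l then ?E k j f else 0)) =
        (\<Sum>k\<in>?I. fscale (A $$ (i, j) * B $$ (k, i)) (?E k j f))" if "i < m" for i j
    proof -
      have "(\<Sum>l\<in>?I. fscale (A $$ (i, j) * B $$ (k, l)) (if i = l then ?E k j f else 0)) =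
        (\<Sum>l\<in>?I. if l = i then fscale (A $$ (i, j) * B $$ (k, l)) (?E k j f) else 0)" for k
        by (intro sum.cong refl) auto
      then show ?thesis using that by simp
    qed
    show ?thesis
      by (simp add: fs.scale_right_diff_distrib sum_subtractf 1 2)
  qed
  also have "(\<Sum>i\<in>?I. \<Sum>j\<in>?I. \<Sum>l\<in>?I. fscale (A $$ (i, j) * B $$ (j, l)) (?E i l f)) =
      (\<Sum>i\<in>?I. \<Sum>l\<in>?I. fscale ((A * B) $$ (i, l)) (?E i l f))"
  proof (rule sum.cong[OF refl])
    fix i assume i: "i \<in> ?I"
    have "(\<Sum>j\<in>?I. \<Sum>l\<in>?I. fscale (A $$ (i, j) * B $$ (j, l)) (?E i l f)) =
      (\<Sum>l\<in>?I. \<Sum>j\<in>?I. fscale (A $$ (i, j) * B $$ (j, l)) (?E i l f))" by (rule sum.swap)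
    also have "\<dots> = (\<Sum>l\<in>?I. fscale ((A * B) $$ (i, l)) (?E i l f))"
      using i A B by (intro sum.cong refl)
        (simp add: scalar_prod_def fs.scale_sum_left atLeast0LessThan)
    finally show "(\<Sum>j\<in>?I. \<Sum>l\<in>?I. fscale (A $$ (i, j) * B $$ (j, l)) (?E i l f)) =
      (\<Sum>l\<in>?I. fscale ((A * B) $$ (i, l)) (?E i l f))" .
  qed
  also have "(\<Sum>i\<in>?I. \<Sum>j\<in>?I. \<Sum>k\<in>?I. fscale (A $$ (i, j) * B $$ (k, i)) (?E k j f)) =
      (\<Sum>k\<in>?I. \<Sum>j\<in>?I. fscale ((B * A) $$ (k, j)) (?E k j f))"
  proof -
    have "(\<Sum>i\<in>?I. \<Sum>j\<in>?I. \<Sum>k\<in>?I. fscale (A $$ (i, j) * B $$ (k, i)) (?E k j f)) =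
      (\<Sum>i\<in>?I. \<Sum>k\<in>?I. \<Sum>j\<in>?I. fscale (A $$ (i, j) * B $$ (k, i)) (?E k j f))"
      by (rule sum.cong[OF refl], rule sum.swap)
    also have "\<dots> = (\<Sum>k\<in>?I. \<Sum>i\<in>?I. \<Sum>j\<in>?I. fscale (A $$ (i, j) * B $$ (k, i)) (?E k j f))"
      by (rule sum.swap)
    also have "\<dots> = (\<Sum>k\<in>?I. \<Sum>j\<in>?I. \<Sum>i\<in>?I. fscale (A $$ (i, j) * B $$ (k, i)) (?E k j f))"
      by (rule sum.cong[OF refl], rule sum.swap)
    also have "\<dots> = (\<Sum>k\<in>?I. \<Sum>j\<in>?I. fscale ((B * A) $$ (k, j)) (?E k j f))"
      using A B by (intro sum.cong refl)
        (simp add: scalar_prod_def fs.scale_sum_left atLeast0LessThan mult.commute)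
    finally show ?thesis .
  qed
  also have "(\<Sum>i\<in>?I. \<Sum>l\<in>?I. fscale ((A * B) $$ (i, l)) (?E i l f)) -
      (\<Sum>k\<in>?I. \<Sum>j\<in>?I. fscale ((B * A) $$ (k, j)) (?E k j f)) = gl_act m (A * B - B * A) f"
    using A B by (simp add: gl_act_def fs.scale_left_diff_distrib sum_subtractf)
  finally show ?thesis by simp
qed

section \<open>The contravariant form\<close>

text \<open>Squared norms of the powers of one variable, chosen such that \<open>q\<close> and \<open>p\<close> become adjoint.  The
  recursion \<open>norm1 (z + 1) = norm_ratio z * norm1 z\<close> imposes no condition at \<open>z = -1\<close>, where \<open>q\<close>
  vanishes; the value 1 there only keeps the norms nonzero.\<close>

definition norm_ratio :: "complex \<Rightarrow> complex" where
  "norm_ratio z = (if \<not> neg_int z then z + 1 else if z = -1 then 1 else 1 / (z + 1))"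

text \<open>The solution of the recursion on each coset of the integers that takes the value 1 at the
  representative with real part in \<open>[0, 1)\<close>.\<close>

definition norm1 :: "complex \<Rightarrow> complex" where
  "norm1 z = (let k = \<lfloor>Re z\<rfloor>; z0 = z - of_int k in
     if 0 \<le> k then \<Prod>j<nat k. norm_ratio (z0 + of_nat j)
     else \<Prod>j<nat (-k). 1 / norm_ratio (z0 - 1 - of_nat j))"

lemma norm_ratio_nonzero: "norm_ratio z \<noteq> 0"
  by (auto simp: norm_ratio_def add_eq_0_iff2)

lemma norm1_nonzero: "norm1 z \<noteq> 0"
  by (simp add: norm1_def Let_def norm_ratio_nonzero)

lemma norm1_succ: "norm1 (z + 1) = norm_ratio z * norm1 z"
proof (cases "0 \<le> \<lfloor>Re z\<rfloor>")
  case True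
  have "nat (1 + \<lfloor>Re z\<rfloor>) = Suc (nat \<lfloor>Re z\<rfloor>)" using Suc_nat_eq_nat_zadd1[OF True] by simp
  then show ?thesis using True by (simp add: norm1_def Let_def algebra_simps)
next
  case False
  then obtain l where l: "\<lfloor>Re z\<rfloor> = - int (Suc l)" 
    by (metis int_nat_eq less_imp_Suc_add minus_minus neg_less_0_iff_less nat_eq_iff2 not_le zero_less_imp_eq_int)
  then have l1: "\<lfloor>Re (z + 1)\<rfloor> = - int l" by simp
  let ?r = "\<lambda>j::nat. 1 / norm_ratio (z + of_nat l - of_nat j)"
  have "norm1 z = (\<Prod>j<Suc l. ?r j)"
    unfolding norm1_def Let_def l by (simp add: algebra_simps nat_add_distrib del: prod.lessThan_Suc)
  moreover have "norm1 (z + 1) = (\<Prod>j<l. ?r j)"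
    unfolding norm1_def Let_def l1 by (cases "l = 0") (simp_all add: algebra_simps)
  ultimately show ?thesis using norm_ratio_nonzero[of z] by simp
qed

lemma norm1_adjoint: "norm1 (z + 1) * q_coeff z = norm1 z * p_coeff (z + 1)"
  using neg_int_succ[of z] neg_int_pred[of "z + 1"]
  by (cases "z = -1") (auto simp: norm1_succ norm_ratio_def p_coeff_def q_coeff_def add_eq_0_iff2)

definition vec_norm :: "nat \<Rightarrow> complex vec \<Rightarrow> complex" where
  "vec_norm m \<beta> = (\<Prod>k<m. norm1 (\<beta> $ k))"

lemma vec_norm_nonzero: "vec_norm m \<beta> \<noteq> 0"
  by (simp add: vec_norm_def norm1_nonzero)

lemma vec_norm_adjoint:
  assumes "\<beta> \<in> carrier_vec m" "i < m"
  shows "vec_norm m (\<beta> + unit_vec m i) * q_coeff (\<beta> $ i) = vec_norm m \<beta> * p_coeff (\<beta> $ i + 1)"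
proof -
  have "vec_norm m (\<beta> + unit_vec m i) = norm1 (\<beta> $ i + 1) * (\<Prod>k\<in>{..<m}-{i}. norm1 (\<beta> $ k))"
    using assms by (simp add: vec_norm_def prod.remove[of _ i])
  moreover have "vec_norm m \<beta> = norm1 (\<beta> $ i) * (\<Prod>k\<in>{..<m}-{i}. norm1 (\<beta> $ k))"
    using assms by (simp add: vec_norm_def prod.remove[of _ i])
  ultimately show ?thesis using norm1_adjoint[of "\<beta> $ i"] by (simp add: algebra_simps)
qed

text \<open>The values of the form are written as vectors of the one-dimensional free space.\<close>

definition form :: "nat \<Rightarrow> (complex vec \<Rightarrow>\<^sub>0 complex) \<Rightarrow> (complex vec \<Rightarrow>\<^sub>0 complex) \<Rightarrow> (unit \<Rightarrow>\<^sub>0 complex)" where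
  "form m f h = linear_extension
     (\<lambda>\<beta>. single () (vec_norm m \<beta> * lookup h \<beta>)) f"

lemma flinear_form_left: "flinear (\<lambda>f. form m f h)"
  unfolding form_def by (rule flinear_linear_extension)

lemma flinear_form_right: "flinear (form m f)"
  unfolding form_def linear_extension_def
  by (intro flinear_sum flinear_scale flinearI)
     (auto intro!: poly_mapping_eqI simp: lookup_add lookup_single algebra_simps)

lemma form_single_right:
  "form m f (single \<beta> 1) = single () (vec_norm m \<beta> * lookup f \<beta>)"
proof (rule flinear_eq_on_supported[OF flinear_form_left, of _ _ UNIV])
  show "flinear (\<lambda>f. single () (vec_norm m \<beta> * lookup f \<beta>))"
    by (rule flinearI) (auto intro!: poly_mapping_eqI simp: lookup_add lookup_single algebra_simps)
qed (auto simp: supported_def form_def lookup_single when_def intro!: poly_mapping_eqI)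

lemma form_q_p:
  assumes "f \<in> vecs m" "h \<in> vecs m" "i < m"
  shows "form m (q_op m i f) h = form m f (p_op m i h)"
proof (rule flinear_eq_on_supported[OF flinear_compose[OF flinear_q flinear_form_left] flinear_form_left assms(1)])
  fix \<beta> :: "complex vec" assume \<beta>: "\<beta> \<in> carrier_vec m"
  show "form m (q_op m i (single \<beta> 1)) h = form m (single \<beta> 1) (p_op m i h)"
  proof (rule flinear_eq_on_supported[OF flinear_form_right flinear_compose[OF flinear_p flinear_form_right] assms(2)])
    fix \<gamma> :: "complex vec" assume \<gamma>: "\<gamma> \<in> carrier_vec m"
    have "\<gamma> = \<beta> + unit_vec m i \<longleftrightarrow> \<gamma> - unit_vec m i = \<beta>"
    proof -
      have "\<beta> + unit_vec m i - unit_vec m i = \<beta>" "\<gamma> - unit_vec m i + unit_vec m i = \<gamma>"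
        using \<beta> \<gamma> by (intro eq_vecI; auto)+
      then show ?thesis by metis
    qed
    then show "form m (q_op m i (single \<beta> 1)) (single \<gamma> 1) =
        form m (single \<beta> 1) (p_op m i (single \<gamma> 1))"
      using vec_norm_adjoint[OF \<beta> assms(3)] \<beta> assms(3)
      by (cases "\<gamma> = \<beta> + unit_vec m i")
         (auto simp: form_def q_op_single p_op_single lookup_single when_def mult.commute intro!: poly_mapping_eqI)
  qed
qed

lemma form_commute: "form m f h = form m h f"
proof (rule flinear_eq_on_supported[OF flinear_form_right flinear_form_left, of _ UNIV])
  show "form m f (single \<beta> 1) = form m (single \<beta> 1) f" for \<beta>
    unfolding form_single_right by (auto simp: form_def intro!: poly_mapping_eqI)
qed (simp add: supported_def)

lemma form_unit:
  assumes "f \<in> vecs m" "h \<in> vecs m" "i < m" "j < m"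
  shows "form m (gl_unit m i j f) h = form m f (gl_unit m j i h)"
proof -
  have "form m (gl_unit m i j f) h = form m (p_op m j f) (p_op m i h)"
    unfolding gl_unit_def using assms by (intro form_q_p p_closed)
  also have "\<dots> = form m (p_op m i h) (p_op m j f)" by (rule form_commute)
  also have "\<dots> = form m (gl_unit m j i h) f"
    unfolding gl_unit_def using assms by (intro form_q_p[symmetric] p_closed)
  finally show ?thesis using form_commute by metis
qed

section \<open>Admissible monomials\<close>

lemma single_in_subspace:
  assumes P: "fs.subspace P" and c: "single \<beta> c \<in> P" "c \<noteq> 0"
  shows "single \<beta> 1 \<in> P"
proof -
  have "fscale (1 / c) (single \<beta> c) = single \<beta> 1"
    using c(2) by (intro poly_mapping_eqI) (simp add: lookup_single when_def)
  then show ?thesis using fs.subspace_scale[OF P c(1)] by metis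
qed

text \<open>The exponents after the action of the matrix unit \<open>E\<^bsub>i,j\<^esub>\<close>, that is of \<open>q\<^sub>i p\<^sub>j\<close>.\<close>

definition move :: "nat \<Rightarrow> nat \<Rightarrow> nat \<Rightarrow> complex vec \<Rightarrow> complex vec" where
  "move m j i \<beta> = \<beta> - unit_vec m j + unit_vec m i"

lemma move_carrier [simp]: "move m j i \<beta> \<in> carrier_vec m"
  unfolding move_def by (rule carrier_vecI) simp

lemma move_index:
  assumes "\<beta> \<in> carrier_vec m" "k < m" "i < m" "j < m"
  shows "move m j i \<beta> $ k = \<beta> $ k - (if k = j then 1 else 0) + (if k = i then 1 else 0)"
  using assms by (simp add: move_def)

lemma unit_single:
  assumes "\<beta> \<in> carrier_vec m" "i < m" "j < m" "i \<noteq> j"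
  shows "gl_unit m i j (single \<beta> 1) =
    single (move m j i \<beta>) (p_coeff (\<beta> $ j) * q_coeff (\<beta> $ i))"
  using assms by (simp add: gl_unit_def p_op_single q_op_single move_def)

lemma unit_diagonal:
  assumes "\<beta> \<in> carrier_vec m" "i < m"
  shows "gl_unit m i i (single \<beta> 1) = single \<beta> (\<beta> $ i)"
proof -
  have "\<beta> - unit_vec m i + unit_vec m i = \<beta>" using assms by (intro eq_vecI) auto
  then show ?thesis
    using assms by (simp add: gl_unit_def p_op_single q_op_single p_q_coeff_pred)
qed

locale N_module =
  fixes n :: nat and a1 a2 :: complex
  assumes n: "n \<ge> 2" and a1: "a1 \<notin> \<int>" and a2: "a2 \<notin> \<int>" and a12: "a1 - a2 \<notin> \<int>"
begin

abbreviation "m \<equiv> 2 * n"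
abbreviation "Adm \<equiv> admissible n a1 a2"
abbreviation "base \<equiv> base_tuple n a1 a2"
abbreviation "N \<equiv> supported Adm"

lemma Adm_carrier: "\<beta> \<in> Adm \<Longrightarrow> \<beta> \<in> carrier_vec m"
  by (simp add: admissible_def)

lemma N_vecs: "f \<in> N \<Longrightarrow> f \<in> vecs m"
  using Adm_carrier by (auto simp: supported_def)

lemma Adm_diff: "\<beta> \<in> Adm \<Longrightarrow> k < m \<Longrightarrow> \<beta> $ k - base $ k \<in> \<int>"
  by (simp add: admissible_def)

lemma Adm_neg: "\<beta> \<in> Adm \<Longrightarrow> k < n - 1 \<Longrightarrow> neg_int (\<beta> $ k)"
  by (simp add: admissible_def)

lemma Adm_nat: "\<beta> \<in> Adm \<Longrightarrow> n < k \<Longrightarrow> k < m \<Longrightarrow> \<beta> $ k \<in> \<nat>"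
  by (simp add: admissible_def)

lemma base_index:
  "k < n - 1 \<Longrightarrow> base $ k = -1" "base $ (n - 1) = a1" "base $ n = a2"
  "n < k \<Longrightarrow> k < m \<Longrightarrow> base $ k = 0"
  using n by (auto simp: base_tuple_def)

lemma Ints_shift: "z - a \<in> \<int> \<Longrightarrow> a \<notin> \<int> \<Longrightarrow> (z :: complex) \<notin> \<int>"
  using Ints_diff[of z "z - a"] by auto

lemma Adm_nonint: "\<beta> \<in> Adm \<Longrightarrow> k = n - 1 \<or> k = n \<Longrightarrow> \<beta> $ k \<notin> \<int>"
proof -
  assume \<beta>: "\<beta> \<in> Adm" and k: "k = n - 1 \<or> k = n"
  have "k < m" "base $ k \<notin> \<int>" using k n a1 a2 base_index by auto
  then show ?thesis using Ints_shift[OF Adm_diff[OF \<beta>]] by blast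
qed

lemma not_neg_nat: "z \<in> \<nat> \<Longrightarrow> \<not> neg_int z"
  by (auto simp: neg_int_iff elim!: Nats_cases)

lemma nonint_not_neg: "z \<notin> \<int> \<Longrightarrow> \<not> neg_int z"
  by (auto simp: neg_int_iff)

lemma nat_pred: "z \<in> \<nat> \<Longrightarrow> z \<noteq> 0 \<Longrightarrow> (z :: complex) - 1 \<in> \<nat>"
proof (elim Nats_cases)
  fix k assume "z \<noteq> 0" "z = of_nat k"
  then have "z - 1 = of_nat (k - 1)" by (cases k) auto
  then show "z - 1 \<in> \<nat>" by simp
qed

lemma move_Adm:
  assumes \<beta>: "\<beta> \<in> Adm" and ij: "i < m" "j < m" "i \<noteq> j"
    and i: "i < n - 1 \<Longrightarrow> \<beta> $ i \<noteq> -1" and j: "n < j \<Longrightarrow> \<beta> $ j \<noteq> 0"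
  shows "move m j i \<beta> \<in> Adm"
proof -
  note idx = move_index[OF Adm_carrier[OF \<beta>]]
  have int: "move m j i \<beta> $ k - base $ k \<in> \<int>" if "k < m" for k
  proof -
    have "move m j i \<beta> $ k - base $ k =
        (\<beta> $ k - base $ k) + ((if k = i then 1 else 0) - (if k = j then 1 else 0))"
      using idx[OF that ij(1,2)] by simp
    moreover have "(if k = i then 1 else 0) - (if k = j then 1 else 0) \<in> (\<int> :: complex set)" by auto
    ultimately show ?thesis using Adm_diff[OF \<beta> that] by (metis Ints_add)
  qed
  have neg: "neg_int (move m j i \<beta> $ k)" if "k < n - 1" for k
    using idx[of k i j] that ij Adm_neg[OF \<beta> that] neg_int_succ[of "\<beta> $ k"] neg_int_pred[of "\<beta> $ k"] i
    by auto
  have nat: "move m j i \<beta> $ k \<in> \<nat>" if "n < k" "k < m" for k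
    using idx[of k i j] that ij Adm_nat[OF \<beta> that] nat_pred[of "\<beta> $ k"] j by auto
  have "(\<Sum>k<m. move m j i \<beta> $ k) =
      (\<Sum>k<m. \<beta> $ k - (if k = j then 1 else 0) + (if k = i then 1 else 0))"
    by (rule sum.cong) (use idx ij in auto)
  also have "\<dots> = (\<Sum>k<m. \<beta> $ k)"
    using ij by (simp add: sum.distrib sum_subtractf)
  also have "\<dots> = (\<Sum>k<m. base $ k)" using \<beta> by (simp add: admissible_def)
  finally show ?thesis using int neg nat unfolding admissible_def by auto
qed

text \<open>The coefficient vanishes exactly where the sign conditions on the exponents would be violated; this
  is why \<open>N\<close> is stable.\<close>

lemma unit_Adm_zero:
  assumes \<beta>: "\<beta> \<in> Adm" and ij: "i < m" "j < m" "i \<noteq> j"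
  shows "p_coeff (\<beta> $ j) * q_coeff (\<beta> $ i) = 0 \<or> move m j i \<beta> \<in> Adm"
proof (cases "(i < n - 1 \<longrightarrow> \<beta> $ i \<noteq> -1) \<and> (n < j \<longrightarrow> \<beta> $ j \<noteq> 0)")
  case True then show ?thesis using move_Adm[OF \<beta> ij] by blast
next
  case False then show ?thesis by (auto simp: p_coeff_def q_coeff_def)
qed

lemma unit_supported:
  assumes f: "f \<in> supported B" "B \<subseteq> Adm" and ij: "i < m" "j < m"
    and B': "\<And>\<beta>. i = j \<Longrightarrow> \<beta> \<in> B \<Longrightarrow> \<beta> \<in> B'"
      "\<And>\<beta>. i \<noteq> j \<Longrightarrow> \<beta> \<in> B \<Longrightarrow> move m j i \<beta> \<in> Adm \<Longrightarrow> move m j i \<beta> \<in> B'"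
  shows "gl_unit m i j f \<in> supported B'"
proof (rule flinear_maps_supported[OF flinear_unit subspace_supported f(1)])
  fix \<beta> assume b: "\<beta> \<in> B"
  then have \<beta>: "\<beta> \<in> Adm" "\<beta> \<in> carrier_vec m" using f(2) Adm_carrier by auto
  show "gl_unit m i j (single \<beta> 1) \<in> supported B'"
  proof (cases "i = j")
    case True then show ?thesis
      using b B'(1) ij \<beta> by (simp add: unit_diagonal single_supported)
  next
    case False
    have "p_coeff (\<beta> $ j) * q_coeff (\<beta> $ i) = 0 \<or> move m j i \<beta> \<in> B'"
      using unit_Adm_zero[OF \<beta>(1) ij False] B'(2)[OF False b] by blast
    then show ?thesis
      unfolding unit_single[OF \<beta>(2) ij False]
      using single_supported single_zero fs.subspace_0[OF subspace_supported] by metis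
  qed
qed

lemma unit_N: "f \<in> N \<Longrightarrow> i < m \<Longrightarrow> j < m \<Longrightarrow> gl_unit m i j f \<in> N"
  by (rule unit_supported[of f Adm]) auto

lemma gl_act_N: "f \<in> N \<Longrightarrow> gl_act m A f \<in> N"
  unfolding gl_act_def
  by (intro fs.subspace_sum[OF subspace_supported] fs.subspace_scale[OF subspace_supported] unit_N) auto

section \<open>The dual pair\<close>

lemma sum_halves: "(\<Sum>i<m. f i) = (\<Sum>i<n. f i) + (\<Sum>i<n. f (n + i))"
  for f :: "nat \<Rightarrow> 'x :: comm_monoid_add"
proof -
  have "(\<Sum>i<n + k. f i) = (\<Sum>i<n. f i) + (\<Sum>i<k. f (n + i))" for k
    by (induction k) (simp_all add: add.assoc)
  then show ?thesis by (simp only: mult_2)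
qed

abbreviation "X \<equiv> gl_act m (mat_X n)"
abbreviation "Y \<equiv> gl_act m (mat_Y n)"
abbreviation "H \<equiv> gl_act m (mat_H n)"

definition b_unit :: "nat \<Rightarrow> nat \<Rightarrow> (complex vec \<Rightarrow>\<^sub>0 complex) \<Rightarrow> (complex vec \<Rightarrow>\<^sub>0 complex)" where
  "b_unit i j f = gl_unit m i j f + gl_unit m (n + i) (n + j) f"

lemma flinear_b_unit: "flinear (b_unit i j)"
  unfolding b_unit_def[abs_def] by (intro flinear_add flinear_unit)

lemma sum_diag: "k < n \<Longrightarrow> (\<Sum>j<n. fscale (if k = j then 1 else 0) (F j)) = F k"
  by (subst sum.mono_neutral_right[of _ "{k}"]) auto

lemma X_eq: "X f = (\<Sum>i<n. gl_unit m (n + i) i f)"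
  by (simp add: gl_act_def sum_halves mat_X_def sum.distrib sum_diag)

lemma Y_eq: "Y f = (\<Sum>i<n. gl_unit m i (n + i) f)"
  by (simp add: gl_act_def sum_halves mat_Y_def sum.distrib sum_diag)

lemma H_eq: "H f = (\<Sum>i<n. gl_unit m i i f) - (\<Sum>i<n. gl_unit m (n + i) (n + i) f)"
proof -
  have "(\<Sum>j<n. fscale (- (if k = j then 1 else 0)) (F j)) = - F k" if "k < n" for k and F :: "nat \<Rightarrow> complex vec \<Rightarrow>\<^sub>0 complex"
    using that by (subst sum.mono_neutral_right[of _ "{k}"]) auto
  then show ?thesis
    by (simp add: gl_act_def sum_halves mat_H_def sum.distrib sum_diag sum_negf)
qed

lemma diag2_eq:
  assumes "A \<in> carrier_mat n n"
  shows "gl_act m (diag2 n A) f = (\<Sum>i<n. \<Sum>j<n. fscale (A $$ (i, j)) (b_unit i j f))"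
  using assms
  by (simp add: gl_act_def sum_halves diag2_def sum.distrib b_unit_def fs.scale_right_distrib)

section \<open>Levels\<close>

text \<open>Weights of the \<open>2n\<close> indices.  They increase along the indices of each half, and the index \<open>n + i\<close> has
  a larger weight than \<open>i\<close>, so that \<open>X\<close> and the lower triangular matrix units of \<open>b\<close> increase the level.
  They are 0 at the two indices with nonintegral exponents, negative where the exponents are at most
  -1, and positive where these are natural numbers, so that the level is a natural number.\<close>

definition wt :: "nat \<Rightarrow> int" where
  "wt k = (if k < n then int k - int (n - 1) else int k - int n)"

definition clevel :: "complex vec \<Rightarrow> complex" where
  "clevel \<beta> = (\<Sum>k<m. of_int (wt k) * (\<beta> $ k - base $ k))"

definition level :: "complex vec \<Rightarrow> nat" where
  "level \<beta> = nat \<lfloor>Re (clevel \<beta>)\<rfloor>"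

lemma clevel_eq_level: assumes "\<beta> \<in> Adm" shows "clevel \<beta> = of_nat (level \<beta>)"
proof -
  have "of_int (wt k) * (\<beta> $ k - base $ k) \<in> \<nat>" if k: "k < m" for k
  proof -
    consider "k < n - 1" | "k = n - 1 \<or> k = n" | "n < k" by linarith
    then show ?thesis
    proof cases
      case 1
      then obtain l where l: "l < 0" "\<beta> $ k = of_int l"
        using Adm_neg[OF assms] unfolding neg_int_def by blast
      have "of_int (wt k) * (\<beta> $ k - base $ k) = of_int ((int (n - 1) - int k) * (- l - 1))"
        using 1 l base_index by (simp add: wt_def algebra_simps)
      also have "\<dots> = of_nat (nat ((int (n - 1) - int k) * (- l - 1)))"
        using 1 l by (simp add: of_nat_nat)
      finally show ?thesis by simp
    next
      case 2 then show ?thesis using n by (auto simp: wt_def)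
    next
      case 3
      then have "of_int (wt k) = (of_nat (k - n) :: complex)" by (simp add: wt_def of_nat_diff)
      moreover have "\<beta> $ k - base $ k = \<beta> $ k" using 3 k base_index by simp
      ultimately show ?thesis using Adm_nat[OF assms 3 k] by (simp only: Nats_mult of_nat_in_Nats)
    qed
  qed
  moreover have "(\<And>k. k \<in> A \<Longrightarrow> g k \<in> \<nat>) \<Longrightarrow> sum g A \<in> \<nat>" for A and g :: "nat \<Rightarrow> complex"
    by (induction A rule: infinite_finite_induct) auto
  from this[of "{..<m}" "\<lambda>k. of_int (wt k) * (\<beta> $ k - base $ k)"]
  have "(\<And>k. k < m \<Longrightarrow> of_int (wt k) * (\<beta> $ k - base $ k) \<in> \<nat>) \<Longrightarrow> clevel \<beta> \<in> \<nat>"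
    by (simp add: clevel_def)
  ultimately have "clevel \<beta> \<in> \<nat>" by simp
  then show ?thesis by (auto simp: level_def elim!: Nats_cases)
qed

lemma clevel_move:
  assumes "\<beta> \<in> carrier_vec m" "i < m" "j < m"
  shows "clevel (move m j i \<beta>) = clevel \<beta> + of_int (wt i) - of_int (wt j)"
proof -
  have "clevel (move m j i \<beta>) = (\<Sum>k<m. of_int (wt k) * (\<beta> $ k - base $ k)
      - (if k = j then of_int (wt k) else 0) + (if k = i then of_int (wt k) else 0))"
    unfolding clevel_def using assms
    by (intro sum.cong refl) (auto simp: move_index algebra_simps)
  then show ?thesis using assms by (simp add: sum.distrib sum_subtractf clevel_def)
qed

lemma level_move:
  assumes "\<beta> \<in> Adm" "i < m" "j < m" "move m j i \<beta> \<in> Adm"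
  shows "int (level (move m j i \<beta>)) = int (level \<beta>) + wt i - wt j"
proof -
  have "(of_int (int (level (move m j i \<beta>))) :: complex) = of_int (int (level \<beta>) + wt i - wt j)"
    using clevel_move[OF Adm_carrier[OF assms(1)] assms(2,3)] clevel_eq_level assms by simp
  then show ?thesis by (simp only: of_int_eq_iff)
qed

section \<open>Lowering operators reach all but the top monomials\<close>

text \<open>Up to an integer, the expression is \<open>a2 - a1\<close>.\<close>

lemma step_coefficient:
  assumes "\<beta> \<in> Adm"
  shows "\<beta> $ n - (\<Sum>i\<in>{1..<n}. \<beta> $ i) \<noteq> 0"
proof
  assume 0: "\<beta> $ n - (\<Sum>i\<in>{1..<n}. \<beta> $ i) = 0"
  have "(\<beta> $ n - base $ n) - (\<Sum>i\<in>{1..<n}. \<beta> $ i - base $ i) \<in> \<int>"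
    using n by (intro Ints_diff Ints_sum Adm_diff assms) auto
  then have "- (base $ n - (\<Sum>i\<in>{1..<n}. base $ i)) \<in> \<int>"
    using 0 by (simp add: sum_subtractf algebra_simps)
  moreover have "(\<Sum>i\<in>{1..<n}. base $ i) = a1 - of_nat (n - 2)"
  proof -
    have "{1..<n} = insert (n - 1) {1..<n-1}" using n by auto
    moreover have "(\<Sum>i\<in>{1..<n-1}. base $ i) = (\<Sum>i\<in>{1..<n-1}. -1)"
      by (rule sum.cong) (auto simp: base_index)
    ultimately show ?thesis using n by (simp add: base_index base_index(2)[simplified] numeral_2_eq_2)
  qed
  ultimately have "- (a2 - (a1 - of_nat (n - 2))) \<in> \<int>" by (simp only: base_index)
  then have "- (a2 - (a1 - of_nat (n - 2))) + of_nat (n - 2) \<in> \<int>" by (intro Ints_add) auto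
  then show False using a12 by (simp add: algebra_simps)
qed

text \<open>Stated for an arbitrary subspace \<open>P\<close>, because \<open>P\<close> will be both a submodule and the orthogonal
  complement of a singular vector.\<close>

definition lowers_into :: "(complex vec \<Rightarrow>\<^sub>0 complex) set \<Rightarrow> nat \<Rightarrow> bool" where
  "lowers_into P l \<longleftrightarrow> fs.subspace P \<and> (\<forall>\<gamma>\<in>Adm. level \<gamma> < l \<longrightarrow>
     X (single \<gamma> 1) \<in> P \<and>
     (\<forall>i j. i < j \<longrightarrow> j < n \<longrightarrow> b_unit j i (single \<gamma> 1) \<in> P))"

lemma move_move:
  assumes "\<beta> \<in> carrier_vec m"
  shows "move m i j (move m j i \<beta>) = \<beta>"
    "move m k l (move m j i \<beta>) = move m j i (move m k l \<beta>)"
    "move m i k (move m j i \<beta>) = move m j k \<beta>"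
  using assms unfolding move_def by (intro eq_vecI; auto)+

text \<open>For \<open>\<beta>\<^sub>0 < -1\<close> let \<open>\<gamma>\<close> and \<open>\<delta>\<^sub>i\<close> arise from \<open>\<beta>\<close> by moving one unit from the exponent at \<open>n\<close>, respectively
  at \<open>i\<close>, to the one at 0.  Then \<open>X\<close> maps \<open>x(\<gamma>)\<close> to \<open>x(\<beta>)\<close> plus multiples of certain \<open>x(\<eta>\<^sub>i)\<close> with \<open>0 < i < n\<close>,
  and the lower triangular unit of \<open>b\<close> at \<open>(i, 0)\<close> maps \<open>x(\<delta>\<^sub>i)\<close> to a combination of \<open>x(\<beta>)\<close> and \<open>x(\<eta>\<^sub>i)\<close>.
  Eliminating the \<open>x(\<eta>\<^sub>i)\<close> leaves \<open>x(\<beta>)\<close> with the coefficient \<open>1 - (\<beta>\<^sub>1 + \<dots> + \<beta>\<^bsub>n-1\<^esub>) / \<beta>\<^sub>n\<close>, which is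
  nonzero by \<open>step_coefficient\<close>.\<close>

lemma reach_first:
  assumes P: "lowers_into P (level \<beta>)" and \<beta>: "\<beta> \<in> Adm" and \<beta>0: "\<beta> $ 0 \<noteq> -1"
  shows "single \<beta> 1 \<in> P"
proof -
  let ?\<gamma> = "move m n 0 \<beta>" and ?\<delta> = "\<lambda>i. move m i 0 \<beta>" and ?\<eta> = "\<lambda>i. move m i (n + i) (move m n 0 \<beta>)"
  have sub: "fs.subspace P" using P by (simp add: lowers_into_def)
  have \<beta>c: "\<beta> \<in> carrier_vec m" using Adm_carrier \<beta> .
  have idx: "\<And>k i j. k < m \<Longrightarrow> i < m \<Longrightarrow> j < m \<Longrightarrow>
    move m j i \<beta> $ k = \<beta> $ k - (if k = j then 1 else 0) + (if k = i then 1 else 0)"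
    using move_index[OF \<beta>c] .
  have \<gamma>: "?\<gamma> \<in> Adm" using n \<beta>0 by (intro move_Adm \<beta>) auto
  have \<delta>: "?\<delta> i \<in> Adm" if "i \<in> {1..<n}" for i
    using that n \<beta>0 by (intro move_Adm \<beta>) auto
  have b0: "neg_int (\<beta> $ 0)" "neg_int (\<beta> $ 0 + 1)"
    using Adm_neg[OF \<beta>, of 0] n \<beta>0 neg_int_succ by auto
  have bn: "\<beta> $ n \<notin> \<int>" "\<beta> $ n - 1 \<notin> \<int>" "\<beta> $ n \<noteq> 0"
    using Adm_nonint[OF \<beta>, of n] Ints_shift[of "\<beta> $ n - 1" "\<beta> $ n"] by auto
  have XP: "X (single ?\<gamma> 1) \<in> P"
    using P \<gamma> level_move[OF \<beta> _ _ \<gamma>] n unfolding lowers_into_def by (simp add: wt_def)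
  have bP: "b_unit i 0 (single (?\<delta> i) 1) \<in> P" if "i \<in> {1..<n}" for i
    using P \<delta>[OF that] level_move[OF \<beta> _ _ \<delta>[OF that]] n that unfolding lowers_into_def by (simp add: wt_def)
  have nat: "q_coeff (\<beta> $ (n + i)) = 1" if "i \<in> {1..<n}" for i
    using Adm_nat[OF \<beta>, of "n + i"] that not_neg_nat by (auto simp: q_coeff_def)
  have X1: "X (single ?\<gamma> 1) = single \<beta> 1 +
      (\<Sum>i\<in>{1..<n}. single (?\<eta> i) (p_coeff (\<beta> $ i)))"
  proof -
    have "{..<n} = insert 0 {1..<n}" using n by auto
    moreover have "gl_unit m n 0 (single ?\<gamma> 1) = single \<beta> 1"
      using n b0 bn nonint_not_neg
      by (simp add: unit_single move_move \<beta>c idx p_coeff_def q_coeff_def)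
    moreover have "gl_unit m (n + i) i (single ?\<gamma> 1) =
        single (?\<eta> i) (p_coeff (\<beta> $ i))" if "i \<in> {1..<n}" for i
      using that n nat[OF that] by (simp add: unit_single idx)
    ultimately show ?thesis by (simp add: X_eq)
  qed
  have b1: "b_unit i 0 (single (?\<delta> i) 1) =
      single \<beta> (q_coeff (\<beta> $ i - 1)) + single (?\<eta> i) (\<beta> $ n)"
    if i: "i \<in> {1..<n}" for i
  proof -
    have "move m n (n + i) (move m i 0 \<beta>) = ?\<eta> i"
      using \<beta>c unfolding move_def by (intro eq_vecI) auto
    then show ?thesis
      using i n b0 bn nonint_not_neg nat[OF i]
      by (simp add: b_unit_def unit_single move_move \<beta>c idx p_coeff_def[of "\<beta> $ 0 + 1"] p_coeff_def[of "\<beta> $ n"])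
  qed
  let ?z = "X (single ?\<gamma> 1) -
      (\<Sum>i\<in>{1..<n}. fscale (p_coeff (\<beta> $ i) / \<beta> $ n) (b_unit i 0 (single (?\<delta> i) 1)))"
  have "?z \<in> P"
    by (intro fs.subspace_diff[OF sub] fs.subspace_sum[OF sub] fs.subspace_scale[OF sub] XP bP)
  also have "?z = single \<beta> (1 - (\<Sum>i\<in>{1..<n}. \<beta> $ i) / \<beta> $ n)"
  proof -
    have "(\<Sum>i\<in>{1..<n}. fscale (p_coeff (\<beta> $ i) / \<beta> $ n) (b_unit i 0 (single (?\<delta> i) 1))) =
      (\<Sum>i\<in>{1..<n}. single \<beta> (\<beta> $ i / \<beta> $ n) + single (?\<eta> i) (p_coeff (\<beta> $ i)))"
    proof (rule sum.cong[OF refl])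
      fix i assume i: "i \<in> {1..<n}"
      show "fscale (p_coeff (\<beta> $ i) / \<beta> $ n) (b_unit i 0 (single (?\<delta> i) 1)) =
        single \<beta> (\<beta> $ i / \<beta> $ n) + single (?\<eta> i) (p_coeff (\<beta> $ i))"
        unfolding b1[OF i] using bn p_q_coeff_pred[of "\<beta> $ i"]
        by (intro poly_mapping_eqI) (auto simp: lookup_add lookup_single when_def algebra_simps)
    qed
    moreover have "(\<Sum>i\<in>{1..<n}. single \<beta> (\<beta> $ i / \<beta> $ n)) =
        single \<beta> ((\<Sum>i\<in>{1..<n}. \<beta> $ i) / \<beta> $ n)"
      by (intro poly_mapping_eqI) (simp add: lookup_sum lookup_single when_def sum_divide_distrib)
    ultimately show ?thesis unfolding X1 by (simp add: sum.distrib single_diff)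
  qed
  finally have z: "single \<beta> (1 - (\<Sum>i\<in>{1..<n}. \<beta> $ i) / \<beta> $ n) \<in> P" .
  let ?c = "1 - (\<Sum>i\<in>{1..<n}. \<beta> $ i) / \<beta> $ n"
  have c: "?c \<noteq> 0" using step_coefficient[OF \<beta>] bn by (simp add: field_simps)
  then show ?thesis using single_in_subspace[OF sub z] by blast
qed

definition top_monomial :: "complex vec \<Rightarrow> bool" where
  "top_monomial \<beta> \<longleftrightarrow> (\<forall>i<n - 1. \<beta> $ i = -1) \<and> (\<forall>j\<in>{1..<n}. \<beta> $ (n + j) = 0)"

text \<open>With \<open>\<beta>\<^sub>0 < -1\<close> settled, a positive exponent at \<open>n + j\<close> is obtained through the lower triangular unit
  at \<open>(j, 0)\<close>, the error term having exponent -2 at 0; if all these exponents vanish, an exponent less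
  than -1 at \<open>i\<close> is obtained through the unit at \<open>(n - 1, i)\<close>, without error term.\<close>

lemma reach:
  assumes P: "lowers_into P (level \<beta>)" and \<beta>: "\<beta> \<in> Adm" and top: "\<not> top_monomial \<beta>"
  shows "single \<beta> 1 \<in> P"
proof -
  have sub: "fs.subspace P" using P by (simp add: lowers_into_def)
  have \<beta>c: "\<beta> \<in> carrier_vec m" using Adm_carrier \<beta> .
  have idx: "\<And>k i j. k < m \<Longrightarrow> i < m \<Longrightarrow> j < m \<Longrightarrow>
    move m j i \<beta> $ k = \<beta> $ k - (if k = j then 1 else 0) + (if k = i then 1 else 0)"
    using move_index[OF \<beta>c] .
  consider (first) "\<beta> $ 0 \<noteq> -1"
    | (second) j where "\<beta> $ 0 = -1" "j \<in> {1..<n}" "\<beta> $ (n + j) \<noteq> 0"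
    | (third) i where "\<beta> $ 0 = -1" "\<forall>j\<in>{1..<n}. \<beta> $ (n + j) = 0" "0 < i" "i < n - 1" "\<beta> $ i \<noteq> -1"
    using top unfolding top_monomial_def by (metis not_gr_zero)
  then show ?thesis
  proof cases
    case first then show ?thesis using reach_first[OF P \<beta>] by blast
  next
    case (second j)
    let ?\<delta> = "move m (n + j) n \<beta>" let ?\<beta>' = "move m 0 j ?\<delta>"
    have \<delta>: "?\<delta> \<in> Adm" using second n by (intro move_Adm \<beta>) auto
    have ld: "int (level ?\<delta>) = int (level \<beta>) - int j"
      using level_move[OF \<beta> _ _ \<delta>] second n by (simp add: wt_def)
    then have bP: "b_unit j 0 (single ?\<delta> 1) \<in> P"
      using P \<delta> second unfolding lowers_into_def by simp
    have "\<beta> $ n + 1 \<notin> \<int>" using Adm_nonint[OF \<beta>, of n] Ints_shift[of "\<beta> $ n + 1" "\<beta> $ n"] by auto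
    moreover from this have bn: "\<beta> $ n + 1 \<noteq> 0" by (metis Ints_0)
    moreover have "\<beta> $ (n + j) - 1 \<in> \<nat>"
      using Adm_nat[OF \<beta>, of "n + j"] second nat_pred by auto
    ultimately have b1: "b_unit j 0 (single ?\<delta> 1) =
        single ?\<beta>' (p_coeff (?\<delta> $ 0) * q_coeff (?\<delta> $ j)) + single \<beta> (\<beta> $ n + 1)"
      using second n nonint_not_neg[of "\<beta> $ n + 1"] not_neg_nat[of "\<beta> $ (n + j) - 1"]
      by (simp add: b_unit_def unit_single move_move \<beta>c idx p_coeff_def[of "\<beta> $ n + 1"] q_coeff_def[of "\<beta> $ (n + j) - 1"])
    have "single ?\<beta>' (p_coeff (?\<delta> $ 0) * q_coeff (?\<delta> $ j)) \<in> P"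
    proof (cases "p_coeff (?\<delta> $ 0) * q_coeff (?\<delta> $ j) = 0")
      case True then show ?thesis by (simp only: single_zero fs.subspace_0[OF sub])
    next
      case False
      then have \<beta>': "?\<beta>' \<in> Adm" using unit_Adm_zero[OF \<delta>, of j 0] second n by auto
      have "level ?\<beta>' = level \<beta>" using level_move[OF \<delta> _ _ \<beta>'] ld second n by (simp add: wt_def)
      moreover have "?\<beta>' $ 0 = -2"
        using second n move_index[of ?\<delta> m 0 j 0] by (simp add: idx)
      ultimately have "single ?\<beta>' 1 \<in> P"
        using reach_first[OF _ \<beta>'] P by simp
      then show ?thesis by (subst single_eq_fscale) (rule fs.subspace_scale[OF sub])
    qed
    then have "b_unit j 0 (single ?\<delta> 1) -
        single ?\<beta>' (p_coeff (?\<delta> $ 0) * q_coeff (?\<delta> $ j)) \<in> P"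
      by (rule fs.subspace_diff[OF sub bP])
    then have "single \<beta> (\<beta> $ n + 1) \<in> P" unfolding b1 by simp
    then show ?thesis using single_in_subspace[OF sub] bn by blast
  next
    case (third i)
    let ?\<delta> = "move m (n - 1) i \<beta>"
    have \<delta>: "?\<delta> \<in> Adm" using third n by (intro move_Adm \<beta>) auto
    have "int (level ?\<delta>) = int (level \<beta>) + int i - int (n - 1)"
      using level_move[OF \<beta> _ _ \<delta>] third n by (simp add: wt_def)
    then have bP: "b_unit (n - 1) i (single ?\<delta> 1) \<in> P"
      using P \<delta> third n unfolding lowers_into_def by simp
    have "\<beta> $ (n - 1) - 1 \<notin> \<int>"
      using Adm_nonint[OF \<beta>, of "n - 1"] Ints_shift[of "\<beta> $ (n - 1) - 1" "\<beta> $ (n - 1)"] by auto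
    moreover have "neg_int (\<beta> $ i + 1)" using Adm_neg[OF \<beta>] third neg_int_succ by blast
    moreover have "\<beta> $ (n + i) = 0" "n + i \<noteq> n - Suc 0" using third by auto
    ultimately have "b_unit (n - 1) i (single ?\<delta> 1) = single \<beta> 1"
      using third n nonint_not_neg
      by (simp add: b_unit_def unit_single move_move \<beta>c idx p_coeff_def q_coeff_def)
    then show ?thesis using bP by simp
  qed
qed

section \<open>Singular vectors\<close>

text \<open>Raising operators are adjoint to lowering operators, so the orthogonal complement of a singular
  vector contains all images of lowering operators, and with them every monomial that is not a top
  monomial.\<close>

lemma singular_support:
  assumes f: "f \<in> N" and Y: "Y f = 0" and b: "\<And>i j. i < j \<Longrightarrow> j < n \<Longrightarrow> b_unit i j f = 0"
    and \<beta>: "\<beta> \<in> keys f"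
  shows "top_monomial \<beta>"
proof (rule ccontr)
  assume "\<not> top_monomial \<beta>"
  have \<beta>A: "\<beta> \<in> Adm" using \<beta> f by (auto simp: supported_def)
  let ?P = "{h. form m f h = 0}"
  have sub: "fs.subspace ?P"
    by (rule fs.subspaceI) (auto simp: flinear_simps[OF flinear_form_right])
  have vecs: "single \<gamma> 1 \<in> vecs m" if "\<gamma> \<in> Adm" for \<gamma>
    using that Adm_carrier by (auto intro: single_supported)
  have "form m f (X (single \<gamma> 1)) = form m (Y f) (single \<gamma> 1)" if "\<gamma> \<in> Adm" for \<gamma>
    using form_unit[OF N_vecs[OF f] vecs[OF that]]
    by (simp add: X_eq Y_eq fs2.linear_sum[OF flinear_form_right] fs2.linear_sum[OF flinear_form_left])
  moreover have "form m f (b_unit j i (single \<gamma> 1)) = form m (b_unit i j f) (single \<gamma> 1)"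
    if "\<gamma> \<in> Adm" "i < n" "j < n" for \<gamma> i j
    using form_unit[OF N_vecs[OF f] vecs[OF that(1)]] that
    by (simp add: b_unit_def flinear_simps[OF flinear_form_right] flinear_simps[OF flinear_form_left])
  ultimately have "lowers_into ?P (level \<beta>)"
    unfolding lowers_into_def using sub Y b by (simp add: flinear_simps[OF flinear_form_left])
  then have "form m f (single \<beta> 1) = 0"
    using reach[OF _ \<beta>A \<open>\<not> top_monomial \<beta>\<close>] by blast
  then have "vec_norm m \<beta> * lookup f \<beta> = 0"
    unfolding form_single_right by (metis lookup_single_eq lookup_zero)
  then show False using vec_norm_nonzero \<beta> by (auto simp: in_keys_iff)
qed

end

section \<open>The action of the dual pair\<close>

context N_module
begin

lemma mat_carriers [simp]:
  "mat_X n \<in> carrier_mat m m" "mat_Y n \<in> carrier_mat m m" "mat_H n \<in> carrier_mat m m"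
  "A \<in> carrier_mat n n \<Longrightarrow> diag2 n A \<in> carrier_mat m m"
  unfolding mat_X_def mat_Y_def mat_H_def diag2_def mult_2 by (auto intro!: four_block_carrier_mat)

lemma mat_YX: "mat_Y n * mat_X n - mat_X n * mat_Y n = mat_H n"
proof -
  have "mat_Y n * mat_X n = four_block_mat (1\<^sub>m n) (0\<^sub>m n n) (0\<^sub>m n n) (0\<^sub>m n n)"
    unfolding mat_X_def mat_Y_def by (subst mult_four_block_mat[of _ n n _ n _ n]) auto
  moreover have "mat_X n * mat_Y n = four_block_mat (0\<^sub>m n n) (0\<^sub>m n n) (0\<^sub>m n n) (1\<^sub>m n)"
    unfolding mat_X_def mat_Y_def by (subst mult_four_block_mat[of _ n n _ n _ n]) auto
  ultimately show ?thesis
    by (intro eq_matI) (auto simp: mat_H_def)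
qed

lemma diag2_commute:
  assumes "A \<in> carrier_mat n n"
  shows "diag2 n A * mat_X n = mat_X n * diag2 n A" "diag2 n A * mat_Y n = mat_Y n * diag2 n A"
proof -
  have "diag2 n A * mat_X n = four_block_mat (0\<^sub>m n n) (0\<^sub>m n n) A (0\<^sub>m n n)"
    unfolding mat_X_def diag2_def using assms by (subst mult_four_block_mat[of _ n n _ n _ n]) auto
  moreover have "mat_X n * diag2 n A = four_block_mat (0\<^sub>m n n) (0\<^sub>m n n) A (0\<^sub>m n n)"
    unfolding mat_X_def diag2_def using assms by (subst mult_four_block_mat[of _ n n _ n _ n]) auto
  moreover have "diag2 n A * mat_Y n = four_block_mat (0\<^sub>m n n) A (0\<^sub>m n n) (0\<^sub>m n n)"
    unfolding mat_Y_def diag2_def using assms by (subst mult_four_block_mat[of _ n n _ n _ n]) auto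
  moreover have "mat_Y n * diag2 n A = four_block_mat (0\<^sub>m n n) A (0\<^sub>m n n) (0\<^sub>m n n)"
    unfolding mat_Y_def diag2_def using assms by (subst mult_four_block_mat[of _ n n _ n _ n]) auto
  ultimately show "diag2 n A * mat_X n = mat_X n * diag2 n A" "diag2 n A * mat_Y n = mat_Y n * diag2 n A"
    by simp_all
qed

lemma gl_act_commute:
  assumes A: "A \<in> carrier_mat m m" and B: "B \<in> carrier_mat m m" and "f \<in> vecs m" "A * B = B * A"
  shows "gl_act m A (gl_act m B f) = gl_act m B (gl_act m A f)"
proof -
  have "A * B - B * A = 0\<^sub>m m m" using assms(4) mult_carrier_mat[OF B A] by simp
  then show ?thesis using gl_act_commutator[OF A B assms(3)] by (simp add: gl_act_def)
qed

lemma X_pow_N: "f \<in> N \<Longrightarrow> (X ^^ k) f \<in> N"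
  by (induction k) (auto intro: gl_act_N)

lemma flinear_X_pow: "flinear (X ^^ k)" and flinear_Y_pow: "flinear (Y ^^ k)"
proof -
  have "flinear (T ^^ k)" if "flinear T" for T :: "(complex vec \<Rightarrow>\<^sub>0 complex) \<Rightarrow> (complex vec \<Rightarrow>\<^sub>0 complex)"
  proof (induction k)
    case 0 show ?case unfolding funpow.simps id_def by (rule flinear_id)
  next
    case (Suc k) then show ?case using flinear_compose[OF Suc that] by (simp add: comp_def)
  qed
  then show "flinear (X ^^ k)" "flinear (Y ^^ k)" by (simp_all add: flinear_gl_act)
qed

lemma diag2_X_pow:
  assumes "A \<in> carrier_mat n n" "f \<in> N"
  shows "gl_act m (diag2 n A) ((X ^^ k) f) = (X ^^ k) (gl_act m (diag2 n A) f)"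
proof (induction k)
  case (Suc k)
  have "gl_act m (diag2 n A) (X ((X ^^ k) f)) = X (gl_act m (diag2 n A) ((X ^^ k) f))"
    using assms by (intro gl_act_commute N_vecs X_pow_N diag2_commute) auto
  then show ?case using Suc by simp
qed simp

section \<open>Decomposition by degree\<close>

definition Adm_deg :: "int \<Rightarrow> complex vec set" where
  "Adm_deg b = {\<beta> \<in> Adm. (\<Sum>i<n. \<beta> $ i) = a1 - of_nat (n - 1) + of_int b}"

abbreviation "Ndeg b \<equiv> supported (Adm_deg b)"

lemma Ndeg_N: "f \<in> Ndeg b \<Longrightarrow> f \<in> N"
  by (auto simp: supported_def Adm_deg_def)

definition H_weight :: "int \<Rightarrow> complex" where
  "H_weight b = a1 - a2 + 2 * of_int b - (of_nat n - 1)"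

lemma H_weight_nonint: "H_weight b - of_nat k \<noteq> 0"
proof
  assume "H_weight b - of_nat k = 0"
  then have "a1 - a2 = of_int (int k + int n - 1 - 2 * b)" by (simp add: H_weight_def algebra_simps)
  then show False using a12 by (metis Ints_of_int)
qed

lemma base_sums: "(\<Sum>i<n. base $ i) = a1 - of_nat (n - 1)"
  "(\<Sum>i<n. base $ (n + i)) = a2"
proof -
  have "{..<n} = insert (n - 1) {..<n-1}" using n by auto
  moreover have "(\<Sum>i<n-1. base $ i) = (\<Sum>i<n-1. -1)"
    by (rule sum.cong) (auto simp: base_index)
  ultimately show "(\<Sum>i<n. base $ i) = a1 - of_nat (n - 1)"
    using base_index(2) by simp
  have "{..<n} = insert 0 {1..<n}" using n by auto
  moreover have "(\<Sum>i\<in>{1..<n}. base $ (n + i)) = 0"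
    by (rule sum.neutral) (auto simp: base_index)
  ultimately show "(\<Sum>i<n. base $ (n + i)) = a2"
    by (simp add: base_index)
qed

lemma Adm_deg_exists: "\<beta> \<in> Adm \<Longrightarrow> \<exists>b. \<beta> \<in> Adm_deg b"
proof -
  assume \<beta>: "\<beta> \<in> Adm"
  have "(\<Sum>i<n. \<beta> $ i - base $ i) \<in> \<int>" by (intro Ints_sum Adm_diff \<beta>) auto
  then obtain b where "(\<Sum>i<n. \<beta> $ i) - (a1 - of_nat (n - 1)) = of_int b"
    by (auto simp: sum_subtractf base_sums elim!: Ints_cases)
  then show ?thesis using \<beta> by (auto simp: Adm_deg_def algebra_simps intro!: exI[of _ b])
qed

lemma Adm_deg_unique: "\<beta> \<in> Adm_deg b \<Longrightarrow> \<beta> \<in> Adm_deg b' \<Longrightarrow> b = b'"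
  by (simp add: Adm_deg_def)

lemma Adm_deg_second: "\<beta> \<in> Adm_deg b \<Longrightarrow> (\<Sum>i<n. \<beta> $ (n + i)) = a2 - of_int b"
proof -
  assume \<beta>: "\<beta> \<in> Adm_deg b"
  then have "(\<Sum>i<m. \<beta> $ i) = (\<Sum>i<m. base $ i)" by (simp add: Adm_deg_def admissible_def)
  then have "(\<Sum>i<n. \<beta> $ i) + (\<Sum>i<n. \<beta> $ (n + i)) = a1 - of_nat (n - 1) + a2"
    unfolding sum_halves base_sums .
  moreover have "(\<Sum>i<n. \<beta> $ i) = a1 - of_nat (n - 1) + of_int b" using \<beta> by (simp add: Adm_deg_def)
  ultimately have "a1 - of_nat (n - 1) + of_int b + (\<Sum>i<n. \<beta> $ (n + i)) = a1 - of_nat (n - 1) + a2"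
    by simp
  then show ?thesis by (simp add: eq_diff_eq add.commute)
qed

lemma H_act_Ndeg: assumes "f \<in> Ndeg b" shows "H f = fscale (H_weight b) f"
proof (rule flinear_eq_on_supported[OF flinear_gl_act flinear_scale[OF flinear_id] assms])
  fix \<beta> assume \<beta>: "\<beta> \<in> Adm_deg b"
  have "H (single \<beta> 1) =
      single \<beta> ((\<Sum>i<n. \<beta> $ i) - (\<Sum>i<n. \<beta> $ (n + i)))"
    using \<beta> Adm_carrier[of \<beta>]
    by (intro poly_mapping_eqI)
       (auto simp: H_eq unit_diagonal Adm_deg_def lookup_minus lookup_sum lookup_single when_def)
  also have "(\<Sum>i<n. \<beta> $ i) - (\<Sum>i<n. \<beta> $ (n + i)) = H_weight b"
    using Adm_deg_second[OF \<beta>] \<beta> n by (simp add: Adm_deg_def H_weight_def of_nat_diff)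
  finally show "H (single \<beta> 1) = fscale (H_weight b) (single \<beta> 1)"
    by (simp flip: single_eq_fscale)
qed

lemma unit_Ndeg:
  assumes "f \<in> Ndeg b" "i < m" "j < m"
    and b': "b' = b + (if i < n then 1 else 0) - (if j < n then 1 else 0)"
  shows "gl_unit m i j f \<in> Ndeg b'"
proof (rule unit_supported[OF assms(1) _ assms(2,3)])
  show "\<beta> \<in> Adm_deg b'" if "i = j" "\<beta> \<in> Adm_deg b" for \<beta> using that b' by simp
  show "move m j i \<beta> \<in> Adm_deg b'" if \<beta>: "\<beta> \<in> Adm_deg b" and "move m j i \<beta> \<in> Adm" for \<beta>
  proof -
    have "\<beta> \<in> carrier_vec m" using \<beta> Adm_carrier by (simp add: Adm_deg_def)
    then have "(\<Sum>k<n. move m j i \<beta> $ k) =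
        (\<Sum>k<n. \<beta> $ k - (if k = j then 1 else 0) + (if k = i then 1 else 0))"
      by (intro sum.cong) (use move_index[OF _ _ assms(2,3)] in auto)
    also have "\<dots> = (\<Sum>k<n. \<beta> $ k) - (if j < n then 1 else 0) + (if i < n then 1 else 0)"
      by (simp add: sum.distrib sum_subtractf)
    finally show ?thesis using that b' by (auto simp: Adm_deg_def)
  qed
qed (auto simp: Adm_deg_def)

lemma X_Ndeg: "f \<in> Ndeg b \<Longrightarrow> X f \<in> Ndeg (b - 1)"
  unfolding X_eq by (intro fs.subspace_sum[OF subspace_supported] unit_Ndeg[of f b]) auto

lemma X_pow_Ndeg: "f \<in> Ndeg b \<Longrightarrow> (X ^^ k) f \<in> Ndeg (b - int k)"
proof (induction k)
  case (Suc k) then show ?case using X_Ndeg[of "(X ^^ k) f" "b - int k"] by (simp add: algebra_simps)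
qed simp

lemma diag2_Ndeg: "f \<in> Ndeg b \<Longrightarrow> A \<in> carrier_mat n n \<Longrightarrow> gl_act m (diag2 n A) f \<in> Ndeg b"
  unfolding diag2_eq b_unit_def
  by (intro fs.subspace_sum[OF subspace_supported] fs.subspace_scale[OF subspace_supported]
      fs.subspace_add[OF subspace_supported] unit_Ndeg[of f b]) auto

text \<open>Vectors of different degrees have disjoint supports.\<close>

lemma Ndeg_independent:
  assumes fin: "finite B" and f: "\<And>b. b \<in> B \<Longrightarrow> f b \<in> Ndeg b" and s: "sum f B = 0" and b: "b \<in> B"
  shows "f b = 0"
proof (rule poly_mapping_eqI)
  fix \<beta>
  show "lookup (f b) \<beta> = lookup 0 \<beta>"
  proof (cases "\<beta> \<in> Adm_deg b")
    case True
    have "lookup (f b') \<beta> = 0" if "b' \<in> B - {b}" for b'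
      using f[of b'] that Adm_deg_unique[OF True] by (auto simp: supported_def in_keys_iff)
    then have "lookup (sum f B) \<beta> = lookup (f b) \<beta>"
      using fin b by (simp add: lookup_sum lookup_add sum.remove[of B b])
    then show ?thesis using s by simp
  next
    case False then show ?thesis using f[OF b] by (auto simp: supported_def in_keys_iff)
  qed
qed

section \<open>The kernel of the raising operator\<close>

definition K :: "int \<Rightarrow> (complex vec \<Rightarrow>\<^sub>0 complex) set" where
  "K b = {f \<in> Ndeg b. Y f = 0}"

lemma subspace_K: "fs.subspace (K b)"
  by (rule fs.subspaceI)
     (auto simp: K_def flinear_simps[OF flinear_gl_act] fs.subspace_0[OF subspace_supported]
        fs.subspace_add[OF subspace_supported] fs.subspace_scale[OF subspace_supported])

lemma K_N: "f \<in> K b \<Longrightarrow> f \<in> N" by (auto simp: K_def intro: Ndeg_N)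

lemma diag2_K: "f \<in> K b \<Longrightarrow> A \<in> carrier_mat n n \<Longrightarrow> gl_act m (diag2 n A) f \<in> K b"
  using gl_act_commute[of "mat_Y n" "diag2 n A" f] N_vecs[OF K_N] diag2_commute
  by (auto simp: K_def diag2_Ndeg flinear_simps[OF flinear_gl_act])

lemma Y_X: "f \<in> N \<Longrightarrow> Y (X f) = X (Y f) + H f"
  using gl_act_commutator[of "mat_Y n" m "mat_X n" f] N_vecs by (simp add: mat_YX)

text \<open>The usual induction with \<open>[Y, X] = H\<close>; each application of \<open>X\<close> lowers the eigenvalue of \<open>H\<close> by 2.\<close>

lemma Y_X_pow:
  assumes "f \<in> K b"
  shows "Y ((X ^^ Suc k) f) = fscale (of_nat (Suc k) * (H_weight b - of_nat k)) ((X ^^ k) f)"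
proof (induction k)
  case 0
  have "Y (X f) = H f" using Y_X[OF K_N[OF assms]] assms by (simp add: K_def flinear_simps[OF flinear_gl_act])
  then show ?case using H_act_Ndeg[of f b] assms by (simp add: K_def)
next
  case (Suc k)
  have "H ((X ^^ Suc k) f) = fscale (H_weight (b - int (Suc k))) ((X ^^ Suc k) f)"
    using H_act_Ndeg[OF X_pow_Ndeg[of f b "Suc k"]] assms unfolding K_def by blast
  moreover have "X (Y ((X ^^ Suc k) f)) = fscale (of_nat (Suc k) * (H_weight b - of_nat k)) ((X ^^ Suc k) f)"
    unfolding Suc by (simp add: flinear_simps[OF flinear_gl_act])
  ultimately have "Y (X ((X ^^ Suc k) f)) =
      fscale (of_nat (Suc k) * (H_weight b - of_nat k) + H_weight (b - int (Suc k))) ((X ^^ Suc k) f)"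
    using Y_X[OF X_pow_N[OF K_N[OF assms], of "Suc k"]] by (simp only: fs.scale_left_distrib)
  also have "of_nat (Suc k) * (H_weight b - of_nat k) + H_weight (b - int (Suc k)) =
      of_nat (Suc (Suc k)) * (H_weight b - of_nat (Suc k))"
    by (simp add: H_weight_def algebra_simps)
  finally show ?case by simp
qed

lemma Y_pow_X_pow: "\<exists>c. c \<noteq> 0 \<and> (\<forall>f \<in> K b. (Y ^^ k) ((X ^^ k) f) = fscale c f)"
proof (induction k)
  case 0 show ?case by (intro exI[of _ 1]) simp
next
  case (Suc k)
  then obtain c where c: "c \<noteq> 0" "\<And>f. f \<in> K b \<Longrightarrow> (Y ^^ k) ((X ^^ k) f) = fscale c f" by blast
  let ?d = "of_nat (Suc k) * (H_weight b - of_nat k)"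
  have "(Y ^^ Suc k) ((X ^^ Suc k) f) = fscale (?d * c) f" if "f \<in> K b" for f
    using that Y_X_pow[OF that, of k] c(2)[OF that]
    by (simp add: funpow_Suc_right flinear_simps[OF flinear_Y_pow] del: funpow.simps of_nat_Suc)
  moreover have "?d * c \<noteq> 0" using c(1) H_weight_nonint[of b k] by (simp del: of_nat_Suc)
  ultimately show ?case by blast
qed

lemma Y_pow_kills:
  assumes "f \<in> K b" "j < k" shows "(Y ^^ k) ((X ^^ j) f) = 0"
proof -
  obtain c where "(Y ^^ j) ((X ^^ j) f) = fscale c f" using Y_pow_X_pow assms(1) by blast
  then have "(Y ^^ Suc j) ((X ^^ j) f) = 0"
    using assms(1) by (simp add: K_def flinear_simps[OF flinear_gl_act])
  then have "(Y ^^ (k - Suc j)) ((Y ^^ Suc j) ((X ^^ j) f)) = 0"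
    by (simp only: flinear_simps[OF flinear_Y_pow])
  moreover have "(Y ^^ (k - Suc j)) ((Y ^^ Suc j) ((X ^^ j) f)) = (Y ^^ (k - Suc j + Suc j)) ((X ^^ j) f)"
    by (simp only: funpow_add comp_def)
  ultimately show ?thesis using assms(2) by simp
qed

text \<open>If \<open>k\<close> is the largest power of \<open>X\<close> that occurs, \<open>Y\<^sup>k\<close> kills all terms with smaller powers and returns
  nonzero multiples of the remaining \<open>t p\<close>, which lie in different degrees.\<close>

lemma X_pow_independent:
  fixes t :: "int \<times> nat \<Rightarrow> _"
  assumes fin: "finite S" and t: "\<And>p. p \<in> S \<Longrightarrow> t p \<in> K (fst p)"
    and zero: "(\<Sum>p\<in>S. (X ^^ snd p) (t p)) = 0" and p: "p \<in> S"
  shows "t p = 0"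
proof (rule ccontr)
  assume "t p \<noteq> 0"
  define S' where "S' = {p \<in> S. t p \<noteq> 0}"
  have S': "finite S'" "p \<in> S'" using fin p \<open>t p \<noteq> 0\<close> by (auto simp: S'_def)
  define k where "k = Max (snd ` S')"
  have k: "\<And>q. q \<in> S' \<Longrightarrow> snd q \<le> k" "k \<in> snd ` S'"
    using S' unfolding k_def by (auto intro!: Max_in)
  have "(\<Sum>p\<in>S'. (X ^^ snd p) (t p)) = 0"
    unfolding zero[symmetric]
    by (rule sum.mono_neutral_left) (use fin in \<open>auto simp: S'_def flinear_simps[OF flinear_X_pow]\<close>)
  then have "(\<Sum>p\<in>S'. (Y ^^ k) ((X ^^ snd p) (t p))) = 0"
    by (simp add: flinear_simps[OF flinear_Y_pow] flip: fs2.linear_sum[OF flinear_Y_pow])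
  moreover obtain c where c: "\<And>b. c b \<noteq> 0" "\<And>b f. f \<in> K b \<Longrightarrow> (Y ^^ k) ((X ^^ k) f) = fscale (c b) f"
    using Y_pow_X_pow[of _ k] by metis
  have "(Y ^^ k) ((X ^^ snd q) (t q)) = (if snd q = k then fscale (c (fst q)) (t q) else 0)" if "q \<in> S'" for q
    using c(2) t[of q] k(1)[OF that] that Y_pow_kills[of "t q" "fst q" "snd q" k] by (auto simp: S'_def)
  ultimately have "(\<Sum>q\<in>S'. if snd q = k then fscale (c (fst q)) (t q) else 0) = 0" by simp
  moreover have "(\<Sum>q\<in>S'. if snd q = k then fscale (c (fst q)) (t q) else 0) =
      (\<Sum>q\<in>{q \<in> S'. snd q = k}. fscale (c (fst q)) (t q))"
    using S'(1) by (simp add: sum.inter_filter)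
  moreover have "(\<Sum>q\<in>{q \<in> S'. snd q = k}. fscale (c (fst q)) (t q)) =
      (\<Sum>b\<in>fst ` {q \<in> S'. snd q = k}. fscale (c b) (t (b, k)))"
    by (subst sum.reindex) (auto simp: inj_on_def intro!: sum.cong)
  ultimately have z: "(\<Sum>b\<in>fst ` {q \<in> S'. snd q = k}. fscale (c b) (t (b, k))) = 0" by simp
  obtain q where q: "q \<in> S'" "snd q = k" using k(2) by auto
  have "fscale (c (fst q)) (t (fst q, k)) = 0"
  proof (rule Ndeg_independent[OF _ _ z])
    show "fscale (c b) (t (b, k)) \<in> Ndeg b" if "b \<in> fst ` {q \<in> S'. snd q = k}" for b
    proof -
      have "(b, k) \<in> S" using that by (auto simp: S'_def)
      then have "t (b, k) \<in> Ndeg b" using t[of "(b, k)"] by (simp add: K_def)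
      then show ?thesis by (rule fs.subspace_scale[OF subspace_supported])
    qed
  qed (use S' q in auto)
  then show False using q c(1) by (auto simp: S'_def)
qed

section \<open>Highest weight vectors\<close>

text \<open>The exponents of the highest weight vector in degree \<open>b\<close>.\<close>

definition topv :: "int \<Rightarrow> complex vec" where
  "topv b = vec m (\<lambda>i. if i < n - 1 then -1 else if i = n - 1 then a1 + of_int b
     else if i = n then a2 - of_int b else 0)"

abbreviation "hwv b \<equiv> single (topv b) (1 :: complex)"

lemma topv_index:
  "i < n - 1 \<Longrightarrow> topv b $ i = -1" "topv b $ (n - 1) = a1 + of_int b" "topv b $ n = a2 - of_int b"
  "n < i \<Longrightarrow> i < m \<Longrightarrow> topv b $ i = 0"
  using n by (auto simp: topv_def)

lemma topv_carrier: "topv b \<in> carrier_vec m" by (simp add: topv_def)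

lemma topv_sums: "(\<Sum>i<n. topv b $ i) = a1 - of_nat (n - 1) + of_int b"
  "(\<Sum>i<n. topv b $ (n + i)) = a2 - of_int b"
proof -
  have "{..<n} = insert (n - 1) {..<n-1}" using n by auto
  moreover have "(\<Sum>i<n-1. topv b $ i) = (\<Sum>i<n-1. -1)"
    by (rule sum.cong) (auto simp: topv_index)
  ultimately show "(\<Sum>i<n. topv b $ i) = a1 - of_nat (n - 1) + of_int b"
    using topv_index(2) by simp
  have "{..<n} = insert 0 {1..<n}" using n by auto
  moreover have "(\<Sum>i\<in>{1..<n}. topv b $ (n + i)) = 0"
    by (rule sum.neutral) (auto simp: topv_index)
  ultimately show "(\<Sum>i<n. topv b $ (n + i)) = a2 - of_int b"
    by (simp add: topv_index)
qed

lemma topv_Adm: "topv b \<in> Adm_deg b"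
proof -
  have "topv b $ k - base $ k \<in> \<int>" if "k < m" for k
  proof -
    consider "k < n - 1" | "k = n - 1" | "k = n" | "n < k" by linarith
    then show ?thesis using that by cases (simp_all add: topv_index base_index topv_index(2)[simplified] base_index(2)[simplified])
  qed
  moreover have "(\<Sum>i<m. topv b $ i) = (\<Sum>i<m. base $ i)"
    by (simp add: sum_halves topv_sums base_sums)
  ultimately show ?thesis
    by (auto simp: Adm_deg_def admissible_def topv_carrier topv_sums topv_index)
qed

lemma top_monomial_eq:
  assumes "\<beta> \<in> Adm_deg b" "top_monomial \<beta>" shows "\<beta> = topv b"
proof (rule eq_vecI)
  have \<beta>: "\<beta> \<in> carrier_vec m" using assms(1) Adm_carrier by (auto simp: Adm_deg_def)
  then show "dim_vec \<beta> = dim_vec (topv b)" by (simp add: topv_def)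
  fix k assume "k < dim_vec (topv b)"
  then have k: "k < m" by (simp add: topv_def)
  have low: "\<beta> $ i = -1" if "i < n - 1" for i using assms(2) that by (simp add: top_monomial_def)
  have high: "\<beta> $ i = 0" if "n < i" "i < m" for i
  proof -
    have "i - n \<in> {1..<n}" using that by auto
    then have "\<beta> $ (n + (i - n)) = 0" using assms(2) unfolding top_monomial_def by blast
    then show ?thesis using that by simp
  qed
  have "{..<n} = insert (n - 1) {..<n-1}" using n by auto
  moreover have "(\<Sum>i<n-1. \<beta> $ i) = (\<Sum>i<n-1. -1)"
    by (rule sum.cong) (auto simp: low)
  ultimately have 1: "\<beta> $ (n - 1) = a1 + of_int b" using assms(1) by (simp add: Adm_deg_def)
  have "{..<n} = insert 0 {1..<n}" using n by auto
  moreover have "(\<Sum>i\<in>{1..<n}. \<beta> $ (n + i)) = 0"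
    by (rule sum.neutral) (auto simp: high)
  ultimately have 2: "\<beta> $ n = a2 - of_int b" using Adm_deg_second[OF assms(1)] by simp
  consider "k < n - 1" | "k = n - 1" | "k = n" | "n < k" by linarith
  then show "\<beta> $ k = topv b $ k"
    using k low high 1 2 by cases (auto simp: topv_index topv_index(2)[simplified])
qed

lemma hwv_unit_zero:
  assumes "i < m" "j < m" "i \<noteq> j" "i < n - 1 \<or> n < j"
  shows "gl_unit m i j (hwv b) = 0"
  using assms topv_index by (auto simp: unit_single topv_carrier p_coeff_def q_coeff_def)

lemma hwv_K: "hwv b \<in> K b"
proof -
  have "gl_unit m i (n + i) (hwv b) = 0" if "i < n" for i
    using that n by (intro hwv_unit_zero) auto
  then show ?thesis using topv_Adm by (auto simp: K_def Y_eq intro: single_supported)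
qed

lemma hwv_b_unit: "i < j \<Longrightarrow> j < n \<Longrightarrow> b_unit i j (hwv b) = 0"
  by (auto simp: b_unit_def hwv_unit_zero)

lemma hwv_diag:
  assumes "A \<in> carrier_mat n n" "\<And>i j. i < n \<Longrightarrow> j < n \<Longrightarrow> i \<noteq> j \<Longrightarrow> A $$ (i, j) = 0"
  shows "gl_act m (diag2 n A) (hwv b) = fscale (\<Sum>k<n. A $$ (k, k) * (topv b $ k + topv b $ (n + k))) (hwv b)"
proof -
  have "(\<Sum>j<n. fscale (A $$ (i, j)) (b_unit i j (hwv b))) = fscale (A $$ (i, i)) (b_unit i i (hwv b))"
    if "i < n" for i
    by (subst sum.mono_neutral_right[of _ "{i}"]) (use assms(2) that in auto)
  moreover have "b_unit i i (hwv b) = fscale (topv b $ i + topv b $ (n + i)) (hwv b)" if "i < n" for i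
    using that by (simp add: b_unit_def unit_diagonal topv_carrier flip: single_add single_eq_fscale)
  ultimately show ?thesis
    by (simp add: diag2_eq[OF assms(1)] fs.scale_sum_left)
qed

section \<open>Simplicity\<close>

definition Nlevel :: "nat \<Rightarrow> (complex vec \<Rightarrow>\<^sub>0 complex) set" where
  "Nlevel l = supported {\<beta> \<in> Adm. level \<beta> < l}"

lemma unit_Nlevel:
  assumes "f \<in> Nlevel (Suc l)" "i < m" "j < m" "wt i < wt j"
  shows "gl_unit m i j f \<in> Nlevel l"
  unfolding Nlevel_def
proof (rule unit_supported[OF assms(1)[unfolded Nlevel_def] _ assms(2,3)])
  show "move m j i \<beta> \<in> {\<beta> \<in> Adm. level \<beta> < l}"
    if "\<beta> \<in> {\<beta> \<in> Adm. level \<beta> < Suc l}" "move m j i \<beta> \<in> Adm" for \<beta>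
    using level_move[of \<beta> i j] that assms(2-4) by auto
qed (use assms(4) in auto)

text \<open>A nonzero vector of \<open>S\<close> whose support has the smallest possible maximal level is singular, since
  the strictly upper triangular units of \<open>b\<close> decrease levels and preserve \<open>S\<close>.\<close>

lemma hwv_in_subspace:
  assumes S: "fs.subspace S" "S \<subseteq> K b" "S \<noteq> {0}"
    and stable: "\<And>i j f. i < n \<Longrightarrow> j < n \<Longrightarrow> i \<noteq> j \<Longrightarrow> f \<in> S \<Longrightarrow> b_unit i j f \<in> S"
  shows "hwv b \<in> S"
proof -
  obtain f0 where f0: "f0 \<in> S" "f0 \<noteq> 0" using S(3) fs.subspace_0[OF S(1)] by blast
  have ex: "\<exists>l. \<exists>f\<in>S. f \<noteq> 0 \<and> f \<in> Nlevel l"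
  proof -
    have "f0 \<in> N" using f0 S(2) K_N by blast
    moreover have "level \<beta> < Suc (Max (level ` keys f0))" if "\<beta> \<in> keys f0" for \<beta>
      using that by (simp add: less_Suc_eq_le)
    ultimately have "f0 \<in> Nlevel (Suc (Max (level ` keys f0)))"
      unfolding Nlevel_def supported_def by blast
    then show ?thesis using f0 by blast
  qed
  define l where "l = (LEAST l. \<exists>f\<in>S. f \<noteq> 0 \<and> f \<in> Nlevel l)"
  obtain f where f: "f \<in> S" "f \<noteq> 0" "f \<in> Nlevel l" using LeastI_ex[OF ex] unfolding l_def by blast
  have "l \<noteq> 0"
  proof
    assume "l = 0"
    then have "keys f = {}" using f(3) by (auto simp: Nlevel_def supported_def)
    then show False using f(2) by simp
  qed
  then obtain l' where l': "l = Suc l'" by (cases l) auto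
  have min: "h = 0" if "h \<in> S" "h \<in> Nlevel l'" for h
    using not_less_Least[of l' "\<lambda>l. \<exists>f\<in>S. f \<noteq> 0 \<and> f \<in> Nlevel l"] that l' unfolding l_def[symmetric] by blast
  have "b_unit i j f = 0" if "i < j" "j < n" for i j
  proof (rule min)
    show "b_unit i j f \<in> S" using stable f that by auto
    show "b_unit i j f \<in> Nlevel l'"
      using f(3) that unfolding l' b_unit_def Nlevel_def
      by (intro fs.subspace_add[OF subspace_supported] unit_Nlevel[unfolded Nlevel_def]) (auto simp: wt_def)
  qed
  moreover have fK: "f \<in> K b" using f S by blast
  ultimately have "top_monomial \<beta>" if "\<beta> \<in> keys f" for \<beta>
    using singular_support[OF K_N[OF fK] _ _ that] by (auto simp: K_def)
  then have "keys f \<subseteq> {topv b}"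
    using fK top_monomial_eq by (auto simp: K_def supported_def)
  then have "f = single (topv b) (lookup f (topv b))"
    by (intro poly_mapping_eqI) (auto simp: lookup_single when_def in_keys_iff)
  moreover from this have "lookup f (topv b) \<noteq> 0" using f(2) by (metis single_zero)
  ultimately show ?thesis using single_in_subspace[OF S(1)] f(1) by metis
qed

text \<open>
  The span is stable under \<open>X\<close> and \<open>b\<close>, so \<open>reach\<close> applies to it, by induction on the level.\<close>

lemma N_span:
  assumes S: "\<And>b. S b \<subseteq> K b" "\<And>b. hwv b \<in> S b"
    and stable: "\<And>b i j f. i < n \<Longrightarrow> j < n \<Longrightarrow> i \<noteq> j \<Longrightarrow> f \<in> S b \<Longrightarrow> b_unit i j f \<in> S b"
    and commute: "\<And>b i j k f. i < n \<Longrightarrow> j < n \<Longrightarrow> f \<in> K b \<Longrightarrow> b_unit i j ((X ^^ k) f) = (X ^^ k) (b_unit i j f)"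
  shows "N \<subseteq> fs.span {(X ^^ k) f | k f b. f \<in> S b}" (is "_ \<subseteq> fs.span ?G")
proof -
  let ?W = "fs.span ?G"
  have G: "f \<in> S b \<Longrightarrow> (X ^^ k) f \<in> ?W" for f b k by (rule fs.span_base) blast
  have stab: "T f \<in> ?W" if "flinear T" "\<And>h. h \<in> ?G \<Longrightarrow> T h \<in> ?W" "f \<in> ?W" for T f
  proof -
    have "?W \<subseteq> {f. T f \<in> ?W}"
      by (rule fs.span_minimal, use that(2) in blast, rule fs.subspaceI)
         (auto simp: flinear_simps[OF that(1)] intro: fs.span_add fs.span_scale fs.span_zero)
    then show ?thesis using that(3) by blast
  qed
  have XW: "X f \<in> ?W" if "f \<in> ?W" for f
  proof (rule stab[OF flinear_gl_act _ that])
    show "X h \<in> ?W" if hG: "h \<in> ?G" for h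
    proof -
      obtain k f b where "h = (X ^^ k) f" "f \<in> S b" using hG by blast
      then show ?thesis using G[of f b "Suc k"] by simp
    qed
  qed
  have bW: "b_unit i j f \<in> ?W" if ij: "i < n" "j < n" "i \<noteq> j" and f: "f \<in> ?W" for i j f
  proof (rule stab[OF flinear_b_unit _ f])
    show "b_unit i j h \<in> ?W" if hG: "h \<in> ?G" for h
    proof -
      obtain k f b where h: "h = (X ^^ k) f" "f \<in> S b" using hG by blast
      then have "b_unit i j h = (X ^^ k) (b_unit i j f)" using commute ij S by blast
      then show ?thesis using G[OF stable[OF ij h(2)]] by simp
    qed
  qed
  have "single \<beta> 1 \<in> ?W" if "\<beta> \<in> Adm" for \<beta>
    using that
  proof (induction "level \<beta>" arbitrary: \<beta> rule: less_induct)
    case less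
    show ?case
    proof (cases "top_monomial \<beta>")
      case True
      obtain b where "\<beta> \<in> Adm_deg b" using Adm_deg_exists less by blast
      then show ?thesis using G[OF S(2), of 0 b] top_monomial_eq[OF _ True] by auto
    next
      case False
      have "lowers_into ?W (level \<beta>)"
        unfolding lowers_into_def using less XW bW by auto
      then show ?thesis using reach less False by blast
    qed
  qed
  then show ?thesis by (intro supported_subset) auto
qed

lemma span_finite_sum:
  assumes S: "\<And>b. fs.subspace (S b)" and f: "f \<in> fs.span {(X ^^ k) f | k f b. f \<in> S b}"
  obtains A t where "finite A" "\<And>p. t p \<in> S (fst p)" "\<And>p. p \<notin> A \<Longrightarrow> t p = 0"
    "f = (\<Sum>p\<in>A. (X ^^ snd p) (t p))"
proof -
  let ?R = "{f. \<exists>A t. finite A \<and> (\<forall>p. t p \<in> S (fst p)) \<and> (\<forall>p. p \<notin> A \<longrightarrow> t p = 0) \<and>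
      f = (\<Sum>p\<in>A. (X ^^ snd p) (t p))}"
  note X0 = flinear_simps[OF flinear_X_pow]
  have "fs.subspace ?R"
  proof (rule fs.subspaceI)
    show "0 \<in> ?R"
      using fs.subspace_0[OF S] by (auto intro!: exI[of _ "{}"] exI[of _ "\<lambda>_. 0"])
  next
    fix x y assume "x \<in> ?R" "y \<in> ?R"
    then obtain A s B t where A: "finite A" "\<And>p. s p \<in> S (fst p)" "\<And>p. p \<notin> A \<Longrightarrow> s p = 0"
        "x = (\<Sum>p\<in>A. (X ^^ snd p) (s p))" and
      B: "finite B" "\<And>p. t p \<in> S (fst p)" "\<And>p. p \<notin> B \<Longrightarrow> t p = 0"
        "y = (\<Sum>p\<in>B. (X ^^ snd p) (t p))" by blast
    have "x = (\<Sum>p\<in>A \<union> B. (X ^^ snd p) (s p))"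
      unfolding A(4) by (rule sum.mono_neutral_left) (use A B X0 in auto)
    moreover have "y = (\<Sum>p\<in>A \<union> B. (X ^^ snd p) (t p))"
      unfolding B(4) by (rule sum.mono_neutral_left) (use A B X0 in auto)
    ultimately have "x + y = (\<Sum>p\<in>A \<union> B. (X ^^ snd p) (s p + t p))"
      by (simp add: X0 sum.distrib)
    then show "x + y \<in> ?R"
      using A B fs.subspace_add[OF S] by (intro CollectI exI[of _ "A \<union> B"] exI[of _ "\<lambda>p. s p + t p"]) auto
  next
    fix c x assume "x \<in> ?R"
    then obtain A s where A: "finite A" "\<And>p. s p \<in> S (fst p)" "\<And>p. p \<notin> A \<Longrightarrow> s p = 0"
        "x = (\<Sum>p\<in>A. (X ^^ snd p) (s p))" by blast
    then have "fscale c x = (\<Sum>p\<in>A. (X ^^ snd p) (fscale c (s p)))"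
      by (simp add: X0 fs.scale_sum_right)
    then show "fscale c x \<in> ?R"
      using A fs.subspace_scale[OF S] by (intro CollectI exI[of _ A] exI[of _ "\<lambda>p. fscale c (s p)"]) auto
  qed
  moreover have "{(X ^^ k) f | k f b. f \<in> S b} \<subseteq> ?R"
  proof
    fix x assume "x \<in> {(X ^^ k) f | k f b. f \<in> S b}"
    then obtain k h b where "x = (X ^^ k) h" "h \<in> S b" by blast
    then show "x \<in> ?R"
      using fs.subspace_0[OF S]
      by (intro CollectI exI[of _ "{(b, k)}"] exI[of _ "\<lambda>p. if p = (b, k) then h else 0"]) auto
  qed
  ultimately have "fs.span {(X ^^ k) f | k f b. f \<in> S b} \<subseteq> ?R" by (intro fs.span_minimal)
  then have "f \<in> ?R" using f by (rule subsetD)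
  then show ?thesis
  proof (elim CollectE exE conjE)
    fix A t
    assume "finite A" "\<forall>p. t p \<in> S (fst p)" "\<forall>p. p \<notin> A \<longrightarrow> t p = 0" "f = (\<Sum>p\<in>A. (X ^^ snd p) (t p))"
    then show thesis by (intro that[of A t]) blast+
  qed
qed

lemma b_unit_eq:
  assumes "i < n" "j < n"
  shows "b_unit i j f = gl_act m (diag2 n (mat n n (\<lambda>p. if p = (i, j) then 1 else 0))) f"
proof -
  have "(\<Sum>l<n. fscale (if k = i \<and> l = j then 1 else 0) (b_unit k l f)) = (if k = i then b_unit i j f else 0)" for k
  proof -
    have "(\<Sum>l<n. fscale (if k = i \<and> l = j then 1 else 0) (b_unit k l f)) =
        (\<Sum>l<n. if l = j then (if k = i then b_unit i j f else 0) else 0)"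
      by (rule sum.cong) auto
    then show ?thesis using assms by simp
  qed
  then show ?thesis using assms by (subst diag2_eq) auto
qed

text \<open>Since \<open>S\<close> contains the highest weight vector, \<open>S\<close> together with all other \<open>K c\<close> still generates \<open>N\<close>.
  Comparing an expansion of \<open>f \<in> K b\<close> obtained in this way with \<open>f\<close> itself shows that \<open>f\<close> is the component
  of the expansion in \<open>S\<close>.\<close>

lemma K_simple:
  assumes S: "fs.subspace S" "S \<subseteq> K b" "S \<noteq> {0}"
    and stable: "\<And>i j f. i < n \<Longrightarrow> j < n \<Longrightarrow> i \<noteq> j \<Longrightarrow> f \<in> S \<Longrightarrow> b_unit i j f \<in> S"
  shows "S = K b"
proof (rule subset_antisym[OF S(2)], rule subsetI)
  fix f assume f: "f \<in> K b"
  define S' where "S' c = (if c = b then S else K c)" for c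
  have "N \<subseteq> fs.span {(X ^^ k) f | k f b. f \<in> S' b}"
  proof (rule N_span)
    show "S' c \<subseteq> K c" "hwv c \<in> S' c" for c
      using S hwv_in_subspace[OF S stable] hwv_K by (auto simp: S'_def)
    show "b_unit i j h \<in> S' c" if "i < n" "j < n" "i \<noteq> j" "h \<in> S' c" for c i j h
      using that stable diag2_K by (auto simp: S'_def b_unit_eq split: if_splits)
    show "b_unit i j ((X ^^ k) h) = (X ^^ k) (b_unit i j h)" if "i < n" "j < n" "h \<in> K c" for c i j k h
      using that K_N by (simp add: b_unit_eq diag2_X_pow)
  qed
  then have "f \<in> fs.span {(X ^^ k) f | k f b. f \<in> S' b}" using K_N f by blast
  moreover have "fs.subspace (S' c)" for c using S(1) subspace_K by (simp add: S'_def)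
  ultimately obtain A t where A: "finite A" "\<And>p. t p \<in> S' (fst p)" "\<And>p. p \<notin> A \<Longrightarrow> t p = 0"
    "f = (\<Sum>p\<in>A. (X ^^ snd p) (t p))" using span_finite_sum[of S' f] by blast
  define A' where "A' = insert (b, 0::nat) A"
  have fA: "f = (\<Sum>p\<in>A'. (X ^^ snd p) (t p))"
    unfolding A(4) A'_def
    by (rule sum.mono_neutral_left) (use A(1,3) in \<open>auto simp: flinear_simps[OF flinear_X_pow]\<close>)
  let ?e = "\<lambda>p. if p = (b, 0::nat) then f else 0"
  have "(\<Sum>p\<in>A'. (X ^^ snd p) (?e p)) = (\<Sum>p\<in>A'. if p = (b, 0) then f else 0)"
    by (rule sum.cong) (auto simp: flinear_simps[OF flinear_X_pow])
  also have "\<dots> = f" using A(1) by (simp add: A'_def)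
  finally have zero: "(\<Sum>p\<in>A'. (X ^^ snd p) (t p - ?e p)) = 0"
    using fA by (simp add: flinear_simps[OF flinear_X_pow] sum_subtractf)
  have mem: "t p - ?e p \<in> K (fst p)" for p
  proof -
    have "S' (fst p) \<subseteq> K (fst p)" using S(2) by (simp add: S'_def)
    then show ?thesis using A(2)[of p] f
      by (intro fs.subspace_diff[OF subspace_K]) (auto simp: fs.subspace_0[OF subspace_K])
  qed
  have "finite A'" "(b, 0) \<in> A'" using A(1) by (simp_all add: A'_def)
  then have "t (b, 0) - ?e (b, 0) = 0"
    using X_pow_independent[of A' "\<lambda>p. t p - ?e p" "(b, 0)", OF _ mem zero] by blast
  then show "f \<in> S" using A(2)[of "(b, 0)"] by (simp add: S'_def)
qed

end

section \<open>The two Lie algebras\<close>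

lemma mat_sum_closed:
  fixes M :: "'i \<Rightarrow> complex mat"
  assumes closed: "\<And>x y c d. x \<in> P \<Longrightarrow> y \<in> P \<Longrightarrow> c \<cdot>\<^sub>m x + d \<cdot>\<^sub>m y \<in> P"
    and P: "P \<subseteq> carrier_mat n n" and I: "finite I" "I \<noteq> {}" "\<And>p. p \<in> I \<Longrightarrow> M p \<in> P"
  shows "mat n n (\<lambda>ij. \<Sum>p\<in>I. c p * M p $$ ij) \<in> P"
  using I
proof (induction rule: finite_ne_induct)
  case (singleton p)
  then have "M p \<in> carrier_mat n n" using P by auto
  then have "mat n n (\<lambda>ij. c p * M p $$ ij) = c p \<cdot>\<^sub>m M p + 0 \<cdot>\<^sub>m M p" by (intro eq_matI) auto
  then show ?case using closed[of "M p" "M p" "c p" 0] singleton by simp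
next
  case (insert p I)
  then have "M p \<in> carrier_mat n n" using P by auto
  then have "mat n n (\<lambda>ij. \<Sum>p\<in>insert p I. c p * M p $$ ij) =
      c p \<cdot>\<^sub>m M p + 1 \<cdot>\<^sub>m mat n n (\<lambda>ij. \<Sum>p\<in>I. c p * M p $$ ij)"
    using insert by (intro eq_matI) auto
  then show ?case using closed insert by simp
qed

lemma commutator_trace:
  fixes A B :: "complex mat"
  assumes "A \<in> carrier_mat n n" "B \<in> carrier_mat n n"
  shows "(\<Sum>i<n. (A * B - B * A) $$ (i, i)) = 0"
proof -
  have "(\<Sum>i<n. (A * B) $$ (i, i)) = (\<Sum>i<n. \<Sum>j<n. A $$ (i, j) * B $$ (j, i))"
    using assms by (intro sum.cong) (auto simp: scalar_prod_def atLeast0LessThan)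
  also have "\<dots> = (\<Sum>j<n. \<Sum>i<n. A $$ (i, j) * B $$ (j, i))" by (rule sum.swap)
  also have "\<dots> = (\<Sum>i<n. (B * A) $$ (i, i))"
    using assms by (intro sum.cong) (auto simp: scalar_prod_def atLeast0LessThan mult.commute)
  finally show ?thesis using assms by (simp add: sum_subtractf)
qed

context N_module
begin

definition E :: "nat \<Rightarrow> nat \<Rightarrow> complex mat" where
  "E i j = mat n n (\<lambda>p. if p = (i, j) then 1 else 0)"

definition Diag :: "(nat \<Rightarrow> complex) \<Rightarrow> complex mat" where
  "Diag d = mat n n (\<lambda>(k, l). if k = l then d k else 0)"

lemma E_carrier [simp]: "E i j \<in> carrier_mat n n" and Diag_carrier [simp]: "Diag d \<in> carrier_mat n n"
  and coroot_carrier [simp]: "coroot n i \<in> carrier_mat n n"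
  by (simp_all add: E_def Diag_def coroot_def)

lemma E_sl: "i \<noteq> j \<Longrightarrow> E i j \<in> sl n"
  by (auto simp: sl_def E_def intro!: sum.neutral)

lemma coroot_sl: assumes "i < n - 1" shows "coroot n i \<in> sl n"
proof -
  have "(\<Sum>k<n. coroot n i $$ (k, k)) = (\<Sum>k<n. (if k = i then 1 else 0) - (if k = i + 1 then 1 else 0))"
    by (rule sum.cong) (auto simp: coroot_def)
  also have "\<dots> = 0" using assms by (simp add: sum_subtractf)
  finally show ?thesis by (simp add: sl_def)
qed

lemma sl_carrier: "A \<in> sl n \<Longrightarrow> A \<in> carrier_mat n n" by (simp add: sl_def)

lemma diag2_lincomb:
  "A \<in> carrier_mat n n \<Longrightarrow> B \<in> carrier_mat n n \<Longrightarrow>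
    diag2 n (c \<cdot>\<^sub>m A + d \<cdot>\<^sub>m B) = c \<cdot>\<^sub>m diag2 n A + d \<cdot>\<^sub>m diag2 n B"
  unfolding diag2_def by (intro eq_matI) auto

lemma diag2_commutator:
  assumes "A \<in> carrier_mat n n" "B \<in> carrier_mat n n"
  shows "diag2 n A * diag2 n B - diag2 n B * diag2 n A = diag2 n (A * B - B * A)"
proof -
  have "diag2 n A * diag2 n B = diag2 n (A * B)" if "A \<in> carrier_mat n n" "B \<in> carrier_mat n n" for A B
    unfolding diag2_def using that by (subst mult_four_block_mat[of _ n n _ n _ n]) auto
  moreover have "diag2 n (A * B) - diag2 n (B * A) = diag2 n (A * B - B * A)"
    unfolding diag2_def using assms by (intro eq_matI) auto
  ultimately show ?thesis using assms by simp
qed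

lemma alg_b_matrices: "alg_b n \<subseteq> carrier_mat m m"
  by (auto simp: alg_b_def sl_carrier)

lemma sl_lincomb: "A \<in> sl n \<Longrightarrow> B \<in> sl n \<Longrightarrow> c \<cdot>\<^sub>m A + d \<cdot>\<^sub>m B \<in> sl n"
  by (auto simp: sl_def sum.distrib simp flip: sum_distrib_left)

lemma alg_b_lie: "matrix_lie_algebra (alg_b n)"
proof
  fix x y c d assume "x \<in> alg_b n" "y \<in> alg_b n"
  then obtain A B where AB: "A \<in> sl n" "B \<in> sl n" "x = diag2 n A" "y = diag2 n B" by (auto simp: alg_b_def)
  show "c \<cdot>\<^sub>m x + d \<cdot>\<^sub>m y \<in> alg_b n"
    unfolding alg_b_def using AB sl_lincomb sl_carrier
    by (intro image_eqI[of _ _ "c \<cdot>\<^sub>m A + d \<cdot>\<^sub>m B"]) (auto simp: diag2_lincomb)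
  have "A * B - B * A \<in> sl n"
    unfolding sl_def
  proof (intro CollectI conjI)
    show "(\<Sum>i<n. (A * B - B * A) $$ (i, i)) = 0"
      using AB sl_carrier by (intro commutator_trace) blast+
    show "A * B - B * A \<in> carrier_mat n n"
      using sl_carrier[OF AB(1)] sl_carrier[OF AB(2)] by (intro minus_carrier_mat mult_carrier_mat)
  qed
  then show "x * y - y * x \<in> alg_b n"
    unfolding alg_b_def using AB sl_carrier
    by (intro image_eqI[of _ _ "A * B - B * A"]) (auto simp: diag2_commutator)
qed

text \<open>Summation by parts: the coefficient of a coroot is a partial sum of the diagonal entries, and the
  last partial sum is the trace.\<close>

lemma Diag_coroots:
  assumes "(\<Sum>k<n. d k) = 0"
  shows "Diag d = mat n n (\<lambda>ij. \<Sum>i\<in>{..<n-1}. (\<Sum>k\<le>i. d k) * coroot n i $$ ij)"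
proof (rule eq_matI)
  fix k l assume "k < dim_row (mat n n (\<lambda>ij. \<Sum>i\<in>{..<n-1}. (\<Sum>k\<le>i. d k) * coroot n i $$ ij))"
    "l < dim_col (mat n n (\<lambda>ij. \<Sum>i\<in>{..<n-1}. (\<Sum>k\<le>i. d k) * coroot n i $$ ij))"
  then have kl: "k < n" "l < n" by auto
  let ?s = "\<lambda>i. \<Sum>k\<le>i. d k"
  have "(\<Sum>i\<in>{..<n-1}. ?s i * coroot n i $$ (k, l)) = Diag d $$ (k, l)"
  proof (cases "k = l")
    case False then show ?thesis using kl by (auto simp: coroot_def Diag_def intro!: sum.neutral)
  next
    case True
    have "(\<Sum>i\<in>{..<n-1}. ?s i * coroot n i $$ (k, l)) =
        (\<Sum>i\<in>{..<n-1}. (if i = k then ?s i else 0) - (if Suc i = k then ?s i else 0))"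
      using kl True by (intro sum.cong) (auto simp: coroot_def)
    also have "\<dots> = (if k < n - 1 then ?s k else 0) - (\<Sum>i\<in>{..<n-1}. if Suc i = k then ?s i else 0)"
      by (simp add: sum_subtractf)
    also have "\<dots> = d k"
    proof (cases k)
      case 0 then show ?thesis using n by simp
    next
      case (Suc j)
      have j: "(\<Sum>i\<in>{..<n-1}. if Suc i = k then ?s i else 0) = ?s j"
        using Suc kl by simp
      have sk: "?s k = ?s j + d k" using Suc by simp
      have "?s (n - 1) = 0"
        using assms n lessThan_Suc_atMost[of "n - 1"] by simp
      moreover have "k = n - 1" if "\<not> k < n - 1" using that kl by simp
      ultimately have "(if k < n - 1 then ?s k else 0) = ?s k" by auto
      then show ?thesis unfolding j sk by simp
    qed
    finally show ?thesis using kl True by (simp add: Diag_def)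
  qed
  then show "Diag d $$ (k, l) = mat n n (\<lambda>ij. \<Sum>i\<in>{..<n-1}. ?s i * coroot n i $$ ij) $$ (k, l)"
    using kl by simp
qed (simp_all add: Diag_def)

definition Fb :: "complex mat set" where "Fb = {diag2 n (E i j) | i j. j < i \<and> i < n}"

abbreviation "hwb mu \<equiv> {(diag2 n (coroot n i), mu ! i) | i. i < n - 1}"

lemma fst_hwb: "fst ` hwb mu = {diag2 n (coroot n i) | i. i < n - 1}"
  by force

text \<open>Half the sum of the positive coroots; the bracket with it multiplies the matrix unit at \<open>(i, j)\<close> by
  \<open>j - i\<close>.\<close>

definition h0b :: "complex mat" where
  "h0b = diag2 n (Diag (\<lambda>k. of_nat (n - 1) / 2 - of_nat k))"

text \<open>A lowering element is only known as a matrix, so its degree is recovered from the bracket with \<open>h\<close>.\<close>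

definition ad_degree :: "complex mat \<Rightarrow> complex mat \<Rightarrow> nat" where
  "ad_degree h y = (SOME e. 0 < e \<and> h * y - y * h = (- of_nat e) \<cdot>\<^sub>m y + 0 \<cdot>\<^sub>m y)"

lemma ad_degreeI:
  assumes "0 < e" "h * y - y * h = (- of_nat e) \<cdot>\<^sub>m y + 0 \<cdot>\<^sub>m y"
  shows "0 < ad_degree h y" "h * y - y * h = (- of_nat (ad_degree h y)) \<cdot>\<^sub>m y + 0 \<cdot>\<^sub>m y"
  using someI[of "\<lambda>e. 0 < e \<and> h * y - y * h = (- of_nat e) \<cdot>\<^sub>m y + 0 \<cdot>\<^sub>m y", OF conjI[OF assms]]
  unfolding ad_degree_def by auto

lemma h0b_commutator:
  assumes "j < i" "i < n"
  shows "h0b * diag2 n (E i j) - diag2 n (E i j) * h0b =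
    (- of_nat (i - j)) \<cdot>\<^sub>m diag2 n (E i j) + 0 \<cdot>\<^sub>m diag2 n (E i j)"
proof -
  let ?d = "\<lambda>k. of_nat (n - 1) / 2 - of_nat k :: complex"
  have "Diag ?d * E i j = ?d i \<cdot>\<^sub>m E i j"
  proof (rule eq_matI)
    fix k l assume "k < dim_row (?d i \<cdot>\<^sub>m E i j)" "l < dim_col (?d i \<cdot>\<^sub>m E i j)"
    then have kl: "k < n" "l < n" by (auto simp: E_def)
    have "(Diag ?d * E i j) $$ (k, l) = (\<Sum>r<n. Diag ?d $$ (k, r) * E i j $$ (r, l))"
      using kl by (simp add: E_def Diag_def scalar_prod_def atLeast0LessThan)
    also have "\<dots> = (\<Sum>r<n. if r = k then ?d k * E i j $$ (k, l) else 0)"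
      using kl by (intro sum.cong) (auto simp: Diag_def)
    finally show "(Diag ?d * E i j) $$ (k, l) = (?d i \<cdot>\<^sub>m E i j) $$ (k, l)"
      using kl by (auto simp: E_def)
  qed (auto simp: E_def Diag_def)
  moreover have "E i j * Diag ?d = ?d j \<cdot>\<^sub>m E i j"
  proof (rule eq_matI)
    fix k l assume "k < dim_row (?d j \<cdot>\<^sub>m E i j)" "l < dim_col (?d j \<cdot>\<^sub>m E i j)"
    then have kl: "k < n" "l < n" by (auto simp: E_def)
    have "(E i j * Diag ?d) $$ (k, l) = (\<Sum>r<n. E i j $$ (k, r) * Diag ?d $$ (r, l))"
      using kl by (simp add: E_def Diag_def scalar_prod_def atLeast0LessThan)
    also have "\<dots> = (\<Sum>r<n. if r = l then E i j $$ (k, l) * ?d l else 0)"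
      using kl by (intro sum.cong) (auto simp: Diag_def)
    finally show "(E i j * Diag ?d) $$ (k, l) = (?d j \<cdot>\<^sub>m E i j) $$ (k, l)"
      using kl by (auto simp: E_def)
  qed (auto simp: E_def Diag_def)
  ultimately have "Diag ?d * E i j - E i j * Diag ?d = (- of_nat (i - j)) \<cdot>\<^sub>m E i j + 0 \<cdot>\<^sub>m E i j"
    using assms by (intro eq_matI) (auto simp: E_def of_nat_diff)
  then show ?thesis
    unfolding h0b_def by (simp add: diag2_commutator diag2_lincomb)
qed

lemma lin_hull_diag2_sum:
  assumes "finite I" "I \<noteq> {}" "\<And>p. p \<in> I \<Longrightarrow> M p \<in> carrier_mat n n" "\<And>p. p \<in> I \<Longrightarrow> diag2 n (M p) \<in> lin_hull Z"
  shows "diag2 n (mat n n (\<lambda>ij. \<Sum>p\<in>I. c p * M p $$ ij)) \<in> lin_hull Z"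
proof -
  have "mat n n (\<lambda>ij. \<Sum>p\<in>I. c p * M p $$ ij) \<in> {A \<in> carrier_mat n n. diag2 n A \<in> lin_hull Z}"
    by (rule mat_sum_closed) (use assms in \<open>auto simp: diag2_lincomb intro: lin_hull.lincomb\<close>)
  then show ?thesis by simp
qed

lemma Diag_lin_hull:
  assumes "(\<Sum>k<n. d k) = 0" "{diag2 n (coroot n i) | i. i < n - 1} \<subseteq> Z"
  shows "diag2 n (Diag d) \<in> lin_hull Z"
  unfolding Diag_coroots[OF assms(1)]
proof (rule lin_hull_diag2_sum)
  have "0 \<in> {..<n - 1}" using n by simp
  then show "{..<n - 1} \<noteq> {}" by blast
qed (use assms(2) in \<open>auto intro!: lin_hull.base\<close>)

lemma alg_b_generated: "alg_b n \<subseteq> lin_hull (Fb \<union> fst ` hwb mu \<union> pos_b n)" (is "_ \<subseteq> lin_hull ?Z")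
proof
  fix x assume "x \<in> alg_b n"
  then obtain A where A: "A \<in> sl n" "x = diag2 n A" by (auto simp: alg_b_def)
  define U where "U = mat n n (\<lambda>(i, j). if i < j then A $$ (i, j) else 0)"
  define I where "I = {(i, j). j < i \<and> i < n}"
  define L where "L = mat n n (\<lambda>ij. \<Sum>p\<in>I. A $$ p * (\<lambda>(i, j). E i j) p $$ ij)"
  have fin: "finite I" unfolding I_def by (rule finite_subset[of _ "{..<n} \<times> {..<n}"]) auto
  have "(1, 0) \<in> I" using n by (auto simp: I_def)
  then have L: "diag2 n L \<in> lin_hull ?Z"
    unfolding L_def by (intro lin_hull_diag2_sum fin) (auto simp: I_def Fb_def intro!: lin_hull.base)
  have "diag2 n U \<in> pos_b n" unfolding pos_b_def by (rule imageI) (auto simp: U_def)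
  then have U: "diag2 n U \<in> lin_hull ?Z" by (intro lin_hull.base) auto
  have D: "diag2 n (Diag (\<lambda>k. A $$ (k, k))) \<in> lin_hull ?Z"
    using A(1) fst_hwb by (intro Diag_lin_hull) (auto simp: sl_def)
  have carr: "U \<in> carrier_mat n n" "L \<in> carrier_mat n n" by (auto simp: U_def L_def)
  have "A = 1 \<cdot>\<^sub>m U + 1 \<cdot>\<^sub>m (1 \<cdot>\<^sub>m L + 1 \<cdot>\<^sub>m Diag (\<lambda>k. A $$ (k, k)))"
  proof (rule eq_matI)
    fix k l assume "k < dim_row (1 \<cdot>\<^sub>m U + 1 \<cdot>\<^sub>m (1 \<cdot>\<^sub>m L + 1 \<cdot>\<^sub>m Diag (\<lambda>k. A $$ (k, k))))"
      "l < dim_col (1 \<cdot>\<^sub>m U + 1 \<cdot>\<^sub>m (1 \<cdot>\<^sub>m L + 1 \<cdot>\<^sub>m Diag (\<lambda>k. A $$ (k, k))))"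
    then have kl: "k < n" "l < n" by (auto simp: Diag_def)
    have "L $$ (k, l) = (\<Sum>p\<in>I. if p = (k, l) then A $$ (k, l) else 0)"
      using kl by (auto simp: L_def E_def split: prod.splits intro!: sum.cong)
    also have "\<dots> = (if l < k then A $$ (k, l) else 0)"
      using fin kl by (auto simp: I_def)
    finally show "A $$ (k, l) = (1 \<cdot>\<^sub>m U + 1 \<cdot>\<^sub>m (1 \<cdot>\<^sub>m L + 1 \<cdot>\<^sub>m Diag (\<lambda>k. A $$ (k, k)))) $$ (k, l)"
      using kl carr by (auto simp: U_def Diag_def)
  qed (use A(1) in \<open>auto simp: sl_def Diag_def\<close>)
  then have "x = 1 \<cdot>\<^sub>m diag2 n U + 1 \<cdot>\<^sub>m (1 \<cdot>\<^sub>m diag2 n L + 1 \<cdot>\<^sub>m diag2 n (Diag (\<lambda>k. A $$ (k, k))))"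
    using carr A(2) diag2_lincomb by (metis Diag_carrier add_carrier_mat smult_carrier_mat)
  then show "x \<in> lin_hull ?Z" using U L D by (auto intro: lin_hull.lincomb)
qed

lemma pos_b_alg_b: "pos_b n \<subseteq> alg_b n"
  unfolding pos_b_def alg_b_def by (intro image_mono) (auto simp: sl_def intro!: sum.neutral)

lemma alg_b_triangular: "triangular_lie_algebra (alg_b n) (pos_b n) Fb (hwb mu) h0b (ad_degree h0b)"
proof -
  interpret matrix_lie_algebra "alg_b n" by (rule alg_b_lie)
  show ?thesis
  proof
    show "pos_b n \<subseteq> alg_b n" by (rule pos_b_alg_b)
    show "fst ` hwb mu \<subseteq> alg_b n" using coroot_sl unfolding fst_hwb alg_b_def by blast
    show "Fb \<subseteq> alg_b n" using E_sl unfolding Fb_def alg_b_def by force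
    have gauss: "(\<Sum>k<n. of_nat k) = (of_nat n * (of_nat n - 1) / 2 :: complex)" for n
      by (induction n) (simp_all add: field_simps)
    have "(\<Sum>k<n. of_nat (n - 1) / 2 - of_nat k :: complex) = 0"
      using n by (simp add: sum_subtractf gauss of_nat_diff)
    then show "h0b \<in> lin_hull (fst ` hwb mu)" unfolding h0b_def fst_hwb by (rule Diag_lin_hull) simp
    show "alg_b n \<subseteq> lin_hull (Fb \<union> fst ` hwb mu \<union> pos_b n)" by (rule alg_b_generated)
    fix y assume "y \<in> Fb"
    then obtain i j where "j < i" "i < n" "y = diag2 n (E i j)" by (auto simp: Fb_def)
    then show "0 < ad_degree h0b y" "h0b * y - y * h0b = (- of_nat (ad_degree h0b y)) \<cdot>\<^sub>m y + 0 \<cdot>\<^sub>m y"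
      using ad_degreeI[OF _ h0b_commutator, of i j] by auto
  qed
qed

text \<open>The hypothesis lists the eigenvalues of the coroots on the highest weight vector in degree \<open>b\<close>.\<close>

lemma K_identified:
  assumes mu: "\<And>i. i < n - 1 \<Longrightarrow> mu ! i = topv b $ i + topv b $ (n + i) - (topv b $ (i + 1) + topv b $ (n + (i + 1)))"
  shows "\<exists>\<Phi>. identified_rep (alg_b n) (L_b n mu) \<Phi> (K b) (gl_act m)"
proof -
  interpret triangular_lie_algebra "alg_b n" "pos_b n" Fb "hwb mu" h0b "ad_degree h0b"
    by (rule alg_b_triangular)
  interpret simple_hw_module "alg_b n" "pos_b n" Fb "hwb mu" h0b "ad_degree h0b" "K b" "gl_act m" "hwv b"
  proof
    show "fs.subspace (K b)" by (rule subspace_K)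
    show "gl_act m x (f + h) = gl_act m x f + gl_act m x h"
      "gl_act m x (fscale c f) = fscale c (gl_act m x f)" for x f h c
      by (simp_all add: flinear_simps[OF flinear_gl_act])
    show "gl_act m x f \<in> K b" if "x \<in> alg_b n" "f \<in> K b" for x f
      using that diag2_K sl_carrier by (auto simp: alg_b_def)
    show "gl_act m (c \<cdot>\<^sub>m x + d \<cdot>\<^sub>m y) f = fscale c (gl_act m x f) + fscale d (gl_act m y f)"
      if "x \<in> alg_b n" "y \<in> alg_b n" for x y c d f
      using that alg_b_matrices by (intro gl_act_lincomb) auto
    show "gl_act m (x * y - y * x) f = gl_act m x (gl_act m y f) - gl_act m y (gl_act m x f)"
      if "x \<in> alg_b n" "y \<in> alg_b n" "f \<in> K b" for x y f
      using that alg_b_matrices by (intro gl_act_commutator N_vecs[OF K_N]) auto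
    show "hwv b \<in> K b" by (rule hwv_K)
    show "hwv b \<noteq> 0" by (metis lookup_single_eq lookup_zero zero_neq_one)
    show "gl_act m x (hwv b) = 0" if x: "x \<in> pos_b n" for x
    proof -
      obtain A where A: "A \<in> carrier_mat n n" "\<forall>i<n. \<forall>j<n. j \<le> i \<longrightarrow> A $$ (i, j) = 0" "x = diag2 n A"
        using x by (auto simp: pos_b_def)
      have "fscale (A $$ (i, j)) (b_unit i j (hwv b)) = 0" if "i < n" "j < n" for i j
        using A(2) that hwv_b_unit[of i j b] by (cases "i < j") auto
      then show ?thesis unfolding A(3) diag2_eq[OF A(1)] by (intro sum.neutral ballI) auto
    qed
    show "gl_act m h (hwv b) = fscale c (hwv b)" if hc: "(h, c) \<in> hwb mu" for h c
    proof -
      obtain i where i: "i < n - 1" "h = diag2 n (coroot n i)" "c = mu ! i" using hc by auto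
      let ?t = "\<lambda>k. topv b $ k + topv b $ (n + k)"
      have "(\<Sum>k<n. coroot n i $$ (k, k) * ?t k) = (\<Sum>k<n. (if k = i then ?t k else 0) - (if k = i + 1 then ?t k else 0))"
        by (rule sum.cong) (auto simp: coroot_def)
      also have "\<dots> = ?t i - ?t (i + 1)"
      proof -
        have "i < n" "i + 1 < n" using i by auto
        then show ?thesis by (simp add: sum_subtractf)
      qed
      also have "\<dots> = c" using i mu[OF i(1)] by simp
      finally show ?thesis using hwv_diag[OF coroot_carrier, of i b] i(2) by (simp add: coroot_def)
    qed
    show "S = K b" if S: "fs.subspace S" "S \<subseteq> K b" "S \<noteq> {0}"
      and st: "\<And>x f. x \<in> alg_b n \<Longrightarrow> f \<in> S \<Longrightarrow> gl_act m x f \<in> S" for S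
    proof (rule K_simple[OF S])
      fix i j f assume "i < n" "j < n" "i \<noteq> j" "f \<in> S"
      then show "b_unit i j f \<in> S"
        using st[of "diag2 n (E i j)" f] E_sl[of i j] by (auto simp: b_unit_eq E_def alg_b_def)
    qed
  qed
  show ?thesis using simple_hw_rep_identified by (simp add: L_b_def)
qed

section \<open>The Verma modules of the second algebra\<close>

text \<open>The general element of \<open>alg_a\<close>, in block form, so that brackets can be computed blockwise.\<close>

definition sl2_mat :: "complex \<Rightarrow> complex \<Rightarrow> complex \<Rightarrow> complex mat" where
  "sl2_mat x h y = four_block_mat (h \<cdot>\<^sub>m 1\<^sub>m n) (y \<cdot>\<^sub>m 1\<^sub>m n) (x \<cdot>\<^sub>m 1\<^sub>m n) ((-h) \<cdot>\<^sub>m 1\<^sub>m n)"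

lemma sl2_mat_eq: "x \<cdot>\<^sub>m mat_X n + h \<cdot>\<^sub>m mat_H n + y \<cdot>\<^sub>m mat_Y n = sl2_mat x h y"
  unfolding sl2_mat_def mat_X_def mat_Y_def mat_H_def by (intro eq_matI) auto

lemma alg_a_eq: "alg_a n = {sl2_mat x h y | x h y. True}"
  by (simp add: alg_a_def sl2_mat_eq)

lemma sl2_mat_in [simp]: "sl2_mat x h y \<in> alg_a n" by (auto simp: alg_a_eq)

lemma alg_aE: assumes "A \<in> alg_a n" obtains x h y where "A = sl2_mat x h y"
  using assms by (auto simp: alg_a_eq)

lemma sl2_mat_carrier [simp]: "sl2_mat x h y \<in> carrier_mat m m"
  unfolding sl2_mat_def mult_2 by (intro four_block_carrier_mat) auto

lemma sl2_mat_lincomb: "c \<cdot>\<^sub>m sl2_mat x h y + d \<cdot>\<^sub>m sl2_mat x' h' y' = sl2_mat (c * x + d * x') (c * h + d * h') (c * y + d * y')"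
  unfolding sl2_mat_def by (intro eq_matI) (auto simp: algebra_simps)

lemma sl2_mat_mult: "sl2_mat x h y * sl2_mat x' h' y' = four_block_mat ((h * h' + y * x') \<cdot>\<^sub>m 1\<^sub>m n) ((h * y' - y * h') \<cdot>\<^sub>m 1\<^sub>m n)
    ((x * h' - h * x') \<cdot>\<^sub>m 1\<^sub>m n) ((x * y' + h * h') \<cdot>\<^sub>m 1\<^sub>m n)"
proof -
  have s: "(c \<cdot>\<^sub>m 1\<^sub>m n) * (d \<cdot>\<^sub>m 1\<^sub>m n) = (c * d) \<cdot>\<^sub>m (1\<^sub>m n :: complex mat)" for c d
  proof -
    have "(c \<cdot>\<^sub>m 1\<^sub>m n) * (d \<cdot>\<^sub>m 1\<^sub>m n) = c \<cdot>\<^sub>m (1\<^sub>m n * (d \<cdot>\<^sub>m 1\<^sub>m n) :: complex mat)"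
      by (rule mult_smult_assoc_mat) auto
    also have "\<dots> = c \<cdot>\<^sub>m (d \<cdot>\<^sub>m 1\<^sub>m n)" by (subst left_mult_one_mat[of _ n n]) auto
    also have "\<dots> = (c * d) \<cdot>\<^sub>m 1\<^sub>m n" by (intro eq_matI) auto
    finally show ?thesis .
  qed
  show ?thesis unfolding sl2_mat_def
    by (subst mult_four_block_mat[of _ n n _ n _ n _ _ n _ n], simp_all add: s)
       (intro eq_matI, auto simp: algebra_simps)
qed

lemma sl2_mat_commutator: "sl2_mat x h y * sl2_mat x' h' y' - sl2_mat x' h' y' * sl2_mat x h y =
    sl2_mat (2 * (x * h' - x' * h)) (y * x' - y' * x) (2 * (h * y' - h' * y))"
  unfolding sl2_mat_mult unfolding sl2_mat_def by (intro eq_matI) (auto simp: algebra_simps)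

lemma basis_sl2_mat: "mat_X n = sl2_mat 1 0 0" "mat_H n = sl2_mat 0 1 0" "mat_Y n = sl2_mat 0 0 1"
  unfolding sl2_mat_def mat_X_def mat_Y_def mat_H_def by (intro eq_matI; auto)+

lemma sl2_mat_act: "gl_act m (sl2_mat x h y) f = fscale x (X f) + fscale h (H f) + fscale y (Y f)"
proof -
  have "sl2_mat x h y = 1 \<cdot>\<^sub>m (x \<cdot>\<^sub>m mat_X n + h \<cdot>\<^sub>m mat_H n) + y \<cdot>\<^sub>m mat_Y n"
    unfolding basis_sl2_mat by (simp add: sl2_mat_lincomb)
  then show ?thesis by (simp add: gl_act_lincomb)
qed

lemma alg_a_lie: "matrix_lie_algebra (alg_a n)"
  by unfold_locales (auto elim!: alg_aE simp: sl2_mat_lincomb sl2_mat_commutator)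

lemma alg_a_triangular: "triangular_lie_algebra (alg_a n) {mat_Y n} {mat_X n} {(mat_H n, mu)} (mat_H n) (ad_degree (mat_H n))"
proof -
  interpret matrix_lie_algebra "alg_a n" by (rule alg_a_lie)
  have comm: "mat_H n * mat_X n - mat_X n * mat_H n = (- of_nat 2) \<cdot>\<^sub>m mat_X n + 0 \<cdot>\<^sub>m mat_X n"
    by (simp add: basis_sl2_mat sl2_mat_commutator sl2_mat_lincomb)
  show ?thesis
  proof
    show "alg_a n \<subseteq> lin_hull ({mat_X n} \<union> fst ` {(mat_H n, mu)} \<union> {mat_Y n})" (is "_ \<subseteq> lin_hull ?Z")
    proof
      fix x assume "x \<in> alg_a n"
      then obtain p q r where x: "x = sl2_mat p q r" by (auto simp: alg_a_eq)
      have "x = 1 \<cdot>\<^sub>m (p \<cdot>\<^sub>m mat_X n + q \<cdot>\<^sub>m mat_H n) + r \<cdot>\<^sub>m mat_Y n"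
        unfolding x basis_sl2_mat by (simp add: sl2_mat_lincomb)
      moreover have "mat_X n \<in> lin_hull ?Z" "mat_H n \<in> lin_hull ?Z" "mat_Y n \<in> lin_hull ?Z"
        by (auto intro: lin_hull.base)
      ultimately show "x \<in> lin_hull ?Z" using lin_hull.lincomb by metis
    qed
    show "0 < ad_degree (mat_H n) y" "mat_H n * y - y * mat_H n = (- of_nat (ad_degree (mat_H n) y)) \<cdot>\<^sub>m y + 0 \<cdot>\<^sub>m y"
      if "y \<in> {mat_X n}" for y
      using ad_degreeI[OF _ comm] that by auto
  qed (auto simp: alg_a_eq basis_sl2_mat intro: lin_hull.base)
qed

text \<open>The Verma module on the basis \<open>X\<^sup>k w\<close>, where \<open>w\<close> is the highest weight vector; the coordinates of an
  element of \<open>alg_a\<close> are read off from three of its entries.  At \<open>k = 0\<close> the truncated \<open>k - 1\<close> is harmless,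
  as its coefficient is 0.\<close>

definition verma_act :: "complex \<Rightarrow> complex mat \<Rightarrow> (nat \<Rightarrow>\<^sub>0 complex) \<Rightarrow> (nat \<Rightarrow>\<^sub>0 complex)" where
  "verma_act mu A = linear_extension (\<lambda>k. single (Suc k) (A $$ (n, 0))
     + single k (A $$ (0, 0) * (mu - 2 * of_nat k))
     + single (k - 1) (A $$ (0, n) * (of_nat k * (mu - of_nat (k - 1)))))"

lemma flinear_verma_act: "flinear (verma_act mu A)"
  unfolding verma_act_def by (rule flinear_linear_extension)

lemma sl2_mat_index: "sl2_mat x h y $$ (n, 0) = x" "sl2_mat x h y $$ (0, 0) = h" "sl2_mat x h y $$ (0, n) = y"
  using n by (simp_all add: sl2_mat_def)

lemma verma_act_single: "verma_act mu (sl2_mat x h y) (single k 1) = single (Suc k) x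
     + single k (h * (mu - 2 * of_nat k))
     + single (k - 1) (y * (of_nat k * (mu - of_nat (k - 1))))"
  unfolding verma_act_def by (simp add: sl2_mat_index)

abbreviation "Xp \<equiv> \<lambda>k::nat. X ^^ k"

text \<open>The basis vector \<open>X\<^sup>k w\<close> behaves like \<open>X\<^sup>k f\<close> for any \<open>f \<in> K b\<close>.\<close>

lemma pairing_verma_act_single:
  assumes "A \<in> alg_a n" "f \<in> K b"
  shows "pairing Xp f (verma_act (H_weight b) A (single k 1)) = gl_act m A (Xp k f)"
proof -
  obtain x h y where A: "A = sl2_mat x h y" using assms by (auto simp: alg_a_eq)
  have "H (Xp k f) = fscale (H_weight b - 2 * of_nat k) (Xp k f)"
    using H_act_Ndeg[OF X_pow_Ndeg[of f b k]] assms(2) by (simp add: K_def H_weight_def algebra_simps)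
  moreover have "Y (Xp k f) = fscale (of_nat k * (H_weight b - of_nat (k - 1))) (Xp (k - 1) f)"
  proof (cases k)
    case 0 then show ?thesis using assms(2) by (simp add: K_def)
  next
    case (Suc j)
    then show ?thesis using Y_X_pow[OF assms(2), of j] by (simp del: of_nat_Suc)
  qed
  ultimately show ?thesis
    unfolding A sl2_mat_act verma_act_single by (simp add: flinear_simps[OF flinear_pairing])
qed

lemma pairing_verma_act:
  assumes "A \<in> alg_a n" "f \<in> K b"
  shows "pairing Xp f (verma_act (H_weight b) A h) = gl_act m A (pairing Xp f h)"
  by (rule flinear_eq_on_supported[OF flinear_compose[OF flinear_verma_act flinear_pairing]
        flinear_compose[OF flinear_pairing flinear_gl_act], of _ UNIV])
     (use pairing_verma_act_single[OF assms] in \<open>auto simp: supported_def\<close>)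

lemma pairing_N: "f \<in> K b \<Longrightarrow> pairing Xp f h \<in> N"
  by (rule flinear_maps_supported[OF flinear_pairing subspace_supported, of _ UNIV])
     (auto simp: supported_def[of UNIV] X_pow_N K_N)

lemma pairing_hwv_inj:
  assumes "pairing Xp (hwv b) h = 0" shows "h = 0"
proof (rule poly_mapping_eqI)
  fix k
  let ?S = "keys h"
  show "lookup h k = lookup 0 k"
  proof (cases "k \<in> ?S")
    case True
    let ?t = "\<lambda>p::int \<times> nat. fscale (lookup h (snd p)) (hwv b)"
    have "(\<Sum>p\<in>Pair b ` ?S. (X ^^ snd p) (?t p)) = 0"
      using assms by (simp add: sum.reindex inj_on_def pairing_def linear_extension_def flinear_simps[OF flinear_X_pow])
    then have "?t (b, k) = 0"
      using True hwv_K[of b] fs.subspace_scale[OF subspace_K]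
      by (intro X_pow_independent[of "Pair b ` ?S" ?t]) auto
    then show ?thesis by (metis fs.scale_eq_0_iff lookup_single_eq lookup_zero snd_conv zero_neq_one)
  qed (simp add: in_keys_iff)
qed

text \<open>The shortest nonzero vector of \<open>S\<close> is killed by \<open>Y\<close>.  As \<open>Y\<close> maps \<open>X\<^sup>k w\<close> with \<open>k > 0\<close> to a
  nonzero multiple of \<open>X\<^bsup>k-1\<^esup> w\<close>, this vector is a multiple of \<open>w\<close>, which generates the module.\<close>

lemma verma_simple:
  assumes S: "fs.subspace S" "S \<noteq> {0}"
    and st: "\<And>x f. x \<in> alg_a n \<Longrightarrow> f \<in> S \<Longrightarrow> verma_act (H_weight b) x f \<in> S"
  shows "S = UNIV"
proof -
  let ?X = "verma_act (H_weight b) (sl2_mat 1 0 0)" and ?Y = "verma_act (H_weight b) (sl2_mat 0 0 1)"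
  have XY: "f \<in> S \<Longrightarrow> ?X f \<in> S" "f \<in> S \<Longrightarrow> ?Y f \<in> S" for f
    using st by simp_all
  have Y: "?Y (single k 1) = single (k - 1) (of_nat k * (H_weight b - of_nat (k - 1)))" for k
    by (simp add: verma_act_single)
  obtain f0 where f0: "f0 \<in> S" "f0 \<noteq> 0" using S fs.subspace_0[OF S(1)] by blast
  have ex: "\<exists>l. \<exists>f\<in>S. f \<noteq> 0 \<and> f \<in> supported {..<l}"
    using f0 by (intro exI[of _ "Suc (Max (keys f0))"] bexI[of _ f0])
      (auto simp: supported_def less_Suc_eq_le)
  define l where "l = (LEAST l. \<exists>f\<in>S. f \<noteq> 0 \<and> f \<in> supported {..<l})"
  obtain f where f: "f \<in> S" "f \<noteq> 0" "f \<in> supported {..<l}" using LeastI_ex[OF ex] unfolding l_def by blast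
  have "l \<noteq> 0"
  proof
    assume "l = 0"
    then have "keys f = {}" using f(3) by (auto simp: supported_def)
    then show False using f(2) by simp
  qed
  then obtain l' where l': "l = Suc l'" by (cases l) auto
  have "?Y f \<in> supported {..<l'}"
  proof (rule flinear_maps_supported[OF flinear_verma_act subspace_supported f(3)[unfolded l']])
    fix k assume "k \<in> {..<Suc l'}"
    then show "?Y (single k 1) \<in> supported {..<l'}"
      unfolding Y by (cases k) (auto simp: fs.subspace_0[OF subspace_supported] intro: single_supported)
  qed
  then have Yf: "?Y f = 0"
    using not_less_Least[of l' "\<lambda>l. \<exists>f\<in>S. f \<noteq> 0 \<and> f \<in> supported {..<l}"] XY(2)[OF f(1)] l'
    unfolding l_def[symmetric] by blast
  have high: "lookup f (Suc k) = 0" for k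
  proof -
    have "?Y f = (\<Sum>j\<in>keys f. fscale (lookup f j) (?Y (single j 1)))"
      by (subst sum_of_singles) (simp add: fs2.linear_sum[OF flinear_verma_act] flinear_simps[OF flinear_verma_act])
    then have "lookup (?Y f) k = lookup
        (\<Sum>j\<in>keys f. fscale (lookup f j) (?Y (single j 1))) k"
      by (rule arg_cong)
    then have "0 = (\<Sum>j\<in>keys f. lookup f j * lookup (?Y (single j 1)) k)"
      unfolding Yf lookup_sum lookup_fscale lookup_zero .
    also have "\<dots> = (\<Sum>j\<in>keys f. if j = Suc k then lookup f j * (of_nat (Suc k) * (H_weight b - of_nat k)) else 0)"
    proof (rule sum.cong[OF refl])
      fix j
      show "lookup f j * lookup (?Y (single j 1)) k =
          (if j = Suc k then lookup f j * (of_nat (Suc k) * (H_weight b - of_nat k)) else 0)"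
        unfolding Y by (cases j) (auto simp: lookup_single when_def)
    qed
    finally show ?thesis
      using H_weight_nonint[of b k] by (auto simp: in_keys_iff simp del: of_nat_Suc split: if_splits)
  qed
  have "f = single 0 (lookup f 0)"
  proof (rule poly_mapping_eqI)
    show "lookup f k = lookup (single 0 (lookup f 0)) k" for k
      using high by (cases k) (auto simp: lookup_single)
  qed
  moreover from this have "lookup f 0 \<noteq> 0" using f(2) by (metis single_zero)
  ultimately have "single 0 1 \<in> S" using single_in_subspace[OF S(1)] f(1) by metis
  then have "single k 1 \<in> S" for k
  proof (induction k)
    case (Suc k) then show ?case using XY(1)[of "single k 1"] by (simp add: verma_act_single)
  qed
  then have "supported UNIV \<subseteq> S" by (intro supported_subset[OF S(1)])
  then show ?thesis by (auto simp: supported_def)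
qed

text \<open>The Lie algebra relations for \<open>verma_act\<close> need no computation: the pairing with a highest weight
  vector embeds the Verma module into \<open>N\<close>, where they hold.\<close>

lemma verma_identified:
  "\<exists>\<Theta>. identified_rep (alg_a n) (L_a n (H_weight b)) \<Theta> UNIV (verma_act (H_weight b))"
proof -
  let ?e = "pairing Xp (hwv b)"
  have inj: "f = h" if "?e f = ?e h" for f h
    using pairing_hwv_inj[of b "f - h"] that by (simp add: flinear_simps[OF flinear_pairing])
  note pa = pairing_verma_act[OF _ hwv_K, of _ b]
  have mats: "x \<in> alg_a n \<Longrightarrow> x \<in> carrier_mat m m" for x by (auto simp: alg_a_eq)
  interpret triangular_lie_algebra "alg_a n" "{mat_Y n}" "{mat_X n}" "{(mat_H n, H_weight b)}" "mat_H n" "ad_degree (mat_H n)"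
    by (rule alg_a_triangular)
  interpret simple_hw_module "alg_a n" "{mat_Y n}" "{mat_X n}" "{(mat_H n, H_weight b)}" "mat_H n" "ad_degree (mat_H n)"
    UNIV "verma_act (H_weight b)" "single 0 1"
  proof
    show "verma_act (H_weight b) x (f + h) = verma_act (H_weight b) x f + verma_act (H_weight b) x h"
      "verma_act (H_weight b) x (fscale c f) = fscale c (verma_act (H_weight b) x f)" for x f h c
      by (simp_all add: flinear_simps[OF flinear_verma_act])
    show "verma_act (H_weight b) (c \<cdot>\<^sub>m x + d \<cdot>\<^sub>m y) f = fscale c (verma_act (H_weight b) x f) + fscale d (verma_act (H_weight b) y f)"
      if "x \<in> alg_a n" "y \<in> alg_a n" for x y c d f
    proof (rule inj)
      show "?e (verma_act (H_weight b) (c \<cdot>\<^sub>m x + d \<cdot>\<^sub>m y) f) =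
          ?e (fscale c (verma_act (H_weight b) x f) + fscale d (verma_act (H_weight b) y f))"
        using that lincomb_closed[OF that] mats
        by (simp add: pa flinear_simps[OF flinear_pairing] gl_act_lincomb)
    qed
    show "verma_act (H_weight b) (x * y - y * x) f =
        verma_act (H_weight b) x (verma_act (H_weight b) y f) - verma_act (H_weight b) y (verma_act (H_weight b) x f)"
      if "x \<in> alg_a n" "y \<in> alg_a n" for x y f
    proof (rule inj)
      show "?e (verma_act (H_weight b) (x * y - y * x) f) =
          ?e (verma_act (H_weight b) x (verma_act (H_weight b) y f) - verma_act (H_weight b) y (verma_act (H_weight b) x f))"
        using that commutator_closed[OF that] mats N_vecs[OF pairing_N[OF hwv_K]]
        by (simp add: pa flinear_simps[OF flinear_pairing] gl_act_commutator)
    qed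
    show "single 0 1 \<noteq> (0 :: nat \<Rightarrow>\<^sub>0 complex)" by simp
    show "S = UNIV" if "fs.subspace S" "S \<noteq> {0}"
      "\<And>x f. x \<in> alg_a n \<Longrightarrow> f \<in> S \<Longrightarrow> verma_act (H_weight b) x f \<in> S" for S
      using verma_simple that by blast
    show "verma_act (H_weight b) x (single 0 1) = 0" if "x \<in> {mat_Y n}" for x
      using that verma_act_single[of "H_weight b" 0 0 1 0] by (simp add: basis_sl2_mat del: single_one)
    show "verma_act (H_weight b) h (single 0 1) = fscale c (single 0 1)"
      if "(h, c) \<in> {(mat_H n, H_weight b)}" for h c
      using that verma_act_single[of "H_weight b" 0 1 0 0]
      by (simp add: basis_sl2_mat single_eq_fscale[of 0 "H_weight b"] del: single_one)
  qed auto
  show ?thesis using simple_hw_rep_identified by (simp add: L_a_def)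
qed

section \<open>The decomposition\<close>

lemma N_ba_decomposition:
  assumes mu: "\<And>b i. i < n - 1 \<Longrightarrow>
    mu b ! i = topv b $ i + topv b $ (n + i) - (topv b $ (i + 1) + topv b $ (n + (i + 1)))"
  shows "isomorphic_rep (alg_b n \<times> alg_a n) (N_ba_rep n a1 a2)
    (direct_sum_rep (\<lambda>b. tensor_rep (L_b n (mu b)) (L_a n (H_weight b))))"
proof -
  let ?\<tau> = "\<lambda>(x, y) f. gl_act m x f + gl_act m y f"
  let ?I = "\<lambda>b. {\<Sum>k<l. Xp k (t k) | l t. \<forall>k. t k \<in> K b}"
  have mats: "x \<in> alg_a n \<Longrightarrow> x \<in> carrier_mat m m" "y \<in> alg_b n \<Longrightarrow> y \<in> carrier_mat m m" for x y
    using alg_b_matrices by (auto simp: alg_a_eq)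
  have "\<exists>\<Psi>. identified_rep (alg_b n \<times> alg_a n) (tensor_rep (L_b n (mu b)) (L_a n (H_weight b))) \<Psi> (?I b) ?\<tau>" for b
  proof -
    obtain \<Phi> where \<Phi>: "identified_rep (alg_b n) (L_b n (mu b)) \<Phi> (K b) (gl_act m)"
      using K_identified[of "mu b" b] mu by blast
    obtain \<Theta> where \<Theta>: "identified_rep (alg_a n) (L_a n (H_weight b)) \<Theta> UNIV (verma_act (H_weight b))"
      using verma_identified by blast
    interpret tensor_pairing "alg_b n" "L_b n (mu b)" \<Phi> "K b" "gl_act m" "alg_a n" "L_a n (H_weight b)" \<Theta>
      "verma_act (H_weight b)" Xp "gl_act m" "gl_act m"
    proof (intro tensor_pairing.intro tensor_pairing_axioms.intro \<Phi> \<Theta> flinear_X_pow flinear_verma_act flinear_gl_act)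
      fix l t k assume t: "\<And>k. k < l \<Longrightarrow> t k \<in> K b" and 0: "(\<Sum>k<l. Xp k (t k)) = 0" and k: "k < l"
      have "(\<Sum>p\<in>Pair b ` {..<l}. (X ^^ snd p) (t (snd p))) = 0"
        using 0 by (simp add: sum.reindex inj_on_def)
      have "t (snd (b, k)) = 0"
        by (rule X_pow_independent[of "Pair b ` {..<l}" "\<lambda>p. t (snd p)" "(b, k)"])
           (use t k \<open>(\<Sum>p\<in>Pair b ` {..<l}. (X ^^ snd p) (t (snd p))) = 0\<close> in auto)
      then show "t k = 0" by simp
    next
      fix k x f assume "x \<in> alg_b n" "f \<in> K b"
      then show "Xp k (gl_act m x f) = gl_act m x (Xp k f)"
        using diag2_X_pow K_N sl_carrier by (auto simp: alg_b_def)
    next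
      fix k y f assume "y \<in> alg_a n" "f \<in> K b"
      then show "pairing Xp f (verma_act (H_weight b) y (single k 1)) = gl_act m y (Xp k f)"
        by (rule pairing_verma_act_single)
    qed
    show ?thesis by (rule tensor_rep_identified)
  qed
  then have "\<forall>b. \<exists>\<Psi>. identified_rep (alg_b n \<times> alg_a n)
      (tensor_rep (L_b n (mu b)) (L_a n (H_weight b))) \<Psi> (?I b) ?\<tau>" by (rule allI)
  from choice[OF this] obtain \<Psi> where "\<forall>b. identified_rep (alg_b n \<times> alg_a n)
      (tensor_rep (L_b n (mu b)) (L_a n (H_weight b))) (\<Psi> b) (?I b) ?\<tau>" by (rule exE)
  note \<Psi> = spec[OF this]
  show ?thesis
  proof (rule isomorphic_direct_sum_rep[OF _ _ _ _ \<Psi>])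
    show "add (N_ba_rep n a1 a2) = (+)" "smult (N_ba_rep n a1 a2) = fscale"
      by (simp_all add: N_ba_rep_def pullback_rep_def N_rep_def free_rep_def)
    show "act (N_ba_rep n a1 a2) z f = ?\<tau> z f" if z: "z \<in> alg_b n \<times> alg_a n" for z f
    proof -
      obtain x y where xy: "z = (x, y)" "x \<in> alg_b n" "y \<in> alg_a n" using z by auto
      have "act (N_ba_rep n a1 a2) z f = gl_act m (x + y) f"
        by (simp add: N_ba_rep_def pullback_rep_def N_rep_def free_rep_def xy gl_act_def gl_unit_def)
      then show ?thesis using gl_act_add[OF mats(2,1)] xy by simp
    qed
    show "flinear (?\<tau> z)" for z
      by (cases z) (auto intro!: flinear_add flinear_gl_act)
  next
    have sum: "f \<in> {\<Sum>b\<in>S. t b | S t. finite S \<and> (\<forall>b\<in>S. t b \<in> ?I b)}" if f: "f \<in> N" for f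
    proof -
      have "N \<subseteq> fs.span {Xp k f | k f b. f \<in> K b}"
        using hwv_K diag2_K K_N by (intro N_span) (auto simp: b_unit_eq diag2_X_pow)
      then have "f \<in> fs.span {Xp k f | k f b. f \<in> K b}" using f by (rule subsetD)
      then obtain A t where A: "finite A" "\<And>p. t p \<in> K (fst p)" "\<And>p. p \<notin> A \<Longrightarrow> t p = 0"
        "f = (\<Sum>p\<in>A. (X ^^ snd p) (t p))"
        by (rule span_finite_sum[OF subspace_K]) (rule that; assumption)
      define l where "l = Suc (Max (snd ` A))"
      have l: "snd p < l" if "p \<in> A" for p
        using A(1) that by (simp add: l_def less_Suc_eq_le)
      have "f = (\<Sum>p\<in>fst ` A \<times> {..<l}. (X ^^ snd p) (t p))"
        unfolding A(4)
      proof (rule sum.mono_neutral_left)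
        show "A \<subseteq> fst ` A \<times> {..<l}" using l by force
        show "\<forall>p\<in>fst ` A \<times> {..<l} - A. (X ^^ snd p) (t p) = 0"
          using A(3) by (auto simp: flinear_simps[OF flinear_X_pow])
      qed (use A(1) in auto)
      also have "\<dots> = (\<Sum>b\<in>fst ` A. \<Sum>k<l. Xp k (t (b, k)))"
        by (simp add: sum.cartesian_product case_prod_beta)
      finally have "f = (\<Sum>b\<in>fst ` A. \<Sum>k<l. Xp k (t (b, k)))" .
      moreover have "(\<Sum>k<l. Xp k (t (b, k))) \<in> ?I b" for b
        using A(2)[of "(b, _)"] by (intro CollectI exI[of _ l] exI[of _ "\<lambda>k. t (b, k)"]) simp
      ultimately show ?thesis
        using A(1) by (intro CollectI exI[of _ "fst ` A"] exI[of _ "\<lambda>b. \<Sum>k<l. Xp k (t (b, k))"]) simp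
    qed
    have pieces: "h \<in> N" if "h \<in> ?I b" for b h
      using that by (auto intro!: fs.subspace_sum[OF subspace_supported] X_pow_N intro: K_N)
    have inN: "f \<in> N" if "f \<in> {\<Sum>b\<in>S. t b | S t. finite S \<and> (\<forall>b\<in>S. t b \<in> ?I b)}" for f
      using that
    proof (elim CollectE exE conjE)
      fix S t assume "f = (\<Sum>b\<in>S. t b)" "\<forall>b\<in>S. t b \<in> ?I b"
      then show "f \<in> N" by (simp only:) (rule fs.subspace_sum[OF subspace_supported], rule pieces, erule bspec)
    qed
    have "carrier (N_ba_rep n a1 a2) = N"
      by (simp add: N_ba_rep_def pullback_rep_def N_rep_def free_rep_def supported_def)
    then show "carrier (N_ba_rep n a1 a2) = {\<Sum>b\<in>S. t b | S t. finite S \<and> (\<forall>b\<in>S. t b \<in> ?I b)}"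
      using subsetI[of N, OF sum] subsetI[OF inN] by (simp only: subset_antisym)
  next
    fix S u c assume S: "finite S" "\<And>b. b \<in> S \<Longrightarrow> u b \<in> ?I b" "sum u S = 0" "c \<in> S"
    then have "\<forall>b\<in>S. \<exists>l t. u b = (\<Sum>k<l. Xp k (t k)) \<and> (\<forall>k. t k \<in> K b)" by blast
    then obtain l t where lt: "\<And>b. b \<in> S \<Longrightarrow> u b = (\<Sum>k<l b. Xp k (t b k))"
      "\<And>b k. b \<in> S \<Longrightarrow> t b k \<in> K b" by metis
    let ?t = "\<lambda>p. t (fst p) (snd p)"
    have "(\<Sum>p\<in>Sigma S (\<lambda>b. {..<l b}). (X ^^ snd p) (?t p)) = (\<Sum>b\<in>S. \<Sum>k<l b. Xp k (t b k))"
      using S(1) by (simp add: sum.Sigma case_prod_beta)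
    also have "\<dots> = 0" using lt(1) S(3) by simp
    finally have "?t p = 0" if "p \<in> Sigma S (\<lambda>b. {..<l b})" for p
      using X_pow_independent[of "Sigma S (\<lambda>b. {..<l b})" ?t p] lt(2) S(1) that by auto
    then have "t c k = 0" if "k < l c" for k using that S(4) by force
    then show "u c = 0" using lt(1)[OF S(4)] by (simp add: flinear_simps[OF flinear_X_pow])
  qed
qed

end

theorem theorem3p3:
  fixes n :: nat and a1 a2 :: complex
  assumes "n \<ge> 2" and "a1 \<notin> \<int>" and "a2 \<notin> \<int>" and "a1 - a2 \<notin> \<int>"
  shows "(n = 2 \<longrightarrow>
      isomorphic_rep (alg_b n \<times> alg_a n) (N_ba_rep n a1 a2)
        (direct_sum_rep (\<lambda>b::int.
          tensor_rep (L_b n [-1 - a1 + a2 - 2 * of_int b])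
                     (L_a n (a1 - a2 + 2 * of_int b - 1))))) \<and>
    (n > 2 \<longrightarrow>
      isomorphic_rep (alg_b n \<times> alg_a n) (N_ba_rep n a1 a2)
        (direct_sum_rep (\<lambda>b::int.
          tensor_rep (L_b n ([a2 - of_int b] @ replicate (n - 3) 0 @ [-1 - a1 - of_int b]))
                     (L_a n (a1 - a2 + 2 * of_int b - (of_nat n - 1))))))"
proof -
  interpret N_module n a1 a2 by unfold_locales (fact assms)+
  show ?thesis
  proof (intro conjI impI)
    assume 2: "n = 2"
    have "isomorphic_rep (alg_b n \<times> alg_a n) (N_ba_rep n a1 a2)
        (direct_sum_rep (\<lambda>b. tensor_rep (L_b n [-1 - a1 + a2 - 2 * of_int b]) (L_a n (H_weight b))))"
    proof (rule N_ba_decomposition)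
      fix b i assume "i < n - 1"
      then show "[-1 - a1 + a2 - 2 * of_int b] ! i =
          topv b $ i + topv b $ (n + i) - (topv b $ (i + 1) + topv b $ (n + (i + 1)))"
        unfolding topv_def using 2 by simp
    qed
    then show "isomorphic_rep (alg_b n \<times> alg_a n) (N_ba_rep n a1 a2)
        (direct_sum_rep (\<lambda>b::int.
          tensor_rep (L_b n [-1 - a1 + a2 - 2 * of_int b])
                     (L_a n (a1 - a2 + 2 * of_int b - 1))))"
      unfolding H_weight_def using 2 by simp
  next
    assume 3: "n > 2"
    show "isomorphic_rep (alg_b n \<times> alg_a n) (N_ba_rep n a1 a2)
        (direct_sum_rep (\<lambda>b::int.
          tensor_rep (L_b n ([a2 - of_int b] @ replicate (n - 3) 0 @ [-1 - a1 - of_int b]))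
                     (L_a n (a1 - a2 + 2 * of_int b - (of_nat n - 1)))))"
      unfolding H_weight_def[symmetric]
    proof (rule N_ba_decomposition)
      fix b i assume i: "i < n - 1"
      consider "i = 0" | "0 < i" "i < n - 2" | "i = n - 2" using i by linarith
      then show "([a2 - of_int b] @ replicate (n - 3) 0 @ [-1 - a1 - of_int b]) ! i =
          topv b $ i + topv b $ (n + i) - (topv b $ (i + 1) + topv b $ (n + (i + 1)))"
        using 3 by cases (auto simp: topv_def nth_append nth_Cons')
    qed
  qed
qed

end
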